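(* Let $1\le\alpha\le2$. There exists $C>0$ such that for all $u\in\mathcal{S}(\mathbb{R})$ and all $A>1$, $$\left\|\left[|D|^\alpha,\phi_{1,A}\right]u\right\|_{L^2}\leq C\left|\frac{1}{(1+\mu_1)^2}-\frac{1}{(1+\mu_2)^2}\right|^{\frac12}\left\|u\,\Phi_{1,A}\right\|_{H^1}.$$
   Context: $|D|^\alpha$ is the Fourier multiplier with symbol $|\xi|^\alpha$; $[\cdot,\cdot]$ is the commutator, with a function identified with the multiplication operator by it; $\langle s\rangle=(1+s^2)^{1/2}$. Let $$\phi(y)=\left(\int_{-\infty}^{+\infty}\frac{ds}{\langle s\rangle^{1+\alpha}}\right)^{-1}\int_y^{+\infty}\frac{ds}{\langle s\rangle^{1+\alpha}}.$$ For real numbers $\mu_1,\mu_2>-1$ (in the paper, the values at a fixed time of the modulation parameters, which are small), set $\phi_1(y)=\frac{1-\phi(y)}{(1+\mu_1)^2}+\frac{\phi(y)}{(1+\mu_2)^2}$, $\Phi_1(y)=\sqrt{|\phi_1'(y)|}$, $\phi_{1,A}(y)=\phi_1(y/A)$ and $\Phi_{1,A}(y)=\Phi_1(y/A)$. The constant $C$ depends only on $\alpha$. *)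

theory Defs
  imports "HOL-Analysis.Analysis"
begin

definition vderiv :: "(real \<Rightarrow> complex) \<Rightarrow> real \<Rightarrow> complex" where
  "vderiv f x = vector_derivative f (at x)"

definition schwartz :: "(real \<Rightarrow> complex) \<Rightarrow> bool" where
  "schwartz f \<longleftrightarrow>
     (\<forall>n x. (vderiv ^^ n) f differentiable (at x)) \<and>
     (\<forall>k n. bounded (range (\<lambda>x. complex_of_real (x ^ k) * (vderiv ^^ n) f x)))"

definition in_L2 :: "(real \<Rightarrow> complex) \<Rightarrow> bool" where
  "in_L2 f \<longleftrightarrow> f \<in> borel_measurable lborel \<and> integrable lborel (\<lambda>x. (cmod (f x))\<^sup>2)"

definition L2_norm :: "(real \<Rightarrow> complex) \<Rightarrow> real" where
  "L2_norm f = sqrt (LINT x|lborel. (cmod (f x))\<^sup>2)"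

text \<open>
  Only everywhere differentiable functions are considered here. If such a function and its
  pointwise derivative are square integrable, the pointwise derivative is also the weak one, so the
  function belongs to the Sobolev space and \<open>H1_norm\<close> is its usual norm. The integrals in
  \<open>L2_norm\<close> default to 0 on functions that are not square integrable, so an estimate between
  these norms has to be accompanied by \<open>in_L2\<close> and \<open>in_H1\<close>.
\<close>

definition in_H1 :: "(real \<Rightarrow> complex) \<Rightarrow> bool" where
  "in_H1 f \<longleftrightarrow> (\<forall>x. f differentiable (at x)) \<and> in_L2 f \<and> in_L2 (vderiv f)"

definition H1_norm :: "(real \<Rightarrow> complex) \<Rightarrow> real" where
  "H1_norm f = sqrt ((L2_norm f)\<^sup>2 + (L2_norm (vderiv f))\<^sup>2)"

definition fourier :: "(real \<Rightarrow> complex) \<Rightarrow> real \<Rightarrow> complex" where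
  "fourier f \<xi> = (LINT x|lborel. exp (- (\<i> * complex_of_real (x * \<xi>))) * f x)"

definition inv_fourier :: "(real \<Rightarrow> complex) \<Rightarrow> real \<Rightarrow> complex" where
  "inv_fourier g x =
     complex_of_real (1 / (2 * pi)) * (LINT \<xi>|lborel. exp (\<i> * complex_of_real (x * \<xi>)) * g \<xi>)"

definition fourier_multiplier ::
    "(real \<Rightarrow> complex) \<Rightarrow> (real \<Rightarrow> complex) \<Rightarrow> real \<Rightarrow> complex" where
  "fourier_multiplier m f = inv_fourier (\<lambda>\<xi>. m \<xi> * fourier f \<xi>)"

text \<open>
  For \<open>\<alpha> \<ge> 0\<close> and a Schwartz function \<open>f\<close> both integrals in \<open>abs_D \<alpha> f\<close> converge
  absolutely. The product of a Schwartz function with \<open>phi1_A\<close> below is a Schwartz function.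
\<close>

definition abs_D :: "real \<Rightarrow> (real \<Rightarrow> complex) \<Rightarrow> real \<Rightarrow> complex" where
  "abs_D \<alpha> = fourier_multiplier (\<lambda>\<xi>. complex_of_real (\<bar>\<xi>\<bar> powr \<alpha>))"

definition mult_op :: "(real \<Rightarrow> real) \<Rightarrow> (real \<Rightarrow> complex) \<Rightarrow> real \<Rightarrow> complex" where
  "mult_op g f x = complex_of_real (g x) * f x"

definition commutator ::
    "((real \<Rightarrow> complex) \<Rightarrow> real \<Rightarrow> complex) \<Rightarrow> ((real \<Rightarrow> complex) \<Rightarrow> real \<Rightarrow> complex) \<Rightarrow>
     (real \<Rightarrow> complex) \<Rightarrow> real \<Rightarrow> complex" where
  "commutator S T f x = S (T f) x - T (S f) x"

definition japanese :: "real \<Rightarrow> real" where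
  "japanese s = sqrt (1 + s\<^sup>2)"

definition phi :: "real \<Rightarrow> real \<Rightarrow> real" where
  "phi \<alpha> y =
     inverse (LINT s|lborel. 1 / japanese s powr (1 + \<alpha>)) *
     (LINT s:{y..}|lborel. 1 / japanese s powr (1 + \<alpha>))"

definition phi1 :: "real \<Rightarrow> real \<Rightarrow> real \<Rightarrow> real \<Rightarrow> real" where
  "phi1 \<alpha> \<mu>1 \<mu>2 y = (1 - phi \<alpha> y) / (1 + \<mu>1)\<^sup>2 + phi \<alpha> y / (1 + \<mu>2)\<^sup>2"

definition Phi1 :: "real \<Rightarrow> real \<Rightarrow> real \<Rightarrow> real \<Rightarrow> real" where
  "Phi1 \<alpha> \<mu>1 \<mu>2 y = sqrt \<bar>deriv (phi1 \<alpha> \<mu>1 \<mu>2) y\<bar>"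

definition phi1_A :: "real \<Rightarrow> real \<Rightarrow> real \<Rightarrow> real \<Rightarrow> real \<Rightarrow> real" where
  "phi1_A \<alpha> \<mu>1 \<mu>2 A y = phi1 \<alpha> \<mu>1 \<mu>2 (y / A)"

definition Phi1_A :: "real \<Rightarrow> real \<Rightarrow> real \<Rightarrow> real \<Rightarrow> real \<Rightarrow> real" where
  "Phi1_A \<alpha> \<mu>1 \<mu>2 A y = Phi1 \<alpha> \<mu>1 \<mu>2 (y / A)"

end

theory Submission
  imports Defs
    "HOL-Probability.Characteristic_Functions"
    "HOL-Probability.Sinc_Integral"
    "HOL-Real_Asymp.Real_Asymp"
begin

text \<open>
  Only the size of the profile and of its first two derivatives matters. With
  \<open>b = 1 / (1 + \<mu>\<^sub>1)\<^sup>2 - 1 / (1 + \<mu>\<^sub>2)\<^sup>2\<close> and \<open>\<langle>x\<rangle>\<close> for \<open>japanese x\<close>, the function \<open>\<phi>\<^sub>1\<close> has oscillation at most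
  \<open>\<bar>b\<bar>\<close>, its derivative is a constant times \<open>b \<langle>x\<rangle>\<close> to the power \<open>- 1 - \<alpha>\<close>, and its second
  derivative is at most \<open>1 + \<alpha>\<close> times the first one (\<open>phi1_weight_estimate\<close>). The weight \<open>\<Phi>\<^sub>1\<close> is a constant times
  \<open>\<bar>b\<bar>\<close> to the power \<open>1/2\<close> times \<open>\<langle>x\<rangle>\<close> to the power \<open>- \<beta>\<close>, where \<open>\<beta> = (1 + \<alpha>) / 2\<close>; a multiple of it bounds its own derivative, so
  \<open>\<parallel>u \<Phi>\<^sub>1\<parallel>\<close> in \<open>H\<^sup>1\<close> controls the \<open>L\<^sup>2\<close> norm of \<open>\<Phi>\<^sub>1 (\<bar>u\<bar> + \<bar>u'\<bar>)\<close> (\<open>weighted_size_le_H1\<close>). Of the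
  factor \<open>b\<close> that the commutator carries, one half is spent on \<open>\<Phi>\<^sub>1\<close> and one half remains.
  
  The parameter \<open>A\<close> is removed by scaling (\<open>commutator_scale\<close>): passing to \<open>u (A x)\<close> multiplies the
  \<open>L\<^sup>2\<close> norm of the commutator by \<open>A\<close> to the power \<open>\<alpha> - 1/2\<close> and the \<open>H\<^sup>1\<close> norm by at most \<open>A\<close> to the power \<open>1/2\<close>.
  Since \<open>\<alpha> \<ge> 1\<close> and \<open>A > 1\<close> this is favourable, and it suffices to treat \<open>A = 1\<close>.
  
  For \<open>\<alpha> = 2\<close> the commutator with \<open>g\<close> is \<open>- (g'' u + 2 g' u')\<close>. For \<open>\<alpha> < 2\<close>, Fourier inversion and
  the fact that \<open>\<bar>\<xi>\<bar> powr \<alpha>\<close> is a multiple of \<open>\<integral> (1 - cos (h \<xi>)) \<bar>h\<bar> powr (- 1 - \<alpha>) dh\<close> turn it into a multiple of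
  \<open>\<integral> (F h + F (- h)) / 2 * \<bar>h\<bar> powr (- 1 - \<alpha>) dh\<close> with \<open>F h = (g x - g (x + h)) u (x + h)\<close> (\<open>commutator_kernel\<close>).
  For \<open>\<bar>h\<bar> \<le> 1\<close> the sum \<open>F h + F (- h)\<close> is of second order in \<open>h\<close> although only one derivative falls
  on \<open>u\<close>; what comes out is a convolution of the weighted function with the integrable kernel
  \<open>\<bar>t\<bar> powr (- \<alpha> / 2)\<close>. For \<open>\<bar>h\<bar> > 1\<close> the kernel that acts on the weighted function is bounded by
  \<open>\<bar>x - y\<bar> powr (- 2)\<close> where \<open>\<bar>x - y\<bar>\<close> is small against \<open>max \<langle>x\<rangle> \<langle>y\<rangle>\<close>, and by \<open>1 / max \<langle>x\<rangle> \<langle>y\<rangle>\<close> elsewhere (\<open>far_kernel\<close>).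
  The last kernel has the critical degree \<open>- 1\<close> of homogeneity and is not dominated by an integrable
  convolution kernel; the Schur test with weight \<open>\<langle>y\<rangle> powr (- 1/2)\<close> bounds it on \<open>L\<^sup>2\<close>, as for
  Hilbert's inequality (\<open>hilbert_bound\<close>). Together these give \<open>commutator_L2\<close>.
\<close>

section \<open>Functions whose derivatives are dominated by a weight\<close>

text \<open>
  The recursion on the number of derivatives makes the Leibniz rule an induction. In the
  applications the weight \<open>\<rho>\<close> is either \<open>1\<close>, for the coefficients, or \<open>1 / (1 + x\<^sup>2)\<close>, for the functions on which the
  Fourier transform acts. Unlike the Schwartz space the latter class, with finitely many
  derivatives, comes with a single decay rate to check, and it contains the products of Schwartz
  functions with the profile and with its weight.
\<close>

primrec derivs_dominated :: "nat \<Rightarrow> (real \<Rightarrow> real) \<Rightarrow> (real \<Rightarrow> complex) \<Rightarrow> bool" where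
  "derivs_dominated 0 \<rho> f \<longleftrightarrow> continuous_on UNIV f \<and> (\<exists>M. \<forall>x. cmod (f x) \<le> M * \<rho> x)"
| "derivs_dominated (Suc n) \<rho> f \<longleftrightarrow>
     (\<forall>x. f differentiable at x) \<and> (\<exists>M. \<forall>x. cmod (f x) \<le> M * \<rho> x) \<and> derivs_dominated n \<rho> (vderiv f)"

lemma has_vderiv:
  "f differentiable at x \<Longrightarrow> (f has_vector_derivative vderiv f x) (at x)"
  by (simp add: vderiv_def vector_derivative_works[symmetric])

lemma vderiv_eqI:
  "(\<And>x. (f has_vector_derivative f' x) (at x)) \<Longrightarrow> vderiv f = f'"
  by (auto simp: vderiv_def fun_eq_iff intro: vector_derivative_at)

lemma differentiable_imp_continuous_UNIV:
  "(\<And>x. f differentiable at x) \<Longrightarrow> continuous_on UNIV (f :: real \<Rightarrow> complex)"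
  by (auto simp: continuous_on_eq_continuous_at intro: differentiable_imp_continuous_within)

lemma derivs_dominated_continuous: "derivs_dominated n \<rho> f \<Longrightarrow> continuous_on UNIV f"
  by (cases n) (auto intro: differentiable_imp_continuous_UNIV)

lemma derivs_dominated_bound: "derivs_dominated n \<rho> f \<Longrightarrow> \<exists>M. \<forall>x. cmod (f x) \<le> M * \<rho> x"
  by (cases n) auto

lemma derivs_dominated_Suc_D: "derivs_dominated (Suc n) \<rho> f \<Longrightarrow> derivs_dominated n \<rho> f"
proof (induction n arbitrary: f)
  case 0
  then show ?case by (auto intro: differentiable_imp_continuous_UNIV)
next
  case (Suc n)
  then show ?case by simp
qed

lemma derivs_dominated_antimono: assumes "derivs_dominated n \<rho> f" "m \<le> n" shows "derivs_dominated m \<rho> f"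
proof -
  have "derivs_dominated (m + k) \<rho> f \<Longrightarrow> derivs_dominated m \<rho> f" for k
    by (induction k) (use derivs_dominated_Suc_D in auto)
  then show ?thesis using assms le_Suc_ex by blast
qed

lemma derivs_dominated_weaken:
  assumes "derivs_dominated n \<rho> f" "\<And>x. \<rho> x \<le> K * \<sigma> x" "\<And>x. 0 \<le> \<rho> x"
  shows "derivs_dominated n \<sigma> f"
proof -
  have *: "\<exists>M. \<forall>x. cmod (f x) \<le> M * \<sigma> x" if B: "\<exists>M. \<forall>x. cmod (f x) \<le> M * \<rho> x" for f
  proof -
    obtain M where M: "\<And>x. cmod (f x) \<le> M * \<rho> x" using B by blast
    have "cmod (f x) \<le> (\<bar>M\<bar> * K) * \<sigma> x" for x
    proof -
      have "cmod (f x) \<le> \<bar>M\<bar> * \<rho> x"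
        by (rule order.trans[OF M]) (intro mult_right_mono, auto simp: assms)
      also have "\<dots> \<le> \<bar>M\<bar> * (K * \<sigma> x)" by (intro mult_left_mono assms) auto
      finally show ?thesis by (simp add: mult_ac)
    qed
    then show ?thesis by blast
  qed
  show ?thesis using assms(1) by (induction n arbitrary: f) (auto intro: *)
qed

lemma derivs_dominated_add: assumes "derivs_dominated n \<rho> f" "derivs_dominated n \<rho> g" shows "derivs_dominated n \<rho> (\<lambda>x. f x + g x)"
proof -
  have *: "\<exists>M. \<forall>x. cmod (f x + g x) \<le> M * \<rho> x"
    if B: "\<exists>M. \<forall>x. cmod (f x) \<le> M * \<rho> x" "\<exists>M. \<forall>x. cmod (g x) \<le> M * \<rho> x" for f g
  proof -
    obtain M N where "\<And>x. cmod (f x) \<le> M * \<rho> x" "\<And>x. cmod (g x) \<le> N * \<rho> x" using B by blast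
    then have "cmod (f x + g x) \<le> (M + N) * \<rho> x" for x
      by (smt (verit) norm_triangle_ineq distrib_right)
    then show ?thesis by blast
  qed
  show ?thesis using assms
  proof (induction n arbitrary: f g)
    case 0
    then show ?case using *[of f g] by (auto intro: continuous_intros)
  next
    case (Suc n)
    have "vderiv (\<lambda>x. f x + g x) = (\<lambda>x. vderiv f x + vderiv g x)"
      using Suc.prems by (intro vderiv_eqI has_vector_derivative_add) (auto intro: has_vderiv)
    then show ?case using *[of f g] Suc by auto
  qed
qed

lemma derivs_dominated_mult:
  assumes "derivs_dominated n \<rho> f" "derivs_dominated n \<sigma> g" "\<And>x. 0 \<le> \<rho> x" "\<And>x. 0 \<le> \<sigma> x"
  shows "derivs_dominated n (\<lambda>x. \<rho> x * \<sigma> x) (\<lambda>x. f x * g x)"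
proof -
  have *: "\<exists>M. \<forall>x. cmod (f x * g x) \<le> M * (\<rho> x * \<sigma> x)"
    if B: "\<exists>M. \<forall>x. cmod (f x) \<le> M * \<rho> x" "\<exists>M. \<forall>x. cmod (g x) \<le> M * \<sigma> x" for f g
  proof -
    obtain M N where "\<And>x. cmod (f x) \<le> M * \<rho> x" "\<And>x. cmod (g x) \<le> N * \<sigma> x" using B by blast
    then have "cmod (f x * g x) \<le> (M * \<rho> x) * (N * \<sigma> x)" for x
      unfolding norm_mult by (intro mult_mono) (auto intro: order.trans[OF norm_ge_zero])
    then have "cmod (f x * g x) \<le> (M * N) * (\<rho> x * \<sigma> x)" for x
      by (simp add: mult_ac)
    then show ?thesis by blast
  qed
  show ?thesis using assms(1,2)
  proof (induction n arbitrary: f g)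
    case 0
    then show ?case using *[of f g] by (auto intro: continuous_intros)
  next
    case (Suc n)
    have D: "vderiv (\<lambda>x. f x * g x) = (\<lambda>x. f x * vderiv g x + vderiv f x * g x)"
      using Suc.prems by (intro vderiv_eqI has_vector_derivative_mult) (auto intro: has_vderiv)
    have "derivs_dominated n (\<lambda>x. \<rho> x * \<sigma> x) (\<lambda>x. f x * vderiv g x + vderiv f x * g x)"
      using Suc.prems derivs_dominated_Suc_D[OF Suc.prems(1)] derivs_dominated_Suc_D[OF Suc.prems(2)]
      by (intro derivs_dominated_add Suc.IH) auto
    then show ?case using *[of f g] Suc.prems D by (auto intro: differentiable_mult)
  qed
qed

lemma vderiv_const: "vderiv (\<lambda>_. c) = (\<lambda>_. 0)"
  by (intro vderiv_eqI) auto

lemma derivs_dominated_const: "derivs_dominated n (\<lambda>_. 1) (\<lambda>_. c)"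
proof (induction n arbitrary: c)
  case 0 then show ?case by (auto intro: exI[of _ "cmod c"])
next
  case (Suc n) then show ?case by (auto simp: vderiv_const intro: exI[of _ "cmod c"])
qed

lemma derivs_dominated_cmult: "derivs_dominated n \<rho> f \<Longrightarrow> (\<And>x. 0 \<le> \<rho> x) \<Longrightarrow> derivs_dominated n \<rho> (\<lambda>x. c * f x)"
  using derivs_dominated_mult[OF derivs_dominated_const, of n \<rho> f c] by simp

lemma vderiv_scale:
  assumes "\<And>x. f differentiable at x"
  shows "vderiv (\<lambda>x. f (A * x)) = (\<lambda>x. complex_of_real A * vderiv f (A * x))"
proof (rule vderiv_eqI)
  fix x
  have "((\<lambda>x. A * x) has_vector_derivative A) (at x)"
    by (auto intro!: derivative_eq_intros)
  from vector_diff_chain_at[OF this, of f "vderiv f (A * x)"]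
  have "(f \<circ> (\<lambda>x. A * x) has_vector_derivative A *\<^sub>R vderiv f (A * x)) (at x)"
    using assms has_vderiv by blast
  then show "((\<lambda>x. f (A * x)) has_vector_derivative complex_of_real A * vderiv f (A * x)) (at x)"
    by (simp add: o_def scaleR_conv_of_real)
qed

lemma differentiable_scale:
  assumes "\<And>x. f differentiable at x"
  shows "(\<lambda>x. f (A * x)) differentiable at (x::real)"
proof -
  have "(\<lambda>x. A * x) differentiable at x" by (auto intro: derivative_intros)
  then show ?thesis
    using differentiable_chain_at[of "\<lambda>x. A * x" x f] assms by (simp add: o_def)
qed

lemma derivs_dominated_scale:
  assumes "derivs_dominated n \<rho> f" "\<And>x. 0 \<le> \<rho> x"
  shows "derivs_dominated n (\<lambda>x. \<rho> (A * x)) (\<lambda>x. f (A * x))"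
  using assms(1)
proof (induction n arbitrary: f)
  case 0
  then show ?case by (auto intro!: continuous_intros intro: continuous_on_compose2)
next
  case (Suc n)
  then show ?case
    by (auto simp: vderiv_scale intro!: differentiable_scale derivs_dominated_cmult assms)
qed

text \<open>
  These two functions and the powers \<open>bracket b\<close> below generate an algebra that is stable under
  differentiation: \<open>slope\<close> is half the logarithmic derivative of \<open>1 + x\<^sup>2\<close>. All their derivatives
  are therefore polynomials in bounded functions.
\<close>

definition inv_quad :: "real \<Rightarrow> real" where "inv_quad x = 1 / (1 + x\<^sup>2)"
definition slope :: "real \<Rightarrow> real" where "slope x = x / (1 + x\<^sup>2)"

lemma one_plus_sq_pos [simp]: "0 < 1 + (x::real)\<^sup>2"
  by (simp add: add_pos_nonneg)
lemma one_plus_sq_nz [simp]: "1 + (x::real)\<^sup>2 \<noteq> 0"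
  using one_plus_sq_pos[of x] by linarith

lemma inv_quad_nonneg [simp]: "0 \<le> inv_quad x" by (simp add: inv_quad_def add_nonneg_nonneg)
lemma inv_quad_le_1: "inv_quad x \<le> 1" by (simp add: inv_quad_def divide_simps)
lemma slope_le_1: "\<bar>slope x\<bar> \<le> 1"
proof -
  have "\<bar>x\<bar> \<le> 1 + x\<^sup>2"
    using zero_le_power2[of "\<bar>x\<bar> - 1"] by (simp add: power2_eq_square algebra_simps abs_mult_self_eq)
  then show ?thesis by (simp add: slope_def abs_divide divide_simps)
qed

lemma of_real_has_vderiv:
  "(f has_real_derivative d) (at x) \<Longrightarrow>
    ((\<lambda>x. complex_of_real (f x)) has_vector_derivative complex_of_real d) (at x)"
  unfolding has_real_derivative_iff_has_vector_derivative
  by (rule bounded_linear.has_vector_derivative[OF bounded_linear_of_real])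

lemma vderiv_of_real:
  assumes "\<And>x. (f has_real_derivative f' x) (at x)"
  shows "vderiv (\<lambda>x. complex_of_real (f x)) = (\<lambda>x. complex_of_real (f' x))"
    and "(\<lambda>x. complex_of_real (f x)) differentiable at x"
  using of_real_has_vderiv[OF assms]
  by (auto intro!: vderiv_eqI intro: differentiableI_vector)

lemma inv_quad_deriv: "(inv_quad has_real_derivative -2 * (slope x * inv_quad x)) (at x)"
proof -
  have "(inv_quad has_real_derivative - (2 * x) / ((1 + x\<^sup>2) * (1 + x\<^sup>2))) (at x)"
    unfolding inv_quad_def by (auto intro!: derivative_eq_intros)
  then show ?thesis by (simp add: inv_quad_def slope_def)
qed

lemma slope_deriv: "(slope has_real_derivative inv_quad x + (- 2) * (slope x * slope x)) (at x)"
proof -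
  have "(slope has_real_derivative ((1 + x\<^sup>2) - x * (2 * x)) / ((1 + x\<^sup>2) * (1 + x\<^sup>2))) (at x)"
    unfolding slope_def by (auto intro!: derivative_eq_intros)
  moreover have "((1 + x\<^sup>2) - x * (2 * x)) / ((1 + x\<^sup>2) * (1 + x\<^sup>2)) = inv_quad x + (- 2) * (slope x * slope x)"
    by (simp add: inv_quad_def slope_def diff_divide_distrib)
  ultimately show ?thesis by simp
qed

text \<open>
  The two claims are proved by one induction because each derivative involves both functions.
\<close>

lemma derivs_dominated_rational: "derivs_dominated n (\<lambda>_. 1) (\<lambda>x. complex_of_real (inv_quad x)) \<and> derivs_dominated n (\<lambda>_. 1) (\<lambda>x. complex_of_real (slope x))"
proof (induction n)
  case 0
  have "continuous_on UNIV inv_quad" "continuous_on UNIV slope"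
    unfolding inv_quad_def slope_def by (auto intro!: continuous_intros)
  then show ?case
    by (auto intro!: continuous_intros exI[of _ 1] inv_quad_le_1 slope_le_1)
next
  case (Suc n)
  note prod = derivs_dominated_mult[of n "\<lambda>_. 1" _ "\<lambda>_. 1", simplified]
  have "derivs_dominated n (\<lambda>_. 1) (\<lambda>x. complex_of_real (- 2 * (slope x * inv_quad x)))"
    using derivs_dominated_cmult[OF prod, of "\<lambda>x. complex_of_real (slope x)" "\<lambda>x. complex_of_real (inv_quad x)" "-2"] Suc
    by simp
  moreover have "derivs_dominated n (\<lambda>_. 1) (\<lambda>x. complex_of_real (inv_quad x + (- 2) * (slope x * slope x)))"
    using derivs_dominated_add[OF _ derivs_dominated_cmult[OF prod, of "\<lambda>x. complex_of_real (slope x)" "\<lambda>x. complex_of_real (slope x)" "-2"],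
        of "\<lambda>x. complex_of_real (inv_quad x)"] Suc
    by simp
  ultimately show ?case
    using vderiv_of_real[OF inv_quad_deriv] vderiv_of_real[OF slope_deriv]
    by (auto intro!: exI[of _ 1] inv_quad_le_1 slope_le_1)
qed

definition bracket :: "real \<Rightarrow> real \<Rightarrow> real" where "bracket b x = (1 + x\<^sup>2) powr (- b)"

lemma bracket_pos [simp]: "0 < bracket b x" by (simp add: bracket_def)
lemma bracket_nonneg [simp]: "0 \<le> bracket b x" by (simp add: bracket_def)

lemma bracket_le_1: "0 \<le> b \<Longrightarrow> bracket b x \<le> 1"
  unfolding bracket_def using powr_mono[of "-b" 0 "1+x\<^sup>2"] by simp

lemma bracket_deriv: "(bracket b has_real_derivative (- 2 * b) * (slope x * bracket b x)) (at x)"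
proof -
  have "(bracket b has_real_derivative (- b) * (1 + x\<^sup>2) powr (- b - 1) * (2 * x)) (at x)"
    unfolding bracket_def by (auto intro!: derivative_eq_intros)
  moreover have "(1 + x\<^sup>2) powr (- b - 1) = (1 + x\<^sup>2) powr (- b) / (1 + x\<^sup>2)"
    by (simp add: powr_diff)
  ultimately show ?thesis by (simp add: slope_def bracket_def mult_ac)
qed

lemma continuous_bracket [continuous_intros]: "continuous_on S (bracket b)"
  unfolding bracket_def by (auto intro!: continuous_intros)

lemma derivs_dominated_bracket: assumes "0 \<le> b" shows "derivs_dominated n (\<lambda>_. 1) (\<lambda>x. complex_of_real (bracket b x))"
proof (induction n)
  case 0
  show ?case using assms
    by (auto intro!: continuous_intros exI[of _ 1] bracket_le_1)
next
  case (Suc n)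
  note prod = derivs_dominated_mult[of n "\<lambda>_. 1" _ "\<lambda>_. 1", simplified]
  have "derivs_dominated n (\<lambda>_. 1) (\<lambda>x. complex_of_real (- 2 * b * (slope x * bracket b x)))"
    using derivs_dominated_cmult[OF prod, of "\<lambda>x. complex_of_real (slope x)" "\<lambda>x. complex_of_real (bracket b x)" "-2*b"]
      Suc derivs_dominated_rational[of n] by simp
  then show ?case
    using vderiv_of_real[OF bracket_deriv[of b]] by (auto intro!: exI[of _ 1] bracket_le_1 assms)
qed

lemma schwartz_derivs_dominated: assumes "schwartz u" shows "derivs_dominated n inv_quad u"
proof -
  have B: "\<exists>M. \<forall>x. cmod ((vderiv ^^ m) u x) \<le> M * inv_quad x" for m
  proof -
    have "bounded (range (\<lambda>x. complex_of_real (x ^ 0) * (vderiv ^^ m) u x))"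
         "bounded (range (\<lambda>x. complex_of_real (x ^ 2) * (vderiv ^^ m) u x))"
      using assms unfolding schwartz_def by blast+
    then obtain M N where
      M: "\<And>x. cmod (complex_of_real (x ^ 0) * (vderiv ^^ m) u x) \<le> M" and
      N: "\<And>x. cmod (complex_of_real (x ^ 2) * (vderiv ^^ m) u x) \<le> N"
      unfolding bounded_iff by blast
    have "cmod ((vderiv ^^ m) u x) \<le> (M + N) * inv_quad x" for x
    proof -
      have "cmod ((vderiv ^^ m) u x) * (1 + x\<^sup>2) \<le> M + N"
        using M[of x] N[of x] by (simp add: norm_mult norm_power algebra_simps)
      then show ?thesis by (simp add: inv_quad_def pos_le_divide_eq)
    qed
    then show ?thesis by blast
  qed
  have D: "(vderiv ^^ m) u differentiable at x" for m x
    using assms unfolding schwartz_def by blast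
  have "derivs_dominated n inv_quad ((vderiv ^^ m) u)" for m
  proof (induction n arbitrary: m)
    case 0
    then show ?case using B[of m] D[of m] by (auto intro: differentiable_imp_continuous_UNIV)
  next
    case (Suc n)
    show ?case using B[of m] D[of m] Suc[of "Suc m"] by auto
  qed
  from this[of 0] show ?thesis by simp
qed

section \<open>The Fourier transform and its inversion\<close>

lemma integrable_inv_quad: "integrable lborel inv_quad"
  using integrable_inverse_1_plus_square
  by (simp add: set_integrable_def inv_quad_def[abs_def] inverse_eq_divide)

lemma inv_quad_measurable [measurable]: "inv_quad \<in> borel_measurable borel"
  unfolding inv_quad_def[abs_def] by measurable

lemma derivs_dominated_measurable: "derivs_dominated n \<rho> f \<Longrightarrow> f \<in> borel_measurable borel"
  using derivs_dominated_continuous borel_measurable_continuous_onI by blast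

lemma integrable_dominated:
  fixes f :: "real \<Rightarrow> complex"
  assumes [measurable]: "f \<in> borel_measurable borel" and "\<And>x. cmod (f x) \<le> M * inv_quad x"
  shows "integrable lborel f"
proof (rule Bochner_Integration.integrable_bound)
  show "integrable lborel (\<lambda>x. M * inv_quad x)" using integrable_inv_quad by simp
  show "AE x in lborel. norm (f x) \<le> norm (M * inv_quad x)"
    using assms(2) by (auto intro: order.trans[OF _ abs_ge_self])
qed simp

lemma derivs_dominated_integrable: "derivs_dominated n inv_quad f \<Longrightarrow> integrable lborel f"
  using derivs_dominated_bound derivs_dominated_measurable integrable_dominated by metis

lemma cmod_exp_i [simp]: "cmod (exp (\<i> * complex_of_real t)) = 1" "cmod (exp (- (\<i> * complex_of_real t))) = 1"
  by (simp_all add: norm_exp_eq_Re)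

lemma integrable_exp_mult:
  assumes "integrable lborel f"
  shows "integrable lborel (\<lambda>x. exp (- (\<i> * complex_of_real (x * \<xi>))) * f x)"
    and "integrable lborel (\<lambda>x. exp (\<i> * complex_of_real (\<xi> * x)) * f x)"
proof -
  have [measurable]: "f \<in> borel_measurable lborel" using assms by auto
  show "integrable lborel (\<lambda>x. exp (- (\<i> * complex_of_real (x * \<xi>))) * f x)"
    "integrable lborel (\<lambda>x. exp (\<i> * complex_of_real (\<xi> * x)) * f x)"
    by (rule Bochner_Integration.integrable_bound[OF assms], simp, simp add: norm_mult del: of_real_mult)+
qed

lemma inv_quad_at_infinity: "(inv_quad \<longlongrightarrow> 0) at_top" "(inv_quad \<longlongrightarrow> 0) at_bot"
  unfolding inv_quad_def[abs_def] by real_asymp+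

lemma LINT_vderiv_eq_0:
  assumes F: "\<And>x. (F has_vector_derivative F' x) (at x)"
    and cont: "continuous_on UNIV F'" and int: "integrable lborel F'"
    and M: "\<And>x. cmod (F x) \<le> M * inv_quad x"
  shows "(LINT x|lborel. F' x) = 0"
proof -
  have lim: "(F \<longlongrightarrow> 0) at_top" "(F \<longlongrightarrow> 0) at_bot"
  proof -
    have "(F \<longlongrightarrow> 0) net" if "(inv_quad \<longlongrightarrow> 0) net" for net
      by (rule Lim_null_comparison[OF _ tendsto_mult_right_zero[OF that, of M]]) (simp add: M)
    then show "(F \<longlongrightarrow> 0) at_top" "(F \<longlongrightarrow> 0) at_bot" using inv_quad_at_infinity by blast+
  qed
  have "(LBINT x=-\<infinity>..\<infinity>. F' x) = 0 - 0"
    by (rule interval_integral_FTC_integrable[where F=F])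
       (use F cont int lim in \<open>auto simp: set_integrable_def continuous_on_eq_continuous_at ereal_tendsto_simps\<close>)
  then show ?thesis by (simp add: interval_lebesgue_integral_def set_lebesgue_integral_def)
qed

lemma fourier_vderiv:
  assumes "derivs_dominated (Suc n) inv_quad f"
  shows "fourier (vderiv f) \<xi> = \<i> * complex_of_real \<xi> * fourier f \<xi>"
proof -
  define e where "e = (\<lambda>x::real. exp (- (\<i> * complex_of_real (x * \<xi>))))"
  have f: "integrable lborel f" "continuous_on UNIV f" "\<And>x. f differentiable at x"
    using derivs_dominated_integrable[OF assms] derivs_dominated_continuous[OF assms] assms by auto
  have f': "integrable lborel (vderiv f)" "continuous_on UNIV (vderiv f)"
    using derivs_dominated_integrable[of n "vderiv f"] derivs_dominated_continuous[of n inv_quad "vderiv f"] assms by auto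
  obtain M where M: "\<And>x. cmod (f x) \<le> M * inv_quad x" using derivs_dominated_bound[OF assms] by blast
  have e': "(e has_vector_derivative (- \<i> * \<xi>) * e x) (at x)" for x
    unfolding e_def
    by (auto intro!: derivative_eq_intros has_vector_derivative_real_field simp: mult_ac)
  have e_cont: "continuous_on UNIV e" unfolding e_def by (intro continuous_intros)
  have int: "integrable lborel (\<lambda>x. e x * vderiv f x)" "integrable lborel (\<lambda>x. e x * f x)"
    unfolding e_def by (intro integrable_exp_mult f f')+
  have int2: "integrable lborel (\<lambda>x. (- \<i> * \<xi>) * (e x * f x))" using int by auto
  have "(LINT x|lborel. e x * vderiv f x + (- \<i> * \<xi>) * e x * f x) = 0"
  proof (rule LINT_vderiv_eq_0)
    show "((\<lambda>x. e x * f x) has_vector_derivative e x * vderiv f x + (- \<i> * \<xi>) * e x * f x) (at x)" for x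
      using f(3) by (intro has_vector_derivative_mult e' has_vderiv)
    show "continuous_on UNIV (\<lambda>x. e x * vderiv f x + (- \<i> * \<xi>) * e x * f x)"
      by (intro continuous_intros e_cont f f')
    show "integrable lborel (\<lambda>x. e x * vderiv f x + (- \<i> * \<xi>) * e x * f x)"
      using Bochner_Integration.integrable_add[OF int(1) int2] by (simp add: mult_ac)
    show "cmod (e x * f x) \<le> M * inv_quad x" for x
      using M by (simp add: norm_mult e_def del: of_real_mult)
  qed
  also have "(LINT x|lborel. e x * vderiv f x + (- \<i> * \<xi>) * e x * f x)
      = (LINT x|lborel. e x * vderiv f x) + (LINT x|lborel. (- \<i> * \<xi>) * (e x * f x))"
    by (subst Bochner_Integration.integral_add[OF int(1) int2, symmetric]) (simp add: mult_ac)
  also have "\<dots> = fourier (vderiv f) \<xi> + (- \<i> * \<xi>) * fourier f \<xi>"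
    by (subst integral_mult_right_zero) (simp add: fourier_def e_def)
  finally show ?thesis by (simp add: algebra_simps)
qed

lemma fourier_diff:
  assumes "integrable lborel f" "integrable lborel g"
  shows "fourier (\<lambda>x. f x - g x) \<xi> = fourier f \<xi> - fourier g \<xi>"
  unfolding fourier_def right_diff_distrib
  by (intro Bochner_Integration.integral_diff integrable_exp_mult assms)

lemma fourier_bounded:
  assumes "integrable lborel f"
  shows "cmod (fourier f \<xi>) \<le> (LINT x|lborel. cmod (f x))"
proof -
  have "cmod (fourier f \<xi>) \<le> (LINT x|lborel. cmod (exp (- (\<i> * complex_of_real (x * \<xi>))) * f x))"
    unfolding fourier_def by (rule integral_norm_bound)
  then show ?thesis by (simp add: norm_mult del: of_real_mult)
qed

lemma fourier_measurable [measurable]: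
  assumes [measurable]: "f \<in> borel_measurable borel"
  shows "fourier f \<in> borel_measurable borel"
  unfolding fourier_def by measurable

text \<open>
  Decay of the Fourier transform comes from \<open>1 - \<partial>\<^sup>2\<close>, whose symbol \<open>1 + \<xi>\<^sup>2\<close> vanishes nowhere, so that
  low frequencies need no separate treatment.
\<close>

lemma fourier_bessel:
  assumes "derivs_dominated (Suc (Suc n)) inv_quad f"
  shows "fourier (\<lambda>x. f x - vderiv (vderiv f) x) \<xi> = complex_of_real (1 + \<xi>\<^sup>2) * fourier f \<xi>"
    and "derivs_dominated n inv_quad (\<lambda>x. f x - vderiv (vderiv f) x)"
proof -
  have 1: "derivs_dominated n inv_quad f" "derivs_dominated (Suc n) inv_quad (vderiv f)" "derivs_dominated n inv_quad (vderiv (vderiv f))"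
    using assms derivs_dominated_antimono[OF assms, of n] by auto
  have "fourier (vderiv (vderiv f)) \<xi> = \<i> * complex_of_real \<xi> * (\<i> * complex_of_real \<xi> * fourier f \<xi>)"
    using fourier_vderiv[OF 1(2)] fourier_vderiv[OF assms] by simp
  also have "\<dots> = (\<i> * \<i>) * (complex_of_real \<xi> * complex_of_real \<xi>) * fourier f \<xi>"
    by (simp only: mult_ac)
  also have "\<dots> = - complex_of_real (\<xi>\<^sup>2) * fourier f \<xi>"
    by (simp add: power2_eq_square)
  finally show "fourier (\<lambda>x. f x - vderiv (vderiv f) x) \<xi> = complex_of_real (1 + \<xi>\<^sup>2) * fourier f \<xi>"
    by (subst fourier_diff) (use 1 in \<open>auto intro: derivs_dominated_integrable simp: algebra_simps\<close>)
  show "derivs_dominated n inv_quad (\<lambda>x. f x - vderiv (vderiv f) x)"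
    using derivs_dominated_add[OF 1(1) derivs_dominated_cmult[OF 1(3), of "-1"]] by simp
qed

lemma fourier_decay_2:
  assumes "derivs_dominated (Suc (Suc n)) inv_quad f"
  obtains M where "\<And>\<xi>. cmod (fourier f \<xi>) \<le> M * inv_quad \<xi>"
proof -
  define M where "M = (LINT x|lborel. cmod (f x - vderiv (vderiv f) x))"
  have "cmod (fourier f \<xi>) \<le> M * inv_quad \<xi>" for \<xi>
  proof -
    have "(1 + \<xi>\<^sup>2) * cmod (fourier f \<xi>) = cmod (complex_of_real (1 + \<xi>\<^sup>2) * fourier f \<xi>)"
      unfolding norm_mult norm_of_real by simp
    also have "\<dots> \<le> M"
      unfolding M_def fourier_bessel(1)[OF assms, symmetric]
      by (intro fourier_bounded derivs_dominated_integrable[OF fourier_bessel(2)[OF assms]])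
    finally show ?thesis by (simp add: inv_quad_def pos_le_divide_eq mult_ac)
  qed
  then show ?thesis by (rule that)
qed

text \<open>
  This is the decay that makes \<open>\<bar>\<xi>\<bar> powr \<alpha>\<close> times the Fourier transform integrable for
  \<open>0 \<le> \<alpha> \<le> 2\<close>; it is the reason for asking for four derivatives throughout.
\<close>

lemma fourier_decay_4:
  assumes "derivs_dominated 4 inv_quad f"
  obtains M where "\<And>\<xi>. (1 + \<xi>\<^sup>2) * cmod (fourier f \<xi>) \<le> M * inv_quad \<xi>"
proof -
  have 4: "4 = Suc (Suc (Suc (Suc 0)))" by simp
  note d = assms[unfolded 4]
  obtain M where M: "\<And>\<xi>. cmod (fourier (\<lambda>x. f x - vderiv (vderiv f) x) \<xi>) \<le> M * inv_quad \<xi>"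
    using fourier_decay_2[OF fourier_bessel(2)[OF d]] by blast
  have "(1 + \<xi>\<^sup>2) * cmod (fourier f \<xi>) = cmod (complex_of_real (1 + \<xi>\<^sup>2) * fourier f \<xi>)" for \<xi>
    unfolding norm_mult norm_of_real by simp
  then have "(1 + \<xi>\<^sup>2) * cmod (fourier f \<xi>) \<le> M * inv_quad \<xi>" for \<xi>
    using M[of \<xi>] by (simp add: fourier_bessel(1)[OF d])
  then show ?thesis by (rule that)
qed

text \<open>
  The Gaussian is its own Fourier transform; this is the characteristic function of the standard
  normal distribution.
\<close>

lemma gaussian_fourier:
  "(LINT z|lborel. exp (\<i> * complex_of_real (t * z)) * complex_of_real (std_normal_density z))
    = complex_of_real (sqrt (2 * pi) * std_normal_density t)"
proof -
  have "complex_of_real (exp (- (t^2) / 2)) = char std_normal_distribution t"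
    by (simp add: char_std_normal_distribution)
  also have "\<dots> = (LINT z|lborel. std_normal_density z *\<^sub>R iexp (t * z))"
    unfolding char_def by (subst integral_density) (auto simp: normal_density_nonneg)
  also have "\<dots> = (LINT z|lborel. exp (\<i> * complex_of_real (t * z)) * complex_of_real (std_normal_density z))"
    by (simp add: scaleR_conv_of_real mult_ac)
  finally show ?thesis by (simp add: std_normal_density_def del: of_real_mult)
qed

lemma gaussian_fourier_scaled:
  assumes "0 < \<epsilon>"
  shows "(LINT \<xi>|lborel. exp (\<i> * complex_of_real (t * \<xi>)) * complex_of_real (std_normal_density (\<epsilon> * \<xi>)))
    = complex_of_real (sqrt (2 * pi) / \<epsilon> * std_normal_density (t / \<epsilon>))"
proof -
  have "(LINT \<xi>|lborel. exp (\<i> * complex_of_real (t * \<xi>)) * complex_of_real (std_normal_density (\<epsilon> * \<xi>)))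
    = (1 / \<epsilon>) *\<^sub>R (LINT z|lborel. exp (\<i> * complex_of_real (t / \<epsilon> * z)) * complex_of_real (std_normal_density z))"
    using assms
    by (subst lborel_integral_real_affine[of "1 / \<epsilon>" _ 0]) auto
  then show ?thesis
    unfolding gaussian_fourier by (simp add: scaleR_conv_of_real)
qed

lemma std_normal_density_le_1: "std_normal_density z \<le> 1"
proof -
  have "1 / sqrt (2 * pi) \<le> 1" using pi_gt3 by (simp add: real_le_rsqrt)
  moreover have "exp (- z\<^sup>2 / 2) \<le> (1::real)" by simp
  ultimately show ?thesis
    unfolding std_normal_density_def using mult_mono[of "1 / sqrt (2 * pi)" 1 "exp (- z\<^sup>2 / 2)" 1] by simp
qed

text \<open>
  The Gaussian factor makes the double integral over \<open>\<xi>\<close> and \<open>y\<close> absolutely convergent. After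
  exchanging the two integrals, the \<open>\<xi>\<close>-integral is, as a function of \<open>y\<close>, a Gaussian of width \<open>\<epsilon>\<close>
  centred at \<open>x\<close>.
\<close>

lemma smoothed_fourier_inversion:
  assumes "integrable lborel f" "0 < \<epsilon>"
  shows "(LINT \<xi>|lborel. complex_of_real (std_normal_density (\<epsilon> * \<xi>)) * (exp (\<i> * complex_of_real (x * \<xi>)) * fourier f \<xi>))
    = complex_of_real (sqrt (2 * pi)) * (LINT z|lborel. complex_of_real (std_normal_density z) * f (x + \<epsilon> * z))"
proof -
  have [measurable]: "f \<in> borel_measurable borel" using assms(1) by auto
  define G where "G = (\<lambda>\<xi> y. complex_of_real (std_normal_density (\<epsilon> * \<xi>)) *
      (exp (\<i> * complex_of_real ((x - y) * \<xi>)) * f y))"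
  have intG: "integrable lborel (\<lambda>\<xi>. std_normal_density (\<epsilon> * \<xi>))"
    using lborel_integrable_real_affine[OF integrable_normal_density[of 1 0], of \<epsilon> 0] assms by simp
  have "integrable (lborel \<Otimes>\<^sub>M lborel) (\<lambda>(\<xi>, y). G \<xi> y)"
  proof (rule lborel_pair.Fubini_integrable)
    show "(\<lambda>(\<xi>, y). G \<xi> y) \<in> borel_measurable (lborel \<Otimes>\<^sub>M lborel)"
      unfolding G_def by measurable
    have eq: "(LINT y|lborel. norm (case (\<xi>, y) of (\<xi>, y) \<Rightarrow> G \<xi> y))
        = std_normal_density (\<epsilon> * \<xi>) * (LINT y|lborel. cmod (f y))" for \<xi>
      unfolding G_def by (simp add: norm_mult del: of_real_mult)
    show "integrable lborel (\<lambda>\<xi>. LINT y|lborel. norm (case (\<xi>, y) of (\<xi>, y) \<Rightarrow> G \<xi> y))"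
      unfolding eq using intG by simp
    show "AE \<xi> in lborel. integrable lborel (\<lambda>y. case (\<xi>, y) of (\<xi>, y) \<Rightarrow> G \<xi> y)"
    proof (rule AE_I2)
      fix \<xi>
      show "integrable lborel (\<lambda>y. case (\<xi>, y) of (\<xi>, y) \<Rightarrow> G \<xi> y)"
        unfolding G_def split
        by (intro integrable_mult_right, rule Bochner_Integration.integrable_bound[OF assms(1)])
           (auto simp: norm_mult simp del: of_real_mult)
    qed
  qed
  then have swap: "(LINT \<xi>|lborel. LINT y|lborel. G \<xi> y) = (LINT y|lborel. LINT \<xi>|lborel. G \<xi> y)"
    by (rule lborel_pair.Fubini_integral[symmetric])
  have inner: "(LINT \<xi>|lborel. G \<xi> y) = f y * complex_of_real (sqrt (2 * pi) / \<epsilon> * std_normal_density ((x - y) / \<epsilon>))" for y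
  proof -
    have "(LINT \<xi>|lborel. G \<xi> y) = (LINT \<xi>|lborel. f y * (exp (\<i> * complex_of_real ((x - y) * \<xi>)) * complex_of_real (std_normal_density (\<epsilon> * \<xi>))))"
      unfolding G_def by (simp add: mult_ac)
    then show ?thesis
      unfolding integral_mult_right_zero gaussian_fourier_scaled[OF assms(2)] .
  qed
  have "(LINT \<xi>|lborel. complex_of_real (std_normal_density (\<epsilon> * \<xi>)) * (exp (\<i> * complex_of_real (x * \<xi>)) * fourier f \<xi>))
      = (LINT \<xi>|lborel. LINT y|lborel. G \<xi> y)"
  proof (rule Bochner_Integration.integral_cong[OF refl])
    fix \<xi>
    have "exp (\<i> * complex_of_real ((x - y) * \<xi>)) =
        exp (\<i> * complex_of_real (x * \<xi>)) * exp (- (\<i> * complex_of_real (y * \<xi>)))" for y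
      by (simp add: exp_add[symmetric] algebra_simps)
    then show "complex_of_real (std_normal_density (\<epsilon> * \<xi>)) * (exp (\<i> * complex_of_real (x * \<xi>)) * fourier f \<xi>)
        = (LINT y|lborel. G \<xi> y)"
      unfolding G_def fourier_def integral_mult_right_zero[symmetric] by (simp only: mult.assoc)
  qed
  also note swap
  also have "(LINT y|lborel. LINT \<xi>|lborel. G \<xi> y)
      = (LINT y|lborel. f y * complex_of_real (sqrt (2 * pi) / \<epsilon> * std_normal_density ((x - y) / \<epsilon>)))"
    unfolding inner ..
  also have "(LINT y|lborel. f y * complex_of_real (sqrt (2 * pi) / \<epsilon> * std_normal_density ((x - y) / \<epsilon>)))
     = \<epsilon> *\<^sub>R (LINT z|lborel. f (x + \<epsilon> * z) * complex_of_real (sqrt (2 * pi) / \<epsilon> * std_normal_density z))"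
    using assms(2)
    by (subst lborel_integral_real_affine[of \<epsilon> _ x]) (auto simp: std_normal_density_def)
  also have "\<dots> = \<epsilon> *\<^sub>R (LINT z|lborel. complex_of_real (sqrt (2 * pi) / \<epsilon>) * (complex_of_real (std_normal_density z) * f (x + \<epsilon> * z)))"
    by (simp add: mult_ac)
  also have "\<dots> = complex_of_real (sqrt (2 * pi)) * (LINT z|lborel. complex_of_real (std_normal_density z) * f (x + \<epsilon> * z))"
    unfolding integral_mult_right_zero using assms(2) by (simp add: scaleR_conv_of_real)
  finally show ?thesis .
qed

text \<open>
  As \<open>\<epsilon>\<close> tends to 0 in \<open>smoothed_fourier_inversion\<close>, the left-hand side tends to the inversion integral
  and the right-hand side, an average of \<open>f\<close> near \<open>x\<close>, to a multiple of \<open>f x\<close>.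
\<close>

theorem fourier_inversion:
  assumes int: "integrable lborel f" and cont: "continuous_on UNIV f" and bd: "\<And>x. cmod (f x) \<le> B"
    and int': "integrable lborel (fourier f)"
  shows "inv_fourier (fourier f) x = f x"
proof -
  have [measurable]: "f \<in> borel_measurable borel" using int by auto
  \<comment> \<open>Dominated convergence is a statement about sequences, so the width runs through a null sequence.\<close>
  define \<epsilon> :: "nat \<Rightarrow> real" where "\<epsilon> n = 1 / Suc n" for n
  have \<epsilon>: "0 < \<epsilon> n" for n by (simp add: \<epsilon>_def)
  have \<epsilon>0: "\<epsilon> \<longlonglongrightarrow> 0" unfolding \<epsilon>_def using LIMSEQ_inverse_real_of_nat by (simp add: inverse_eq_divide)
  define g where "g = (\<lambda>\<xi>. exp (\<i> * complex_of_real (x * \<xi>)) * fourier f \<xi>)"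
  have g: "integrable lborel g" unfolding g_def by (rule integrable_exp_mult(2)[OF int'])
  then have [measurable]: "g \<in> borel_measurable borel" by auto
  have "(\<lambda>n. LINT \<xi>|lborel. complex_of_real (std_normal_density (\<epsilon> n * \<xi>)) * g \<xi>)
      \<longlonglongrightarrow> (LINT \<xi>|lborel. complex_of_real (std_normal_density 0) * g \<xi>)"
  proof (rule integral_dominated_convergence[where w="\<lambda>\<xi>. cmod (g \<xi>)"])
    show "AE \<xi> in lborel. (\<lambda>n. complex_of_real (std_normal_density (\<epsilon> n * \<xi>)) * g \<xi>)
        \<longlonglongrightarrow> complex_of_real (std_normal_density 0) * g \<xi>"
    proof (rule AE_I2)
      fix \<xi>
      have "(\<lambda>n. std_normal_density (\<epsilon> n * \<xi>)) \<longlonglongrightarrow> std_normal_density (0 * \<xi>)"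
        unfolding std_normal_density_def by (intro tendsto_intros \<epsilon>0)
           auto
      then show "(\<lambda>n. complex_of_real (std_normal_density (\<epsilon> n * \<xi>)) * g \<xi>)
        \<longlonglongrightarrow> complex_of_real (std_normal_density 0) * g \<xi>"
        by (intro tendsto_intros) simp
    qed
    show "AE \<xi> in lborel. norm (complex_of_real (std_normal_density (\<epsilon> n * \<xi>)) * g \<xi>) \<le> cmod (g \<xi>)" for n
      using mult_right_mono[OF std_normal_density_le_1] by (auto simp: norm_mult)
  qed (use g in auto)
  also have "(\<lambda>n. LINT \<xi>|lborel. complex_of_real (std_normal_density (\<epsilon> n * \<xi>)) * g \<xi>)
     = (\<lambda>n. complex_of_real (sqrt (2 * pi)) * (LINT z|lborel. complex_of_real (std_normal_density z) * f (x + \<epsilon> n * z)))"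
    unfolding g_def using smoothed_fourier_inversion[OF int \<epsilon>] by simp
  finally have lim1: "(\<lambda>n. complex_of_real (sqrt (2 * pi)) * (LINT z|lborel. complex_of_real (std_normal_density z) * f (x + \<epsilon> n * z)))
     \<longlonglongrightarrow> complex_of_real (1 / sqrt (2 * pi)) * (LINT \<xi>|lborel. g \<xi>)"
    unfolding integral_mult_right_zero by (simp add: std_normal_density_def)
  have "(\<lambda>n. LINT z|lborel. complex_of_real (std_normal_density z) * f (x + \<epsilon> n * z))
      \<longlonglongrightarrow> (LINT z|lborel. complex_of_real (std_normal_density z) * f x)"
  proof (rule integral_dominated_convergence[where w="\<lambda>z. std_normal_density z * B"])
    show "AE z in lborel. (\<lambda>n. complex_of_real (std_normal_density z) * f (x + \<epsilon> n * z)) \<longlonglongrightarrow> complex_of_real (std_normal_density z) * f x"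
    proof (rule AE_I2)
      fix z
      have "(\<lambda>n. x + \<epsilon> n * z) \<longlonglongrightarrow> x + 0 * z" by (intro tendsto_intros \<epsilon>0)
      then have "(\<lambda>n. f (x + \<epsilon> n * z)) \<longlonglongrightarrow> f x"
        using cont by (intro isCont_tendsto_compose[of x f]) (auto simp: continuous_on_eq_continuous_at)
      then show "(\<lambda>n. complex_of_real (std_normal_density z) * f (x + \<epsilon> n * z)) \<longlonglongrightarrow> complex_of_real (std_normal_density z) * f x"
        by (intro tendsto_intros)
    qed
    show "AE z in lborel. norm (complex_of_real (std_normal_density z) * f (x + \<epsilon> n * z)) \<le> std_normal_density z * B" for n
      using bd by (auto simp: norm_mult intro!: mult_left_mono)
  qed (auto intro: integrable_normal_density)
  then have "(\<lambda>n. complex_of_real (sqrt (2 * pi)) * (LINT z|lborel. complex_of_real (std_normal_density z) * f (x + \<epsilon> n * z)))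
     \<longlonglongrightarrow> complex_of_real (sqrt (2 * pi)) * ((LINT z|lborel. complex_of_real (std_normal_density z)) * f x)"
    unfolding integral_mult_left_zero by (intro tendsto_intros)
  also have "(LINT z|lborel. complex_of_real (std_normal_density z)) = 1"
    by (simp add: integral_normal_density)
  finally have "complex_of_real (1 / sqrt (2 * pi)) * (LINT \<xi>|lborel. g \<xi>) = complex_of_real (sqrt (2 * pi)) * f x"
    using LIMSEQ_unique[OF lim1] by simp
  then have "complex_of_real (1 / sqrt (2 * pi)) * (complex_of_real (1 / sqrt (2 * pi)) * (LINT \<xi>|lborel. g \<xi>))
     = complex_of_real (1 / sqrt (2 * pi)) * (complex_of_real (sqrt (2 * pi)) * f x)" by simp
  then have "complex_of_real (1 / sqrt (2 * pi) * (1 / sqrt (2 * pi))) * (LINT \<xi>|lborel. g \<xi>)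
     = complex_of_real (1 / sqrt (2 * pi) * sqrt (2 * pi)) * f x" unfolding of_real_mult mult.assoc .
  moreover have "1 / sqrt (2 * pi) * (1 / sqrt (2 * pi)) = 1 / (2 * pi)" "1 / sqrt (2 * pi) * sqrt (2 * pi) = 1"
    by (simp_all add: times_divide_times_eq del: real_sqrt_mult)
  ultimately have "complex_of_real (1 / (2 * pi)) * (LINT \<xi>|lborel. g \<xi>) = f x" by (metis mult_1 of_real_1)
  then show ?thesis unfolding inv_fourier_def g_def .
qed

lemma fourier_inversion_derivs_dominated:
  assumes "derivs_dominated 2 inv_quad f"
  shows "inv_fourier (fourier f) x = f x" "integrable lborel (fourier f)"
proof -
  have d: "derivs_dominated (Suc (Suc 0)) inv_quad f" using assms by (simp add: numeral_2_eq_2)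
  have [measurable]: "f \<in> borel_measurable borel" using derivs_dominated_measurable[OF d] .
  obtain M where M: "\<And>\<xi>. cmod (fourier f \<xi>) \<le> M * inv_quad \<xi>" using fourier_decay_2[OF d] by blast
  show int: "integrable lborel (fourier f)"
    by (rule integrable_dominated[OF _ M]) measurable
  obtain N where N: "\<And>x. cmod (f x) \<le> N * inv_quad x" using derivs_dominated_bound[OF d] by blast
  have "cmod (f x) \<le> \<bar>N\<bar>" for x
    using N[of x] inv_quad_le_1[of x] inv_quad_nonneg[of x] by (smt (verit) mult_left_le mult_right_mono)
  then show "inv_fourier (fourier f) x = f x"
    by (intro fourier_inversion int derivs_dominated_integrable[OF d] derivs_dominated_continuous[OF d])
qed

section \<open>The commutator as a singular integral\<close>

text \<open>
  One exponent for the singularity at 0 and one for the decay at infinity: integrable for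
  \<open>a > - 1\<close> and \<open>b < - 1\<close>.
\<close>

definition two_power :: "real \<Rightarrow> real \<Rightarrow> real \<Rightarrow> real" where
  "two_power a b h = (if \<bar>h\<bar> \<le> 1 then \<bar>h\<bar> powr a else \<bar>h\<bar> powr b)"

lemma two_power_measurable [measurable]: "two_power a b \<in> borel_measurable borel"
  unfolding two_power_def[abs_def] by measurable

lemma two_power_nonneg [simp]: "0 \<le> two_power a b h" by (simp add: two_power_def)

lemma integrable_two_power:
  assumes "-1 < a" "b < -1"
  shows "integrable lborel (two_power a b)"
proof -
  have int: "integrable lborel (\<lambda>h. indicator S h * h powr c :: real)"
    if "((\<lambda>h. h powr c) has_integral I) S" "S \<in> sets borel" for c I S
  proof (rule integrableI_nonneg)
    show "(\<integral>\<^sup>+ h. ennreal (indicator S h * h powr c) \<partial>lborel) < \<infinity>"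
      using nn_integral_has_integral_lebesgue[OF _ that(1)] by simp
  qed (use that(2) in auto)
  define f :: "real \<Rightarrow> real"
    where "f h = indicator {0..1} h * h powr a + indicator {1..} h * h powr b" for h
  have f: "integrable lborel f"
    unfolding f_def
    by (intro Bochner_Integration.integrable_add int[OF has_integral_powr_from_0]
        int[OF has_integral_powr_to_inf]) (use assms in auto)
  show ?thesis
  proof (rule Bochner_Integration.integrable_bound)
    show "integrable lborel (\<lambda>h. f h + f (- h))"
      using Bochner_Integration.integrable_add[OF f lborel_integrable_real_affine[OF f, of "-1" 0]] by simp
    show "AE h in lborel. norm (two_power a b h) \<le> norm (f h + f (- h))"
      by (auto simp: f_def two_power_def indicator_def)
  qed simp
qed

lemma one_minus_cos_le: "1 - cos h \<le> h\<^sup>2 / 2" for h :: real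
  using cos_double_sin[of "h/2"] power_mono[OF abs_sin_x_le_abs_x[of "h/2"], of 2]
  by (simp add: power_divide)

definition symbol_const :: "real \<Rightarrow> real" where
  "symbol_const \<alpha> = (LINT h|lborel. (1 - cos h) * \<bar>h\<bar> powr (- 1 - \<alpha>))"

lemma one_minus_cos_kernel_le:
  fixes \<alpha> h :: real
  shows "(1 - cos h) * \<bar>h\<bar> powr (- 1 - \<alpha>) \<le> 2 * two_power (1 - \<alpha>) (- 1 - \<alpha>) h"
proof (cases "\<bar>h\<bar> \<le> 1")
  case True
  have "(1 - cos h) * \<bar>h\<bar> powr (- 1 - \<alpha>) \<le> h\<^sup>2 / 2 * \<bar>h\<bar> powr (- 1 - \<alpha>)"
    by (intro mult_right_mono one_minus_cos_le) auto
  also have "\<dots> = 1 / 2 * \<bar>h\<bar> powr (1 - \<alpha>)"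
  proof (cases "h = 0")
    case False
    have "\<bar>h\<bar> powr (1 - \<alpha>) = \<bar>h\<bar> powr (2 + (- 1 - \<alpha>))" by simp
    also have "\<dots> = \<bar>h\<bar> powr 2 * \<bar>h\<bar> powr (- 1 - \<alpha>)" by (rule powr_add)
    finally show ?thesis using False by simp
  qed simp
  also have "\<dots> \<le> 2 * \<bar>h\<bar> powr (1 - \<alpha>)" by (intro mult_right_mono) auto
  finally show ?thesis using True by (simp add: two_power_def)
next
  case False
  have "(1 - cos h) * \<bar>h\<bar> powr (- 1 - \<alpha>) \<le> 2 * \<bar>h\<bar> powr (- 1 - \<alpha>)"
    using cos_ge_minus_one[of h] by (intro mult_right_mono) auto
  then show ?thesis using False by (simp add: two_power_def)
qed

lemma integrable_one_minus_cos_kernel: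
  fixes \<alpha> :: real
  assumes "0 < \<alpha>" "\<alpha> < 2"
  shows "integrable lborel (\<lambda>h. (1 - cos h) * \<bar>h\<bar> powr (- 1 - \<alpha>))"
proof (rule Bochner_Integration.integrable_bound)
  show "integrable lborel (\<lambda>h. 2 * two_power (1 - \<alpha>) (- 1 - \<alpha>) h)"
    using integrable_two_power[of "1 - \<alpha>" "- 1 - \<alpha>"] assms by auto
  show "AE h in lborel. norm ((1 - cos h) * \<bar>h\<bar> powr (- 1 - \<alpha>)) \<le> norm (2 * two_power (1 - \<alpha>) (- 1 - \<alpha>) h)"
    using one_minus_cos_kernel_le by (auto simp: abs_mult)
qed simp

lemma symbol_const_pos: assumes "0 < \<alpha>" "\<alpha> < 2" shows "0 < symbol_const \<alpha>"
proof -
  define c where "c = (1 - cos 1) * 2 powr (- 1 - \<alpha>)"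
  have c: "0 < c"
    unfolding c_def using cos_monotone_0_pi[of 0 1] pi_gt3 by auto
  have "c = (LINT h|lborel. c * indicator {1..2::real} h)" by simp
  also have "\<dots> \<le> symbol_const \<alpha>"
    unfolding symbol_const_def
  proof (rule integral_mono[OF _ integrable_one_minus_cos_kernel[OF assms]])
    show "integrable lborel (\<lambda>h::real. c * indicator {1..2} h)" by simp
    fix h :: real
    show "c * indicator {1..2} h \<le> (1 - cos h) * \<bar>h\<bar> powr (- 1 - \<alpha>)"
    proof (cases "h \<in> {1..2}")
      case True
      have "cos h \<le> cos 1" using True pi_gt3 by (intro cos_monotone_0_pi_le) auto
      moreover have "2 powr (- 1 - \<alpha>) \<le> \<bar>h\<bar> powr (- 1 - \<alpha>)"
        using True assms by (intro powr_mono2') auto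
      ultimately show ?thesis using True unfolding c_def by (auto intro!: mult_mono)
    qed auto
  qed
  finally show ?thesis using c by linarith
qed

text \<open>
  By scaling \<open>h\<close>, the integral is homogeneous of degree \<open>\<alpha>\<close> in \<open>\<xi>\<close>.
\<close>

lemma symbol_kernel:
  fixes \<alpha> \<xi> :: real
  assumes "0 < \<alpha>" "\<alpha> < 2"
  shows "integrable lborel (\<lambda>h. (1 - cos (h * \<xi>)) * \<bar>h\<bar> powr (- 1 - \<alpha>))"
    and "(LINT h|lborel. (1 - cos (h * \<xi>)) * \<bar>h\<bar> powr (- 1 - \<alpha>)) = \<bar>\<xi>\<bar> powr \<alpha> * symbol_const \<alpha>"
proof -
  have "integrable lborel (\<lambda>h. (1 - cos (h * \<xi>)) * \<bar>h\<bar> powr (- 1 - \<alpha>)) \<and>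
    (LINT h|lborel. (1 - cos (h * \<xi>)) * \<bar>h\<bar> powr (- 1 - \<alpha>)) = \<bar>\<xi>\<bar> powr \<alpha> * symbol_const \<alpha>"
  proof (cases "\<xi> = 0")
    case False
    have eq: "(1 - cos (0 + \<xi> * h)) * \<bar>0 + \<xi> * h\<bar> powr (- 1 - \<alpha>)
       = \<bar>\<xi>\<bar> powr (- 1 - \<alpha>) * ((1 - cos (h * \<xi>)) * \<bar>h\<bar> powr (- 1 - \<alpha>))" for h
      by (simp add: abs_mult powr_mult mult_ac)
    have "integrable lborel (\<lambda>h. \<bar>\<xi>\<bar> powr (- 1 - \<alpha>) * ((1 - cos (h * \<xi>)) * \<bar>h\<bar> powr (- 1 - \<alpha>)))"
      using lborel_integrable_real_affine[OF integrable_one_minus_cos_kernel[OF assms] False, of 0]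
      unfolding eq .
    then have 1: "integrable lborel (\<lambda>h. (1 - cos (h * \<xi>)) * \<bar>h\<bar> powr (- 1 - \<alpha>))"
      using False by simp
    have "symbol_const \<alpha> = \<bar>\<xi>\<bar> * (\<bar>\<xi>\<bar> powr (- 1 - \<alpha>) * (LINT h|lborel. (1 - cos (h * \<xi>)) * \<bar>h\<bar> powr (- 1 - \<alpha>)))"
      unfolding symbol_const_def lborel_integral_real_affine[OF False, of "\<lambda>h. (1 - cos h) * \<bar>h\<bar> powr (- 1 - \<alpha>)" 0] eq
      by simp
    also have "\<dots> = \<bar>\<xi>\<bar> powr (- \<alpha>) * (LINT h|lborel. (1 - cos (h * \<xi>)) * \<bar>h\<bar> powr (- 1 - \<alpha>))"
      using False by (simp add: powr_diff powr_minus field_simps)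
    finally show ?thesis using 1 False by (simp add: powr_minus field_simps)
  qed auto
  then show "integrable lborel (\<lambda>h. (1 - cos (h * \<xi>)) * \<bar>h\<bar> powr (- 1 - \<alpha>))"
    and "(LINT h|lborel. (1 - cos (h * \<xi>)) * \<bar>h\<bar> powr (- 1 - \<alpha>)) = \<bar>\<xi>\<bar> powr \<alpha> * symbol_const \<alpha>" by auto
qed

lemma abs_powr_le:
  fixes \<alpha> \<xi> :: real
  shows "0 \<le> \<alpha> \<Longrightarrow> \<alpha> \<le> 2 \<Longrightarrow> \<bar>\<xi>\<bar> powr \<alpha> \<le> 1 + \<xi>\<^sup>2"
proof (cases "\<bar>\<xi>\<bar> \<le> 1")
  case True
  assume "0 \<le> \<alpha>"
  then have "\<bar>\<xi>\<bar> powr \<alpha> \<le> 1" using True powr_mono2[of \<alpha> "\<bar>\<xi>\<bar>" 1] by simp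
  then show ?thesis by (smt (verit) zero_le_power2)
next
  case False
  assume "\<alpha> \<le> 2"
  then have "\<bar>\<xi>\<bar> powr \<alpha> \<le> \<bar>\<xi>\<bar> powr 2" using False by (intro powr_mono) auto
  then show ?thesis using False by simp
qed

text \<open>
  The symbol is written as the integral in \<open>symbol_kernel\<close>; Fubini moves the \<open>\<xi>\<close>-integral inside,
  where multiplication by \<open>1 - cos (h \<xi>)\<close> corresponds to a symmetric second difference of \<open>f\<close>.
\<close>

lemma abs_D_kernel:
  assumes \<alpha>: "0 < \<alpha>" "\<alpha> < 2" and f: "derivs_dominated 4 inv_quad f"
  shows "integrable lborel (\<lambda>h. complex_of_real (\<bar>h\<bar> powr (- 1 - \<alpha>)) * (f x - (f (x + h) + f (x - h)) / 2))"
    (is "integrable _ ?R")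
    and "complex_of_real (symbol_const \<alpha>) * abs_D \<alpha> f x
      = (LINT h|lborel. complex_of_real (\<bar>h\<bar> powr (- 1 - \<alpha>)) * (f x - (f (x + h) + f (x - h)) / 2))"
proof -
  have f2: "derivs_dominated 2 inv_quad f" using derivs_dominated_antimono[OF f, of 2] by simp
  have [measurable]: "f \<in> borel_measurable borel" using derivs_dominated_measurable[OF f] .
  have inv: "(LINT \<xi>|lborel. exp (\<i> * complex_of_real (y * \<xi>)) * fourier f \<xi>) = complex_of_real (2 * pi) * f y" for y
    using fourier_inversion_derivs_dominated(1)[OF f2, of y] unfolding inv_fourier_def
    by (auto simp: field_simps)
  have int_e: "integrable lborel (\<lambda>\<xi>. exp (\<i> * complex_of_real (y * \<xi>)) * fourier f \<xi>)" for y
    by (rule integrable_exp_mult(2)[OF fourier_inversion_derivs_dominated(2)[OF f2]])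
  obtain M where M: "\<And>\<xi>. (1 + \<xi>\<^sup>2) * cmod (fourier f \<xi>) \<le> M * inv_quad \<xi>" using fourier_decay_4[OF f] by blast
  \<comment> \<open>The integrand of the double integral; \<open>inner1\<close> and \<open>inner2\<close> below evaluate it in the two orders.\<close>
  define k where "k h \<xi> = (1 - cos (h * \<xi>)) * \<bar>h\<bar> powr (- 1 - \<alpha>)" for h \<xi>
  define J where "J = (\<lambda>\<xi> h. complex_of_real (k h \<xi>) * (exp (\<i> * complex_of_real (x * \<xi>)) * fourier f \<xi>))"
  have k: "integrable lborel (\<lambda>h. k h \<xi>)" "(LINT h|lborel. k h \<xi>) = \<bar>\<xi>\<bar> powr \<alpha> * symbol_const \<alpha>" "0 \<le> k h \<xi>" for h \<xi>
    using symbol_kernel[OF \<alpha>] by (auto simp: k_def)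
  have k2: "integrable lborel (\<lambda>h. complex_of_real (k h \<xi>))"
     "(LINT h|lborel. complex_of_real (k h \<xi>)) = complex_of_real (\<bar>\<xi>\<bar> powr \<alpha> * symbol_const \<alpha>)" for \<xi>
    using k(1,2)[of \<xi>] by (auto simp: integrable_of_real)
  have int: "integrable (lborel \<Otimes>\<^sub>M lborel) (\<lambda>(\<xi>, h). J \<xi> h)"
  proof (rule lborel_pair.Fubini_integrable)
    show "(\<lambda>(\<xi>, h). J \<xi> h) \<in> borel_measurable (lborel \<Otimes>\<^sub>M lborel)"
      unfolding J_def k_def by measurable
    have eq: "(LINT h|lborel. norm (case (\<xi>, h) of (\<xi>, h) \<Rightarrow> J \<xi> h))
        = \<bar>\<xi>\<bar> powr \<alpha> * symbol_const \<alpha> * cmod (fourier f \<xi>)" for \<xi>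
      unfolding J_def using k(3) by (simp add: norm_mult k(2) del: of_real_mult)
    show "integrable lborel (\<lambda>\<xi>. LINT h|lborel. norm (case (\<xi>, h) of (\<xi>, h) \<Rightarrow> J \<xi> h))"
      unfolding eq
    proof (rule Bochner_Integration.integrable_bound)
      show "integrable lborel (\<lambda>\<xi>. symbol_const \<alpha> * (M * inv_quad \<xi>))" using integrable_inv_quad by simp
      show "AE \<xi> in lborel. norm (\<bar>\<xi>\<bar> powr \<alpha> * symbol_const \<alpha> * cmod (fourier f \<xi>)) \<le> norm (symbol_const \<alpha> * (M * inv_quad \<xi>))"
      proof (rule AE_I2)
        fix \<xi>
        have "\<bar>\<xi>\<bar> powr \<alpha> * cmod (fourier f \<xi>) \<le> (1 + \<xi>\<^sup>2) * cmod (fourier f \<xi>)"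
          using \<alpha> by (intro mult_right_mono abs_powr_le) auto
        also have "\<dots> \<le> M * inv_quad \<xi>" by (rule M)
        finally have "symbol_const \<alpha> * (\<bar>\<xi>\<bar> powr \<alpha> * cmod (fourier f \<xi>)) \<le> symbol_const \<alpha> * (M * inv_quad \<xi>)"
          using symbol_const_pos[OF \<alpha>] by (intro mult_left_mono) auto
        then show "norm (\<bar>\<xi>\<bar> powr \<alpha> * symbol_const \<alpha> * cmod (fourier f \<xi>)) \<le> norm (symbol_const \<alpha> * (M * inv_quad \<xi>))"
          using symbol_const_pos[OF \<alpha>] by (simp only: real_norm_def) (smt (verit) abs_ge_self abs_of_nonneg mult.assoc mult.commute mult_nonneg_nonneg norm_ge_zero powr_ge_zero)
      qed
    qed simp
    show "AE \<xi> in lborel. integrable lborel (\<lambda>h. case (\<xi>, h) of (\<xi>, h) \<Rightarrow> J \<xi> h)"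
      unfolding J_def using k2 by auto
  qed
  have inner1: "(LINT h|lborel. J \<xi> h)
    = complex_of_real (symbol_const \<alpha>) * (exp (\<i> * complex_of_real (x * \<xi>)) * (complex_of_real (\<bar>\<xi>\<bar> powr \<alpha>) * fourier f \<xi>))" for \<xi>
    unfolding J_def integral_mult_left_zero k2(2) by (simp add: mult_ac)
  have inner2: "(LINT \<xi>|lborel. J \<xi> h) = complex_of_real (2 * pi) *
      (complex_of_real (\<bar>h\<bar> powr (- 1 - \<alpha>)) * (f x - (f (x + h) + f (x - h)) / 2))" for h
  proof -
    define E where "E y \<xi> = exp (\<i> * complex_of_real (y * \<xi>)) * fourier f \<xi>" for y \<xi>
    have E: "integrable lborel (E y)" "(LINT \<xi>|lborel. E y \<xi>) = complex_of_real (2 * pi) * f y" for y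
      using inv[of y] int_e[of y] unfolding E_def by auto
    have "J \<xi> h = complex_of_real (\<bar>h\<bar> powr (- 1 - \<alpha>)) * (E x \<xi> - (E (x + h) \<xi> + E (x - h) \<xi>) / 2)" for \<xi>
    proof -
      have c: "complex_of_real (cos (h * \<xi>)) = (exp (\<i> * complex_of_real (h * \<xi>)) + exp (- (\<i> * complex_of_real (h * \<xi>)))) / 2"
        unfolding cos_of_real[symmetric] by (rule cos_exp_eq)
      have e: "exp (\<i> * complex_of_real ((x + h) * \<xi>)) = exp (\<i> * complex_of_real (x * \<xi>)) * exp (\<i> * complex_of_real (h * \<xi>))"
        "exp (\<i> * complex_of_real ((x - h) * \<xi>)) = exp (\<i> * complex_of_real (x * \<xi>)) * exp (- (\<i> * complex_of_real (h * \<xi>)))"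
        by (simp_all add: exp_add[symmetric] algebra_simps)
      have alg: "(1 - (b + b') / 2) * K * (a * F) = K * (a * F - (a * b * F + a * b' * F) / 2)"
        for a b b' K F :: complex by (simp add: field_simps)
      have "complex_of_real (k h \<xi>) = (1 - complex_of_real (cos (h * \<xi>))) * complex_of_real (\<bar>h\<bar> powr (- 1 - \<alpha>))"
        by (simp add: k_def)
      then show ?thesis
        unfolding J_def E_def e c by (simp only: alg)
    qed
    then have "(LINT \<xi>|lborel. J \<xi> h) = complex_of_real (\<bar>h\<bar> powr (- 1 - \<alpha>)) *
        (LINT \<xi>|lborel. E x \<xi> - (E (x + h) \<xi> + E (x - h) \<xi>) / 2)" by simp
    also have "(LINT \<xi>|lborel. E x \<xi> - (E (x + h) \<xi> + E (x - h) \<xi>) / 2)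
      = complex_of_real (2 * pi) * (f x - (f (x + h) + f (x - h)) / 2)"
      using E by (simp add: algebra_simps add_divide_distrib)
    finally show ?thesis by (simp add: mult_ac)
  qed
  have "integrable lborel (\<lambda>h. LINT \<xi>|lborel. J \<xi> h)"
    using lborel_pair.integrable_snd[OF int] .
  from this[unfolded inner2] have "integrable lborel (\<lambda>h. complex_of_real (1 / (2 * pi)) * (complex_of_real (2 * pi) * ?R h))"
    by (rule integrable_mult_right)
  then show "integrable lborel ?R"
    unfolding mult.assoc[symmetric] of_real_mult[symmetric] by simp
  have "(LINT \<xi>|lborel. LINT h|lborel. J \<xi> h) = (LINT h|lborel. LINT \<xi>|lborel. J \<xi> h)"
    using lborel_pair.Fubini_integral[OF int] by simp
  then have "complex_of_real (symbol_const \<alpha>) * (LINT \<xi>|lborel. exp (\<i> * complex_of_real (x * \<xi>)) * (complex_of_real (\<bar>\<xi>\<bar> powr \<alpha>) * fourier f \<xi>))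
    = complex_of_real (2 * pi) * (LINT h|lborel. ?R h)"
    unfolding inner1 inner2 integral_mult_right_zero .
  then have "complex_of_real (1 / (2 * pi)) * (complex_of_real (symbol_const \<alpha>) * (LINT \<xi>|lborel. exp (\<i> * complex_of_real (x * \<xi>)) * (complex_of_real (\<bar>\<xi>\<bar> powr \<alpha>) * fourier f \<xi>)))
    = complex_of_real (1 / (2 * pi)) * (complex_of_real (2 * pi) * (LINT h|lborel. ?R h))" by simp
  also have "\<dots> = (LINT h|lborel. ?R h)" by simp
  finally show "complex_of_real (symbol_const \<alpha>) * abs_D \<alpha> f x = (LINT h|lborel. ?R h)"
    unfolding abs_D_def fourier_multiplier_def inv_fourier_def by (simp add: mult_ac)
qed

lemma abs_D_2:
  assumes f: "derivs_dominated 4 inv_quad f"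
  shows "abs_D 2 f x = - vderiv (vderiv f) x"
proof -
  have 4: "4 = Suc (Suc (Suc (Suc 0)))" by simp
  note d = f[unfolded 4]
  have d1: "derivs_dominated (Suc (Suc (Suc 0))) inv_quad (vderiv f)" "derivs_dominated 2 inv_quad (vderiv (vderiv f))"
    using d by (auto simp: numeral_2_eq_2)
  have eq: "complex_of_real (\<bar>\<xi>\<bar> powr 2) * fourier f \<xi> = - fourier (vderiv (vderiv f)) \<xi>" for \<xi>
  proof -
    have "fourier (vderiv (vderiv f)) \<xi> = \<i> * complex_of_real \<xi> * (\<i> * complex_of_real \<xi> * fourier f \<xi>)"
      using fourier_vderiv[OF d1(1)] fourier_vderiv[OF d] by simp
    also have "\<dots> = (\<i> * \<i>) * (complex_of_real \<xi> * complex_of_real \<xi>) * fourier f \<xi>"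
      by (simp only: mult_ac)
    finally show ?thesis by (simp add: power2_eq_square)
  qed
  have "abs_D 2 f x = - inv_fourier (fourier (vderiv (vderiv f))) x"
    unfolding abs_D_def fourier_multiplier_def eq inv_fourier_def by simp
  then show ?thesis using fourier_inversion_derivs_dominated(1)[OF d1(2)] by simp
qed

text \<open>
  In the second difference of the product \<open>g u\<close> minus \<open>g x\<close> times that of \<open>u\<close>, the terms at the
  centre cancel.
\<close>

lemma commutator_kernel:
  assumes \<alpha>: "0 < \<alpha>" "\<alpha> < 2" and u: "derivs_dominated 4 inv_quad u" and g: "derivs_dominated 4 (\<lambda>_. 1) (\<lambda>x. complex_of_real (g x))"
  defines "F \<equiv> (\<lambda>x h. complex_of_real (g x - g (x + h)) * u (x + h))"
  shows "complex_of_real (symbol_const \<alpha>) * commutator (abs_D \<alpha>) (mult_op g) u x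
      = (LINT h|lborel. complex_of_real (\<bar>h\<bar> powr (- 1 - \<alpha>)) * ((F x h + F x (- h)) / 2))"
proof -
  have gu: "derivs_dominated 4 inv_quad (mult_op g u)"
    using derivs_dominated_mult[OF g u] unfolding mult_op_def[abs_def] by simp
  note A = abs_D_kernel[OF \<alpha> gu, of x] and B = abs_D_kernel[OF \<alpha> u, of x]
  have "complex_of_real (symbol_const \<alpha>) * commutator (abs_D \<alpha>) (mult_op g) u x
    = complex_of_real (symbol_const \<alpha>) * abs_D \<alpha> (mult_op g u) x - complex_of_real (g x) * (complex_of_real (symbol_const \<alpha>) * abs_D \<alpha> u x)"
    unfolding commutator_def mult_op_def by (simp add: algebra_simps)
  also have "\<dots> = (LINT h|lborel.
      complex_of_real (\<bar>h\<bar> powr (- 1 - \<alpha>)) * (mult_op g u x - (mult_op g u (x + h) + mult_op g u (x - h)) / 2)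
      - complex_of_real (g x) * (complex_of_real (\<bar>h\<bar> powr (- 1 - \<alpha>)) * (u x - (u (x + h) + u (x - h)) / 2)))"
    unfolding A(2) B(2)
    by (subst Bochner_Integration.integral_diff[OF A(1)]) (use B(1) in \<open>auto simp del: mult_zero_left\<close>)
  also have "\<dots> = (LINT h|lborel. complex_of_real (\<bar>h\<bar> powr (- 1 - \<alpha>)) * ((F x h + F x (- h)) / 2))"
    by (rule Bochner_Integration.integral_cong[OF refl]) (simp add: F_def mult_op_def field_simps)
  finally show ?thesis .
qed

lemma commutator_2:
  assumes u: "derivs_dominated 4 inv_quad u" and g: "derivs_dominated 4 (\<lambda>_. 1) (\<lambda>x. complex_of_real (g x))"
    and g': "\<And>x. (g has_real_derivative g' x) (at x)" and g'': "\<And>x. (g' has_real_derivative g'' x) (at x)"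
  shows "commutator (abs_D 2) (mult_op g) u x = - (of_real (g'' x) * u x + 2 * of_real (g' x) * vderiv u x)"
proof -
  have gu: "derivs_dominated 4 inv_quad (mult_op g u)"
    using derivs_dominated_mult[OF g u] unfolding mult_op_def[abs_def] by simp
  have 4: "4 = Suc (Suc (Suc (Suc 0)))" by simp
  have d: "u differentiable at x" "vderiv u differentiable at x" for x
    using u unfolding 4 by auto
  have 1: "vderiv (mult_op g u) = (\<lambda>x. of_real (g x) * vderiv u x + of_real (g' x) * u x)"
    unfolding mult_op_def[abs_def]
    by (intro vderiv_eqI has_vector_derivative_mult of_real_has_vderiv g' has_vderiv d)
  have 2: "vderiv (vderiv (mult_op g u)) x = (of_real (g x) * vderiv (vderiv u) x + of_real (g' x) * vderiv u x)
       + (of_real (g' x) * vderiv u x + of_real (g'' x) * u x)"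
    unfolding 1
    by (intro fun_cong[of "vderiv _"] vderiv_eqI has_vector_derivative_add has_vector_derivative_mult
        of_real_has_vderiv g' g'' has_vderiv d)
  show ?thesis
    unfolding commutator_def abs_D_2[OF gu] 2 by (simp add: mult_op_def abs_D_2[OF u] algebra_simps)
qed

lemma abs_D_measurable:
  assumes [measurable]: "f \<in> borel_measurable borel"
  shows "abs_D \<alpha> f \<in> borel_measurable borel"
  unfolding abs_D_def fourier_multiplier_def[abs_def] inv_fourier_def[abs_def] by measurable

section \<open>The Schur test and two kernels\<close>

text \<open>
  The Cauchy-Schwarz inequality with \<open>K x y\<close> split as the product of the square roots of
  \<open>K x y * p y\<close> and \<open>K x y / p y\<close>; the two hypotheses then evaluate the two remaining integrals.
\<close>

lemma schur_test:
  fixes K :: "real \<Rightarrow> real \<Rightarrow> real" and p f :: "real \<Rightarrow> real"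
  assumes [measurable]: "case_prod K \<in> borel_measurable (borel \<Otimes>\<^sub>M borel)"
      "p \<in> borel_measurable borel" "f \<in> borel_measurable borel"
    and K: "\<And>x y. 0 \<le> K x y" and p: "\<And>x. 0 < p x"
    and a: "\<And>x. (\<integral>\<^sup>+y. ennreal (K x y * p y) \<partial>lborel) \<le> ennreal a * ennreal (p x)"
    and b: "\<And>y. (\<integral>\<^sup>+x. ennreal (K x y * p x) \<partial>lborel) \<le> ennreal b * ennreal (p y)"
  shows "(\<integral>\<^sup>+x. (\<integral>\<^sup>+y. ennreal (K x y * \<bar>f y\<bar>) \<partial>lborel)\<^sup>2 \<partial>lborel)
    \<le> ennreal a * ennreal b * (\<integral>\<^sup>+y. ennreal ((f y)\<^sup>2) \<partial>lborel)"
proof -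
  have CS: "(\<integral>\<^sup>+y. ennreal (K x y * \<bar>f y\<bar>) \<partial>lborel)\<^sup>2
      \<le> ennreal a * (\<integral>\<^sup>+y. ennreal (p x * K x y * ((f y)\<^sup>2 / p y)) \<partial>lborel)" for x
  proof -
    have 1: "ennreal (sqrt (K x y * p y)) * ennreal (sqrt (K x y / p y) * \<bar>f y\<bar>) = ennreal (K x y * \<bar>f y\<bar>)" for y
    proof -
      have "sqrt (K x y * p y) * sqrt (K x y / p y) = K x y"
        using p[of y] K[of x y] by (simp flip: real_sqrt_mult)
      then have "sqrt (K x y * p y) * (sqrt (K x y / p y) * \<bar>f y\<bar>) = K x y * \<bar>f y\<bar>"
        by (simp flip: mult.assoc)
      then show ?thesis
        using p[of y] K[of x y] by (subst ennreal_mult[symmetric]) (auto intro: less_imp_le)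
    qed
    have 2: "(ennreal (sqrt (K x y * p y)))\<^sup>2 = ennreal (K x y * p y)" for y
      using p[of y] K[of x y] by (subst ennreal_power) (auto intro: less_imp_le)
    have 3: "(ennreal (sqrt (K x y / p y) * \<bar>f y\<bar>))\<^sup>2 = ennreal (K x y * ((f y)\<^sup>2 / p y))" for y
      using p[of y] K[of x y] by (subst ennreal_power) (auto intro: less_imp_le simp: power_mult_distrib)
    have "(\<integral>\<^sup>+y. ennreal (K x y * \<bar>f y\<bar>) \<partial>lborel)\<^sup>2
      \<le> (\<integral>\<^sup>+y. ennreal (K x y * p y) \<partial>lborel) * (\<integral>\<^sup>+y. ennreal (K x y * ((f y)\<^sup>2 / p y)) \<partial>lborel)"
      using Cauchy_Schwarz_nn_integral[of "\<lambda>y. ennreal (sqrt (K x y * p y))" lborel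
          "\<lambda>y. ennreal (sqrt (K x y / p y) * \<bar>f y\<bar>)"]
      unfolding 1 2 3 by simp
    also have "\<dots> \<le> (ennreal a * ennreal (p x)) * (\<integral>\<^sup>+y. ennreal (K x y * ((f y)\<^sup>2 / p y)) \<partial>lborel)"
      by (intro mult_right_mono a) auto
    also have "\<dots> = ennreal a * (\<integral>\<^sup>+y. ennreal (p x) * ennreal (K x y * ((f y)\<^sup>2 / p y)) \<partial>lborel)"
      by (subst nn_integral_cmult) (auto simp: mult.assoc)
    also have "\<dots> = ennreal a * (\<integral>\<^sup>+y. ennreal (p x * K x y * ((f y)\<^sup>2 / p y)) \<partial>lborel)"
      using p K by (subst ennreal_mult[symmetric]) (auto intro!: divide_nonneg_pos mult_nonneg_nonneg simp: mult_ac less_imp_le)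
    finally show ?thesis .
  qed
  have "(\<integral>\<^sup>+x. (\<integral>\<^sup>+y. ennreal (K x y * \<bar>f y\<bar>) \<partial>lborel)\<^sup>2 \<partial>lborel)
    \<le> (\<integral>\<^sup>+x. ennreal a * (\<integral>\<^sup>+y. ennreal (p x * K x y * ((f y)\<^sup>2 / p y)) \<partial>lborel) \<partial>lborel)"
    by (intro nn_integral_mono CS)
  also have "\<dots> = ennreal a * (\<integral>\<^sup>+x. \<integral>\<^sup>+y. ennreal (p x * K x y * ((f y)\<^sup>2 / p y)) \<partial>lborel \<partial>lborel)"
    by (subst nn_integral_cmult) auto
  also have "(\<integral>\<^sup>+x. \<integral>\<^sup>+y. ennreal (p x * K x y * ((f y)\<^sup>2 / p y)) \<partial>lborel \<partial>lborel)
    = (\<integral>\<^sup>+y. \<integral>\<^sup>+x. ennreal (p x * K x y * ((f y)\<^sup>2 / p y)) \<partial>lborel \<partial>lborel)"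
    by (rule lborel_pair.Fubini'[symmetric]) measurable
  also have "\<dots> \<le> (\<integral>\<^sup>+y. ennreal b * ennreal ((f y)\<^sup>2) \<partial>lborel)"
  proof (rule nn_integral_mono)
    fix y
    have "(\<integral>\<^sup>+x. ennreal (p x * K x y * ((f y)\<^sup>2 / p y)) \<partial>lborel)
        = (\<integral>\<^sup>+x. ennreal (K x y * p x) * ennreal ((f y)\<^sup>2 / p y) \<partial>lborel)"
      using p K by (subst ennreal_mult[symmetric]) (auto intro!: divide_nonneg_pos mult_nonneg_nonneg simp: mult_ac less_imp_le)
    also have "\<dots> = (\<integral>\<^sup>+x. ennreal (K x y * p x) \<partial>lborel) * ennreal ((f y)\<^sup>2 / p y)"
      by (subst nn_integral_multc) auto
    also have "\<dots> \<le> (ennreal b * ennreal (p y)) * ennreal ((f y)\<^sup>2 / p y)"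
      by (intro mult_right_mono b) auto
    also have "\<dots> = ennreal b * ennreal ((f y)\<^sup>2)"
      using p[of y] unfolding mult.assoc by (subst ennreal_mult[symmetric]) auto
    finally show "(\<integral>\<^sup>+x. ennreal (p x * K x y * ((f y)\<^sup>2 / p y)) \<partial>lborel) \<le> ennreal b * ennreal ((f y)\<^sup>2)" .
  qed
  also have "\<dots> = ennreal b * (\<integral>\<^sup>+y. ennreal ((f y)\<^sup>2) \<partial>lborel)"
    by (subst nn_integral_cmult) auto
  finally show ?thesis by (simp add: mult.assoc mult_left_mono)
qed

lemma japanese_measurable [measurable]: "japanese \<in> borel_measurable borel"
  unfolding japanese_def[abs_def] by measurable

lemma japanese_ge: "1 \<le> japanese x" "\<bar>x\<bar> \<le> japanese x" "0 < japanese x"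
proof -
  show 1: "1 \<le> japanese x" by (simp add: japanese_def)
  show "\<bar>x\<bar> \<le> japanese x" unfolding japanese_def by (intro real_le_rsqrt) auto
  show "0 < japanese x" using 1 by linarith
qed

definition two_power_integral :: "real \<Rightarrow> real \<Rightarrow> real" where
  "two_power_integral a b = (LINT h|lborel. two_power a b h)"

lemma nn_integral_two_power:
  "-1 < a \<Longrightarrow> b < -1 \<Longrightarrow> (\<integral>\<^sup>+h. ennreal (two_power a b h) \<partial>lborel) = ennreal (two_power_integral a b)"
  unfolding two_power_integral_def by (intro nn_integral_eq_integral integrable_two_power) auto

lemma two_power_integral_nonneg: "0 \<le> two_power_integral a b" unfolding two_power_integral_def by simp

text \<open>
  Young's inequality for an integrable kernel: the Schur test with weight 1.
\<close>

lemma convolution_bound: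
  assumes "-1 < a" "b < -1" and [measurable]: "f \<in> borel_measurable borel"
  shows "(\<integral>\<^sup>+x. (\<integral>\<^sup>+y. ennreal (two_power a b (y - x) * \<bar>f y\<bar>) \<partial>lborel)\<^sup>2 \<partial>lborel)
    \<le> ennreal ((two_power_integral a b)\<^sup>2) * (\<integral>\<^sup>+y. ennreal ((f y)\<^sup>2) \<partial>lborel)"
proof -
  have 1: "(\<integral>\<^sup>+y. ennreal (two_power a b (y - x)) \<partial>lborel) = ennreal (two_power_integral a b)" for x
    using nn_integral_real_affine[of "\<lambda>h. ennreal (two_power a b h)" 1 "- x"] nn_integral_two_power[OF assms(1,2)]
    by simp
  have 2: "(\<integral>\<^sup>+x. ennreal (two_power a b (y - x)) \<partial>lborel) = ennreal (two_power_integral a b)" for y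
    using nn_integral_real_affine[of "\<lambda>h. ennreal (two_power a b h)" "- 1" y] nn_integral_two_power[OF assms(1,2)]
    by simp
  have "(\<integral>\<^sup>+x. (\<integral>\<^sup>+y. ennreal (two_power a b (y - x) * \<bar>f y\<bar>) \<partial>lborel)\<^sup>2 \<partial>lborel)
    \<le> ennreal (two_power_integral a b) * ennreal (two_power_integral a b) * (\<integral>\<^sup>+y. ennreal ((f y)\<^sup>2) \<partial>lborel)"
    by (rule schur_test[where p="\<lambda>_. 1"]) (use 1 2 in auto)
  then show ?thesis by (simp add: ennreal_mult[symmetric] two_power_integral_nonneg power2_eq_square)
qed

text \<open>
  Replacing \<open>\<langle>y\<rangle>\<close> by \<open>\<bar>y\<bar>\<close> increases the integrand and makes it a function of \<open>y / \<langle>x\<rangle>\<close> up to a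
  power of \<open>\<langle>x\<rangle>\<close>. The exponent \<open>- 1/2\<close> lies strictly between \<open>- 1\<close>
  and 0, so the integral converges both at 0 and at infinity.
\<close>

lemma hilbert_weight:
  "(\<integral>\<^sup>+y. ennreal (1 / max (japanese x) (japanese y) * japanese y powr (-1/2)) \<partial>lborel)
    \<le> ennreal (two_power_integral (-1/2) (-3/2)) * ennreal (japanese x powr (-1/2))"
proof -
  define X where "X = japanese x"
  have X: "1 \<le> X" "0 < X" using japanese_ge[of x] by (auto simp: X_def)
  \<comment> \<open>On each side of \<open>\<bar>y\<bar> = X\<close> the maximum is bounded below by \<open>X\<close> and by \<open>\<bar>y\<bar>\<close>, respectively, and the weight is bounded above by its value with \<open>\<bar>y\<bar>\<close> in place of \<open>\<langle>y\<rangle>\<close>.\<close>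
  \<comment> \<open>The point \<open>y = 0\<close> is excluded because \<open>0 powr a = 0\<close> also for negative \<open>a\<close>.\<close>
  have pw: "1 / max X (japanese y) * japanese y powr (-1/2) \<le> X powr (-3/2) * two_power (-1/2) (-3/2) (1 / X * y)"
    if "y \<noteq> 0" for y
  proof -
    have Y: "1 \<le> japanese y" "\<bar>y\<bar> \<le> japanese y" "0 < japanese y" using japanese_ge[of y] by auto
    have le: "japanese y powr (-1/2) \<le> \<bar>y\<bar> powr (-1/2)" using Y that by (intro powr_mono2') auto
    show ?thesis
    proof (cases "\<bar>y\<bar> \<le> X")
      case True
      then have "two_power (-1/2) (-3/2) (1 / X * y) = (\<bar>y\<bar> / X) powr (-1/2)"
        using X by (simp add: two_power_def abs_mult)
      also have "\<dots> = \<bar>y\<bar> powr (-1/2) * X powr (1/2)"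
        using X by (simp add: powr_divide powr_minus field_simps)
      finally have "X powr (-3/2) * two_power (-1/2) (-3/2) (1 / X * y) = \<bar>y\<bar> powr (-1/2) * (X powr (-3/2) * X powr (1/2))"
        by simp
      also have "X powr (-3/2) * X powr (1/2) = X powr (-3/2 + 1/2)" by (rule powr_add[symmetric])
      also have "\<dots> = 1 / X" using X by (simp add: powr_minus_divide)
      finally have eq: "X powr (-3/2) * two_power (-1/2) (-3/2) (1 / X * y) = 1 / X * \<bar>y\<bar> powr (-1/2)" by simp
      show ?thesis unfolding eq using X Y by (intro mult_mono le) (auto intro: divide_left_mono)
    next
      case False
      then have "two_power (-1/2) (-3/2) (1 / X * y) = (\<bar>y\<bar> / X) powr (-3/2)"
        using X by (simp add: two_power_def abs_mult)
      also have "\<dots> = \<bar>y\<bar> powr (-3/2) * X powr (3/2)"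
        using X by (simp add: powr_divide powr_minus field_simps)
      finally have "X powr (-3/2) * two_power (-1/2) (-3/2) (1 / X * y) = \<bar>y\<bar> powr (-3/2) * (X powr (-3/2) * X powr (3/2))"
        by simp
      also have "X powr (-3/2) * X powr (3/2) = 1"
        using X by (simp add: powr_add[symmetric])
      also have "\<bar>y\<bar> powr (-3/2) * 1 = \<bar>y\<bar> powr (-1 + -1/2)" by simp
      also have "\<dots> = \<bar>y\<bar> powr (-1) * \<bar>y\<bar> powr (-1/2)" by (rule powr_add)
      also have "\<dots> = 1 / \<bar>y\<bar> * \<bar>y\<bar> powr (-1/2)" using that by (simp add: powr_minus_divide)
      finally have eq: "X powr (-3/2) * two_power (-1/2) (-3/2) (1 / X * y) = 1 / \<bar>y\<bar> * \<bar>y\<bar> powr (-1/2)" .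
      show ?thesis unfolding eq using X Y that by (intro mult_mono le) (auto intro!: divide_left_mono mult_pos_pos)
    qed
  qed
  have "(\<integral>\<^sup>+y. ennreal (1 / max X (japanese y) * japanese y powr (-1/2)) \<partial>lborel)
    \<le> (\<integral>\<^sup>+y. ennreal (X powr (-3/2) * two_power (-1/2) (-3/2) (1 / X * y)) \<partial>lborel)"
  proof (rule nn_integral_mono_AE)
    have "AE y in lborel. y \<noteq> (0::real)" by (rule AE_lborel_singleton)
    then show "AE y in lborel. ennreal (1 / max X (japanese y) * japanese y powr (-1/2))
        \<le> ennreal (X powr (-3/2) * two_power (-1/2) (-3/2) (1 / X * y))"
      by eventually_elim (intro ennreal_leI pw)
  qed
  also have "\<dots> = ennreal X * (\<integral>\<^sup>+y. ennreal (X powr (-3/2) * two_power (-1/2) (-3/2) y) \<partial>lborel)"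
    using X by (subst nn_integral_real_affine[of _ X 0]) auto
  also have "\<dots> = ennreal X * (ennreal (X powr (-3/2)) * ennreal (two_power_integral (-1/2) (-3/2)))"
    by (simp add: ennreal_mult nn_integral_cmult nn_integral_two_power)
  also have "\<dots> = ennreal (X * X powr (-3/2) * two_power_integral (-1/2) (-3/2))"
    using X by (simp add: ennreal_mult two_power_integral_nonneg mult.assoc)
  also have "X * X powr (-3/2) = X powr (-1/2)"
    using X powr_add[of X 1 "-3/2"] by simp
  finally show ?thesis unfolding X_def by (simp add: ennreal_mult two_power_integral_nonneg mult.commute)
qed

lemma hilbert_bound:
  assumes [measurable]: "f \<in> borel_measurable borel"
  shows "(\<integral>\<^sup>+x. (\<integral>\<^sup>+y. ennreal (1 / max (japanese x) (japanese y) * \<bar>f y\<bar>) \<partial>lborel)\<^sup>2 \<partial>lborel)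
    \<le> ennreal ((two_power_integral (-1/2) (-3/2))\<^sup>2) * (\<integral>\<^sup>+y. ennreal ((f y)\<^sup>2) \<partial>lborel)"
proof -
  have "(\<integral>\<^sup>+x. (\<integral>\<^sup>+y. ennreal (1 / max (japanese x) (japanese y) * \<bar>f y\<bar>) \<partial>lborel)\<^sup>2 \<partial>lborel)
    \<le> ennreal (two_power_integral (-1/2) (-3/2)) * ennreal (two_power_integral (-1/2) (-3/2)) * (\<integral>\<^sup>+y. ennreal ((f y)\<^sup>2) \<partial>lborel)"
  proof (rule schur_test[where p="\<lambda>x. japanese x powr (-1/2)"])
    show "0 \<le> 1 / max (japanese x) (japanese y)" for x y
      using japanese_ge(3)[of x] by (simp add: le_max_iff_disj less_imp_le)
    show "0 < japanese x powr (-1/2)" for x using japanese_ge(3)[of x] by simp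
    show "(\<integral>\<^sup>+x. ennreal (1 / max (japanese x) (japanese y) * japanese x powr (-1/2)) \<partial>lborel)
      \<le> ennreal (two_power_integral (-1/2) (-3/2)) * ennreal (japanese y powr (-1/2))" for y
      using hilbert_weight[of y] by (simp add: max.commute)
  qed (use hilbert_weight in auto)
  then show ?thesis by (simp add: ennreal_mult[symmetric] two_power_integral_nonneg power2_eq_square)
qed

lemma ennreal_sum_square_le: "(a + b)\<^sup>2 \<le> 2 * a\<^sup>2 + 2 * (b::ennreal)\<^sup>2"
proof (cases a; cases b)
  fix c d :: real assume "a = ennreal c" "0 \<le> c" "b = ennreal d" "0 \<le> d"
  moreover have "(c + d)\<^sup>2 \<le> 2 * c\<^sup>2 + 2 * d\<^sup>2"
    using zero_le_power2[of "c - d"] by (simp add: power2_eq_square algebra_simps)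
  moreover have "2 * ennreal (c\<^sup>2) + 2 * ennreal (d\<^sup>2) = ennreal (2 * c\<^sup>2 + 2 * d\<^sup>2)"
    by (simp add: ennreal_mult)
  ultimately show ?thesis
    by (simp add: ennreal_power ennreal_plus[symmetric] del: ennreal_plus)
qed (auto simp: power2_eq_square ennreal_mult_eq_top_iff ennreal_top_mult)

section \<open>The commutator estimate at unit scale\<close>

lemma japanese_lipschitz: "japanese y \<le> japanese x + \<bar>y - x\<bar>"
proof -
  have "japanese z = norm (1::real, z)" for z by (simp add: japanese_def norm_Pair)
  moreover have "norm (1::real, y) \<le> norm (1::real, x) + norm (0::real, y - x)"
    using norm_triangle_ineq[of "(1::real, x)" "(0, y - x)"] by simp
  ultimately show ?thesis by (simp add: norm_Pair)
qed

text \<open>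
  The powers of \<open>\<langle>x\<rangle>\<close> in this section have exponents of modulus at most 3, which makes the constants
  for comparable arguments, here and in the next lemma, explicit.
\<close>

lemma powr_neg_half_le:
  fixes M s p :: real
  assumes "0 < M" "M / 2 \<le> s" "0 \<le> p" "p \<le> 3"
  shows "s powr (- p) \<le> 8 * M powr (- p)"
proof -
  have "s powr (- p) \<le> (M / 2) powr (- p)" using assms by (intro powr_mono2') auto
  also have "\<dots> = M powr (- p) * 2 powr p" using assms by (simp add: powr_divide powr_minus field_simps)
  also have "\<dots> \<le> M powr (- p) * 2 powr 3" using assms by (intro mult_left_mono powr_mono) auto
  finally show ?thesis by simp
qed

lemma powr_double_le:
  fixes M s p :: real
  assumes "0 < s" "s \<le> 2 * M" "0 \<le> p" "p \<le> 2"
  shows "s powr p \<le> 4 * M powr p"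
proof -
  have "s powr p \<le> (2 * M) powr p" using assms by (intro powr_mono2) auto
  also have "\<dots> = 2 powr p * M powr p" using assms by (simp add: powr_mult)
  also have "\<dots> \<le> 2 powr 2 * M powr p" using assms by (intro mult_right_mono powr_mono) auto
  finally show ?thesis by simp
qed

lemma mvt_bound:
  fixes f f' :: "real \<Rightarrow> real"
  assumes f: "\<And>z. (f has_real_derivative f' z) (at z)"
    and B: "\<And>z. \<bar>z - x\<bar> \<le> \<bar>y - x\<bar> \<Longrightarrow> \<bar>z - y\<bar> \<le> \<bar>y - x\<bar> \<Longrightarrow> \<bar>f' z\<bar> \<le> B"
  shows "\<bar>f y - f x\<bar> \<le> B * \<bar>y - x\<bar>"
proof (cases x y rule: linorder_cases)
  case less
  then obtain z where "x < z" "z < y" "f y - f x = (y - x) * f' z" using MVT2[of x y f f'] f by blast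
  then show ?thesis using B[of z] by (simp add: abs_mult mult.commute mult_left_mono)
next
  case greater
  then obtain z where "y < z" "z < x" "f x - f y = (x - y) * f' z" using MVT2[of y x f f'] f by blast
  then have "\<bar>f y - f x\<bar> = \<bar>y - x\<bar> * \<bar>f' z\<bar>" "\<bar>f' z\<bar> \<le> B"
    using B[of z] by (auto simp: abs_mult abs_minus_commute)
  then show ?thesis by (simp add: mult.commute mult_right_mono)
qed simp

text \<open>
  The quantity through which \<open>u\<close> enters the commutator estimate. The derivative acts before the
  weight is multiplied, so that no derivative of the weight occurs.
\<close>

definition weighted_size :: "real \<Rightarrow> (real \<Rightarrow> complex) \<Rightarrow> real \<Rightarrow> real" where
  "weighted_size \<beta> u x = japanese x powr (- \<beta>) * (cmod (u x) + cmod (vderiv u x))"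

lemma weighted_size_nonneg [simp]: "0 \<le> weighted_size \<beta> u x" by (simp add: weighted_size_def)

lemma le_weighted_size:
  "cmod (u x) \<le> japanese x powr \<beta> * weighted_size \<beta> u x" "cmod (vderiv u x) \<le> japanese x powr \<beta> * weighted_size \<beta> u x"
proof -
  have "japanese x powr \<beta> * weighted_size \<beta> u x = cmod (u x) + cmod (vderiv u x)"
    using japanese_ge(3)[of x] by (simp add: weighted_size_def powr_minus)
  then show "cmod (u x) \<le> japanese x powr \<beta> * weighted_size \<beta> u x" "cmod (vderiv u x) \<le> japanese x powr \<beta> * weighted_size \<beta> u x"
    by auto
qed

lemma weighted_size_measurable:
  assumes "derivs_dominated (Suc n) inv_quad u" shows "weighted_size \<beta> u \<in> borel_measurable borel"
proof -
  have [measurable]: "u \<in> borel_measurable borel" "vderiv u \<in> borel_measurable borel"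
    using derivs_dominated_measurable[OF assms] derivs_dominated_measurable[of n inv_quad "vderiv u"] assms by auto
  show ?thesis unfolding weighted_size_def[abs_def] by measurable
qed

lemma cmod_increment_le_integral:
  fixes u :: "real \<Rightarrow> complex"
  assumes "a \<le> b" "\<And>x. u differentiable at x" "continuous_on UNIV (vderiv u)"
  shows "ennreal (cmod (u b - u a)) \<le> (\<integral>\<^sup>+y. ennreal (indicator {a..b} y * cmod (vderiv u y)) \<partial>lborel)"
proof -
  have H: "has_bochner_integral lborel (\<lambda>x. indicator {a..b} x *\<^sub>R vderiv u x) (u b - u a)"
    using assms by (intro has_bochner_integral_FTC_Icc)
      (auto intro: has_vderiv has_vector_derivative_at_within continuous_on_subset)
  have "ennreal (norm (LINT x|lborel. indicator {a..b} x *\<^sub>R vderiv u x))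
      \<le> (\<integral>\<^sup>+x. ennreal (norm (indicator {a..b} x *\<^sub>R vderiv u x)) \<partial>lborel)"
    using H by (intro integral_norm_bound_ennreal) (simp add: has_bochner_integral_iff)
  then show ?thesis using H by (simp add: has_bochner_integral_iff)
qed

text \<open>
  What the estimate requires of the function in the commutator. A single constant \<open>\<kappa>\<close>
  measures it, so the final bound is linear in \<open>\<kappa>\<close>.
\<close>

locale weight_estimate =
  fixes \<alpha> \<kappa> :: real and g g' g'' :: "real \<Rightarrow> real"
  assumes \<alpha>: "1 \<le> \<alpha>" "\<alpha> \<le> 2"
    and g: "\<And>x. (g has_real_derivative g' x) (at x)"
    and g': "\<And>x. (g' has_real_derivative g'' x) (at x)"
    and osc: "\<And>x y. \<bar>g x - g y\<bar> \<le> \<kappa>"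
    and g'_le: "\<And>x. \<bar>g' x\<bar> \<le> \<kappa> * japanese x powr (- (1 + \<alpha>))"
    and g''_le: "\<And>x. \<bar>g'' x\<bar> \<le> \<kappa> * japanese x powr (- (1 + \<alpha>))"
begin

definition \<beta> :: real where "\<beta> = (1 + \<alpha>) / 2"
abbreviation conv_kernel :: "real \<Rightarrow> real" where "conv_kernel \<equiv> two_power (- \<alpha> / 2) (- 2)"

lemma \<kappa>_nonneg: "0 \<le> \<kappa>" using osc[of 0 0] by simp

lemma \<beta>: "1 \<le> \<beta>" "\<beta> \<le> 3 / 2" "1 + \<alpha> = \<beta> + \<beta>" using \<alpha> by (auto simp: \<beta>_def)

lemma near_japanese: assumes "\<bar>z - x\<bar> \<le> 1" shows "japanese x / 2 \<le> japanese z" "japanese z \<le> 2 * japanese x"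
  using japanese_lipschitz[of x z] japanese_lipschitz[of z x] japanese_ge(1)[of x] japanese_ge(1)[of z] assms
  by (auto simp: abs_minus_commute)

lemma near_weight: assumes "\<bar>z - x\<bar> \<le> 1"
  shows "\<kappa> * japanese z powr (- (1 + \<alpha>)) \<le> 8 * \<kappa> * japanese x powr (- (1 + \<alpha>))"
proof -
  have "japanese z powr (- (1 + \<alpha>)) \<le> 8 * japanese x powr (- (1 + \<alpha>))"
    using near_japanese[OF assms] \<alpha> japanese_ge(3)[of x] by (intro powr_neg_half_le) auto
  then show ?thesis using \<kappa>_nonneg mult_left_mono[of _ _ \<kappa>] by fastforce
qed

lemma first_difference:
  assumes "\<bar>h\<bar> \<le> 1"
  shows "\<bar>g x - g (x + h)\<bar> \<le> 8 * \<kappa> * japanese x powr (- (1 + \<alpha>)) * \<bar>h\<bar>"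
proof -
  have "\<bar>g (x + h) - g x\<bar> \<le> 8 * \<kappa> * japanese x powr (- (1 + \<alpha>)) * \<bar>x + h - x\<bar>"
  proof (rule mvt_bound[OF g])
    fix z assume "\<bar>z - x\<bar> \<le> \<bar>x + h - x\<bar>"
    then have "\<bar>z - x\<bar> \<le> 1" using assms by simp
    then show "\<bar>g' z\<bar> \<le> 8 * \<kappa> * japanese x powr (- (1 + \<alpha>))"
      by (rule order.trans[OF g'_le near_weight])
  qed
  then show ?thesis by (simp add: abs_minus_commute)
qed

lemma second_difference:
  assumes "\<bar>h\<bar> \<le> 1"
  shows "\<bar>2 * g x - g (x + h) - g (x - h)\<bar> \<le> 16 * \<kappa> * japanese x powr (- (1 + \<alpha>)) * h\<^sup>2"
proof -
  define B where "B = 8 * \<kappa> * japanese x powr (- (1 + \<alpha>))"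
  have B0: "0 \<le> B" using \<kappa>_nonneg by (simp add: B_def)
  have 1: "((\<lambda>t. g (x + t) + g (x - t)) has_real_derivative g' (x + t) - g' (x - t)) (at t)" for t
    by (auto intro!: derivative_eq_intros DERIV_chain2[OF g])
  have 2: "\<bar>g' (x + t) - g' (x - t)\<bar> \<le> B * (2 * \<bar>h\<bar>)" if "\<bar>t\<bar> \<le> \<bar>h\<bar>" for t
  proof -
    have "\<bar>g' (x + t) - g' (x - t)\<bar> \<le> B * \<bar>x + t - (x - t)\<bar>"
    proof (rule mvt_bound[OF g'])
      fix z assume "\<bar>z - (x - t)\<bar> \<le> \<bar>x + t - (x - t)\<bar>" "\<bar>z - (x + t)\<bar> \<le> \<bar>x + t - (x - t)\<bar>"
      then have "\<bar>z - x\<bar> \<le> 1" using assms that by linarith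
      then show "\<bar>g'' z\<bar> \<le> B" unfolding B_def by (rule order.trans[OF g''_le near_weight])
    qed
    also have "\<dots> \<le> B * (2 * \<bar>h\<bar>)" using that B0 by (intro mult_left_mono) auto
    finally show ?thesis .
  qed
  have "\<bar>(g (x + h) + g (x - h)) - (g (x + 0) + g (x - 0))\<bar> \<le> B * (2 * \<bar>h\<bar>) * \<bar>h - 0\<bar>"
    by (rule mvt_bound[OF 1]) (use 2 in auto)
  then have "\<bar>2 * g x - g (x + h) - g (x - h)\<bar> \<le> B * (2 * \<bar>h\<bar>) * \<bar>h\<bar>" by simp
  also have "\<dots> = 16 * \<kappa> * japanese x powr (- (1 + \<alpha>)) * h\<^sup>2"
    by (simp add: B_def power2_eq_square)
  finally show ?thesis .
qed

text \<open>
  If \<open>d = \<bar>y - x\<bar>\<close> is at most half of \<open>M = max \<langle>x\<rangle> \<langle>y\<rangle>\<close>, the whole segment between \<open>x\<close> and \<open>y\<close> lies where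
  \<open>\<langle>z\<rangle>\<close> is comparable to \<open>M\<close> and the mean value theorem gains \<open>d\<close> times the small derivative; the surplus
  powers of \<open>M\<close> are traded for powers of \<open>d\<close> to reach an integrable rate. Otherwise \<open>d\<close> itself is of the
  order of \<open>M\<close> at least, and the bounded oscillation of \<open>g\<close> is enough.
\<close>

lemma far_kernel:
  assumes "1 < \<bar>y - x\<bar>"
  shows "\<bar>g x - g y\<bar> * cmod (u y) * \<bar>y - x\<bar> powr (- 1 - \<alpha>)
    \<le> 8 * \<kappa> * ((conv_kernel (y - x) + 1 / max (japanese x) (japanese y)) * weighted_size \<beta> u y)"
proof -
  define d where "d = \<bar>y - x\<bar>"
  define M where "M = max (japanese x) (japanese y)"
  have d: "1 < d" using assms by (simp add: d_def)
  have M: "1 \<le> M" "japanese y \<le> M" using japanese_ge(1)[of x] by (auto simp: M_def)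
  have u: "cmod (u y) \<le> M powr \<beta> * weighted_size \<beta> u y"
    using M \<beta> japanese_ge(3)[of y]
    by (intro order.trans[OF le_weighted_size(1)[of u y \<beta>]] mult_right_mono powr_mono2) auto
  have "\<bar>g x - g y\<bar> * d powr (- 1 - \<alpha>) * M powr \<beta> \<le> 8 * \<kappa> * (conv_kernel (y - x) + 1 / M)"
  proof (cases "d \<le> M / 2")
    case True
    have "\<bar>g y - g x\<bar> \<le> 8 * \<kappa> * M powr (- (1 + \<alpha>)) * \<bar>y - x\<bar>"
    proof (rule mvt_bound[OF g])
      fix z assume z: "\<bar>z - x\<bar> \<le> \<bar>y - x\<bar>" "\<bar>z - y\<bar> \<le> \<bar>y - x\<bar>"
      have "M / 2 \<le> japanese z"
        using japanese_lipschitz[of x z] japanese_lipschitz[of y z] z True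
        by (auto simp: M_def d_def max_def abs_minus_commute split: if_splits)
      then have "japanese z powr (- (1 + \<alpha>)) \<le> 8 * M powr (- (1 + \<alpha>))"
        using M \<alpha> by (intro powr_neg_half_le) auto
      from mult_left_mono[OF this \<kappa>_nonneg] show "\<bar>g' z\<bar> \<le> 8 * \<kappa> * M powr (- (1 + \<alpha>))"
        using g'_le[of z] by simp
    qed
    then have "\<bar>g x - g y\<bar> * d powr (- 1 - \<alpha>) * M powr \<beta>
        \<le> 8 * \<kappa> * M powr (- (1 + \<alpha>)) * d * d powr (- 1 - \<alpha>) * M powr \<beta>"
      by (intro mult_right_mono) (auto simp: d_def abs_minus_commute)
    also have "\<dots> = 8 * \<kappa> * ((M powr (- (1 + \<alpha>)) * M powr \<beta>) * (d powr 1 * d powr (- 1 - \<alpha>)))"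
      using d by (simp add: mult_ac)
    also have "\<dots> = 8 * \<kappa> * (M powr (- \<beta>) * d powr (- \<alpha>))"
      unfolding powr_add[symmetric] using \<beta>(3) by (simp add: algebra_simps)
    also have "\<dots> \<le> 8 * \<kappa> * (d powr (- \<beta>) * d powr (- \<alpha>))"
      using \<kappa>_nonneg d True \<beta> by (intro mult_left_mono mult_right_mono powr_mono2') auto
    \<comment> \<open>\<open>\<alpha> + \<beta> \<ge> 2\<close>, with equality for \<open>\<alpha> = 1\<close>.\<close>
    also have "\<dots> \<le> 8 * \<kappa> * d powr (- 2)"
      unfolding powr_add[symmetric] using \<kappa>_nonneg d \<beta> \<alpha> by (intro mult_left_mono powr_mono) auto
    also have "d powr (- 2) = conv_kernel (y - x)" using d by (simp add: two_power_def d_def)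
    also have "8 * \<kappa> * conv_kernel (y - x) \<le> 8 * \<kappa> * (conv_kernel (y - x) + 1 / M)"
      using \<kappa>_nonneg M by (intro mult_left_mono) auto
    finally show ?thesis .
  next
    case False
    have "\<bar>g x - g y\<bar> * d powr (- 1 - \<alpha>) * M powr \<beta> \<le> \<kappa> * (8 * M powr (- (1 + \<alpha>))) * M powr \<beta>"
    proof (intro mult_right_mono mult_mono osc \<kappa>_nonneg)
      show "d powr (- 1 - \<alpha>) \<le> 8 * M powr (- (1 + \<alpha>))"
        using powr_neg_half_le[of M d "1 + \<alpha>"] False M \<alpha> by (simp add: algebra_simps)
    qed auto
    also have "\<dots> = 8 * \<kappa> * (M powr (- (1 + \<alpha>)) * M powr \<beta>)" by simp
    also have "\<dots> = 8 * \<kappa> * M powr (- \<beta>)"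
      unfolding powr_add[symmetric] using \<beta>(3) by (simp add: algebra_simps)
    also have "\<dots> \<le> 8 * \<kappa> * M powr (- 1)"
      using \<kappa>_nonneg M \<beta> by (intro mult_left_mono powr_mono) auto
    also have "M powr (- 1) = 1 / M" using M by (simp add: powr_minus_divide)
    also have "8 * \<kappa> * (1 / M) \<le> 8 * \<kappa> * (conv_kernel (y - x) + 1 / M)"
      using \<kappa>_nonneg by (intro mult_left_mono) auto
    finally show ?thesis .
  qed
  from mult_right_mono[OF this, of "weighted_size \<beta> u y"]
  have "\<bar>g x - g y\<bar> * d powr (- 1 - \<alpha>) * (M powr \<beta> * weighted_size \<beta> u y) \<le> 8 * \<kappa> * ((conv_kernel (y - x) + 1 / M) * weighted_size \<beta> u y)"
    by (simp add: mult_ac)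
  moreover have "\<bar>g x - g y\<bar> * d powr (- 1 - \<alpha>) * cmod (u y) \<le> \<bar>g x - g y\<bar> * d powr (- 1 - \<alpha>) * (M powr \<beta> * weighted_size \<beta> u y)"
    by (intro mult_left_mono u) auto
  ultimately show ?thesis unfolding M_def d_def by (simp add: mult_ac)
qed

text \<open>
  For \<open>\<alpha> < 2\<close>, the constant blows up as \<open>\<alpha>\<close> tends to 2, where the singular kernel \<open>\<bar>t\<bar> powr (- \<alpha> / 2)\<close> ceases to be
  integrable; the value for \<open>\<alpha> = 2\<close> comes from the local formula for the commutator.
\<close>

definition commutator_const :: real where
  "commutator_const = (if \<alpha> < 2 then ((16 * two_power_integral (- \<alpha> / 2) (- 2) + 64) / symbol_const \<alpha>)\<^sup>2
      * (2 * (two_power_integral (- \<alpha> / 2) (- 2))\<^sup>2 + 2 * (two_power_integral (-1/2) (-3/2))\<^sup>2) else 4)"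

lemma commutator_const_nonneg: "0 \<le> commutator_const"
  by (simp add: commutator_const_def)

context
  fixes u :: "real \<Rightarrow> complex"
  assumes u: "derivs_dominated 4 inv_quad u"
begin

text \<open>
  The two integral operators that dominate the commutator. Their values are extended nonnegative
  reals, so finiteness never has to be known before the Schur test supplies it.
\<close>

definition conv_part :: "real \<Rightarrow> ennreal" where
  "conv_part x = (\<integral>\<^sup>+y. ennreal (conv_kernel (y - x) * weighted_size \<beta> u y) \<partial>lborel)"
definition hilbert_part :: "real \<Rightarrow> ennreal" where
  "hilbert_part x = (\<integral>\<^sup>+y. ennreal (1 / max (japanese x) (japanese y) * weighted_size \<beta> u y) \<partial>lborel)"
definition commuted_increment :: "real \<Rightarrow> real \<Rightarrow> complex" where
  "commuted_increment x h = complex_of_real (g x - g (x + h)) * u (x + h)"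

lemma u_regular:
  "u differentiable at x" "continuous_on UNIV (vderiv u)"
  and u_measurable [measurable]: "u \<in> borel_measurable borel"
  and weighted_size_measurable' [measurable]: "weighted_size \<beta> u \<in> borel_measurable borel"
proof -
  have 4: "4 = Suc (Suc (Suc (Suc 0)))" by simp
  note d = u[unfolded 4]
  show "u differentiable at x" "continuous_on UNIV (vderiv u)" "u \<in> borel_measurable borel"
    "weighted_size \<beta> u \<in> borel_measurable borel"
    using d derivs_dominated_continuous[of "Suc (Suc (Suc 0))" inv_quad "vderiv u"] derivs_dominated_measurable[OF d] weighted_size_measurable[OF d] by auto
qed

lemma near_increment:
  assumes h: "0 < h" "h \<le> 1"
  shows "ennreal (h powr (- \<alpha>)) * ennreal (cmod (u (x + h) - u (x - h)))
    \<le> ennreal (4 * japanese x powr \<beta> * h powr (- \<alpha> / 2)) * conv_part x"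
proof -
  define c where "c = 4 * japanese x powr \<beta> * h powr (- \<alpha> / 2)"
  have pw: "h powr (- \<alpha>) * (indicator {x - h..x + h} y * cmod (vderiv u y)) \<le> c * (conv_kernel (y - x) * weighted_size \<beta> u y)"
    if "y \<noteq> x" for y
  proof (cases "y \<in> {x - h..x + h}")
    case True
    then have yx: "\<bar>y - x\<bar> \<le> h" "\<bar>y - x\<bar> \<le> 1" using h by auto
    \<comment> \<open>One half of the singularity becomes the convolution kernel in \<open>y - x\<close>, the other half is left for the integration in \<open>h\<close>; each half is integrable at 0 when \<open>\<alpha> < 2\<close>.\<close>
    have "h powr (- \<alpha>) = h powr (- \<alpha> / 2) * h powr (- \<alpha> / 2)"
      by (simp flip: powr_add)
    also have "\<dots> \<le> h powr (- \<alpha> / 2) * \<bar>y - x\<bar> powr (- \<alpha> / 2)"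
      using yx \<alpha> that by (intro mult_left_mono powr_mono2') auto
    also have "\<dots> = h powr (- \<alpha> / 2) * conv_kernel (y - x)" using yx by (simp add: two_power_def)
    finally have 1: "h powr (- \<alpha>) \<le> h powr (- \<alpha> / 2) * conv_kernel (y - x)" .
    have "cmod (vderiv u y) \<le> japanese y powr \<beta> * weighted_size \<beta> u y" by (rule le_weighted_size)
    also have "\<dots> \<le> 4 * japanese x powr \<beta> * weighted_size \<beta> u y"
      using near_japanese[OF yx(2)] \<beta> japanese_ge(3)[of y]
      by (intro mult_right_mono powr_double_le) auto
    finally have 2: "cmod (vderiv u y) \<le> 4 * japanese x powr \<beta> * weighted_size \<beta> u y" .
    have "h powr (- \<alpha>) * cmod (vderiv u y)
        \<le> (h powr (- \<alpha> / 2) * conv_kernel (y - x)) * (4 * japanese x powr \<beta> * weighted_size \<beta> u y)"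
      by (intro mult_mono 1 2) auto
    then show ?thesis using True by (simp add: c_def mult_ac)
  qed (simp add: c_def)
  have "ennreal (h powr (- \<alpha>)) * ennreal (cmod (u (x + h) - u (x - h)))
    \<le> ennreal (h powr (- \<alpha>)) * (\<integral>\<^sup>+y. ennreal (indicator {x - h..x + h} y * cmod (vderiv u y)) \<partial>lborel)"
    using h by (intro mult_left_mono cmod_increment_le_integral u_regular) auto
  also have "\<dots> = (\<integral>\<^sup>+y. ennreal (h powr (- \<alpha>) * (indicator {x - h..x + h} y * cmod (vderiv u y))) \<partial>lborel)"
    using u_regular(2)[THEN borel_measurable_continuous_onI]
    by (simp add: ennreal_mult nn_integral_cmult)
  also have "\<dots> \<le> (\<integral>\<^sup>+y. ennreal (c * (conv_kernel (y - x) * weighted_size \<beta> u y)) \<partial>lborel)"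
  proof (rule nn_integral_mono_AE)
    have "AE y in lborel. y \<noteq> x" by (rule AE_lborel_singleton)
    then show "AE y in lborel. ennreal (h powr (- \<alpha>) * (indicator {x - h..x + h} y * cmod (vderiv u y)))
        \<le> ennreal (c * (conv_kernel (y - x) * weighted_size \<beta> u y))"
      by eventually_elim (intro ennreal_leI pw)
  qed
  also have "\<dots> = ennreal c * conv_part x"
    unfolding conv_part_def by (subst nn_integral_cmult[symmetric]) (auto simp: c_def ennreal_mult)
  finally show ?thesis unfolding c_def .
qed

text \<open>
  The paired increment equals
  \<open>(g x - g (x + h)) (u (x + h) - u (x - h)) + (2 g x - g (x + h) - g (x - h)) u (x - h)\<close>.
  Each summand is of second order in \<open>h\<close>, and \<open>u\<close> is differentiated once in the first one and not at all
  in the second.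
\<close>

lemma near_kernel_pos:
  assumes h: "0 < h" "h \<le> 1"
  shows "ennreal (\<bar>h\<bar> powr (- 1 - \<alpha>) * cmod ((commuted_increment x h + commuted_increment x (- h)) / 2))
    \<le> ennreal (16 * \<kappa> * conv_kernel h) * conv_part x + ennreal (32 * \<kappa> * (conv_kernel h * (weighted_size \<beta> u (x + h) + weighted_size \<beta> u (x - h))))"
proof -
  define D where "D = cmod (u (x + h) - u (x - h))"
  define W where "W = japanese x powr (- (1 + \<alpha>))"
  have conv_kernel: "conv_kernel h = h powr (- \<alpha> / 2)" using h by (simp add: two_power_def)
  have W: "W * japanese x powr \<beta> \<le> 1"
  proof -
    have "W * japanese x powr \<beta> = japanese x powr (- \<beta>)"
      unfolding W_def powr_add[symmetric] using \<beta>(3) by (simp add: algebra_simps)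
    also have "\<dots> \<le> japanese x powr 0" using japanese_ge[of x] \<beta> by (intro powr_mono) auto
    finally show ?thesis using japanese_ge[of x] by simp
  qed
  have "commuted_increment x h + commuted_increment x (- h) = complex_of_real (g x - g (x + h)) * (u (x + h) - u (x - h))
      + complex_of_real (2 * g x - g (x + h) - g (x - h)) * u (x - h)"
    unfolding commuted_increment_def by (simp add: algebra_simps)
  then have "cmod (commuted_increment x h + commuted_increment x (- h)) \<le> \<bar>g x - g (x + h)\<bar> * D + \<bar>2 * g x - g (x + h) - g (x - h)\<bar> * cmod (u (x - h))"
    unfolding D_def by (metis norm_mult norm_of_real norm_triangle_ineq)
  also have "\<dots> \<le> 8 * \<kappa> * W * h * D + 16 * \<kappa> * W * h\<^sup>2 * cmod (u (x - h))"
    using first_difference[of h x] second_difference[of h x] h unfolding W_def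
    by (intro add_mono mult_right_mono) (auto simp: D_def)
  also have "\<dots> \<le> 8 * \<kappa> * W * h * D + 16 * \<kappa> * W * h\<^sup>2 * (4 * japanese x powr \<beta> * weighted_size \<beta> u (x - h))"
  proof (intro add_left_mono mult_left_mono)
    show "cmod (u (x - h)) \<le> 4 * japanese x powr \<beta> * weighted_size \<beta> u (x - h)"
      using near_japanese[of "x - h" x] h \<beta> japanese_ge(3)[of "x - h"]
      by (intro order.trans[OF le_weighted_size(1)[of u _ \<beta>]] mult_right_mono powr_double_le) auto
  qed (use \<kappa>_nonneg in \<open>auto simp: W_def\<close>)
  finally have "\<bar>h\<bar> powr (- 1 - \<alpha>) * cmod ((commuted_increment x h + commuted_increment x (- h)) / 2)
      \<le> h powr (- 1 - \<alpha>) * ((8 * \<kappa> * W * h * D + 16 * \<kappa> * W * h\<^sup>2 * (4 * japanese x powr \<beta> * weighted_size \<beta> u (x - h))) / 2)"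
    using h by (simp add: norm_divide mult_left_mono)
  also have "\<dots> = 4 * \<kappa> * W * ((h powr (- 1 - \<alpha>) * h) * D)
      + 32 * \<kappa> * ((W * japanese x powr \<beta>) * ((h powr (- 1 - \<alpha>) * h\<^sup>2) * weighted_size \<beta> u (x - h)))"
    by (simp add: field_simps)
  also have "h powr (- 1 - \<alpha>) * h = h powr (- \<alpha>)"
    using h powr_add[of h "- 1 - \<alpha>" 1] by simp
  also have "h powr (- 1 - \<alpha>) * h\<^sup>2 = h powr (1 - \<alpha>)"
    using h powr_add[of h "- 1 - \<alpha>" 2] by simp
  finally have 1: "\<bar>h\<bar> powr (- 1 - \<alpha>) * cmod ((commuted_increment x h + commuted_increment x (- h)) / 2)
     \<le> 4 * \<kappa> * W * (h powr (- \<alpha>) * D) + 32 * \<kappa> * ((W * japanese x powr \<beta>) * (h powr (1 - \<alpha>) * weighted_size \<beta> u (x - h)))" .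
  have 2: "32 * \<kappa> * ((W * japanese x powr \<beta>) * (h powr (1 - \<alpha>) * weighted_size \<beta> u (x - h)))
     \<le> 32 * \<kappa> * (conv_kernel h * (weighted_size \<beta> u (x + h) + weighted_size \<beta> u (x - h)))"
  proof (rule mult_left_mono)
    have "(W * japanese x powr \<beta>) * (h powr (1 - \<alpha>) * weighted_size \<beta> u (x - h)) \<le> 1 * (conv_kernel h * weighted_size \<beta> u (x - h))"
      unfolding conv_kernel using h \<alpha> by (intro mult_mono W mult_right_mono powr_mono') (auto simp: W_def)
    also have "\<dots> \<le> conv_kernel h * (weighted_size \<beta> u (x + h) + weighted_size \<beta> u (x - h))" by (simp add: mult_left_mono)
    finally show "(W * japanese x powr \<beta>) * (h powr (1 - \<alpha>) * weighted_size \<beta> u (x - h))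
       \<le> conv_kernel h * (weighted_size \<beta> u (x + h) + weighted_size \<beta> u (x - h))" .
  qed (use \<kappa>_nonneg in auto)
  have "ennreal (4 * \<kappa> * W * (h powr (- \<alpha>) * D)) = ennreal (4 * \<kappa> * W) * (ennreal (h powr (- \<alpha>)) * ennreal D)"
    using \<kappa>_nonneg by (simp add: ennreal_mult W_def D_def)
  also have "\<dots> \<le> ennreal (4 * \<kappa> * W) * (ennreal (4 * japanese x powr \<beta> * h powr (- \<alpha> / 2)) * conv_part x)"
    unfolding D_def by (intro mult_left_mono near_increment h) auto
  also have "\<dots> = ennreal (4 * \<kappa> * W * (4 * japanese x powr \<beta> * h powr (- \<alpha> / 2))) * conv_part x"
    using ennreal_mult[of "4 * \<kappa> * W" "4 * japanese x powr \<beta> * h powr (- \<alpha> / 2)"] \<kappa>_nonneg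
    by (simp add: W_def mult.assoc[symmetric])
  also have "4 * \<kappa> * W * (4 * japanese x powr \<beta> * h powr (- \<alpha> / 2)) = 16 * \<kappa> * conv_kernel h * (W * japanese x powr \<beta>)"
    unfolding conv_kernel by simp
  also have "ennreal (16 * \<kappa> * conv_kernel h * (W * japanese x powr \<beta>)) * conv_part x \<le> ennreal (16 * \<kappa> * conv_kernel h) * conv_part x"
    using W \<kappa>_nonneg by (intro mult_right_mono ennreal_leI mult_left_le) auto
  finally have 3: "ennreal (4 * \<kappa> * W * (h powr (- \<alpha>) * D)) \<le> ennreal (16 * \<kappa> * conv_kernel h) * conv_part x" .
  have "ennreal (\<bar>h\<bar> powr (- 1 - \<alpha>) * cmod ((commuted_increment x h + commuted_increment x (- h)) / 2))
     \<le> ennreal (4 * \<kappa> * W * (h powr (- \<alpha>) * D) + 32 * \<kappa> * ((W * japanese x powr \<beta>) * (h powr (1 - \<alpha>) * weighted_size \<beta> u (x - h))))"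
    by (intro ennreal_leI 1)
  also have "\<dots> = ennreal (4 * \<kappa> * W * (h powr (- \<alpha>) * D))
      + ennreal (32 * \<kappa> * ((W * japanese x powr \<beta>) * (h powr (1 - \<alpha>) * weighted_size \<beta> u (x - h))))"
    using \<kappa>_nonneg by (intro ennreal_plus) (auto simp: W_def D_def)
  also have "\<dots> \<le> ennreal (16 * \<kappa> * conv_kernel h) * conv_part x + ennreal (32 * \<kappa> * (conv_kernel h * (weighted_size \<beta> u (x + h) + weighted_size \<beta> u (x - h))))"
    by (intro add_mono 3 ennreal_leI 2)
  finally show ?thesis .
qed

text \<open>
  The sum of the two kernels of \<open>conv_part\<close> and \<open>hilbert_part\<close> acting on the weighted function,
  as a density in \<open>h\<close>.
\<close>

definition majorant :: "real \<Rightarrow> real \<Rightarrow> real" where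
  "majorant x h = (conv_kernel h + 1 / max (japanese x) (japanese (x + h))) * weighted_size \<beta> u (x + h)"

lemma majorant_nonneg: "0 \<le> majorant x h"
  using japanese_ge(3)[of x] by (simp add: majorant_def le_max_iff_disj less_imp_le)

lemma two_power_minus: "two_power a b (- h) = two_power a b h" by (simp add: two_power_def)

text \<open>
  Short and long increments combined. In \<open>h\<close>, the first term on the right only has to be
  integrable; the second one becomes a multiple of \<open>conv_part x + hilbert_part x\<close> after
  integration.
\<close>

lemma kernel_estimate:
  assumes "h \<noteq> 0"
  shows "ennreal (\<bar>h\<bar> powr (- 1 - \<alpha>) * cmod ((commuted_increment x h + commuted_increment x (- h)) / 2))
    \<le> ennreal (16 * \<kappa> * conv_kernel h) * conv_part x + ennreal (32 * \<kappa> * (majorant x h + majorant x (- h)))"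
proof (cases "\<bar>h\<bar> \<le> 1")
  case True
  have "conv_kernel h * weighted_size \<beta> u (x + k) \<le> majorant x k" if "\<bar>k\<bar> = \<bar>h\<bar>" for k
  proof -
    have "conv_kernel h = conv_kernel k" using that by (simp add: two_power_def)
    then show ?thesis
      using japanese_ge(3)[of x] by (simp add: majorant_def distrib_right le_max_iff_disj less_imp_le)
  qed
  from this[of h] this[of "- h"]
  have 1: "32 * \<kappa> * (conv_kernel h * (weighted_size \<beta> u (x + h) + weighted_size \<beta> u (x - h))) \<le> 32 * \<kappa> * (majorant x h + majorant x (- h))"
    using \<kappa>_nonneg by (intro mult_left_mono) (auto simp: distrib_left)
  have "ennreal (\<bar>h\<bar> powr (- 1 - \<alpha>) * cmod ((commuted_increment x h + commuted_increment x (- h)) / 2))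
    \<le> ennreal (16 * \<kappa> * conv_kernel h) * conv_part x + ennreal (32 * \<kappa> * (conv_kernel h * (weighted_size \<beta> u (x + h) + weighted_size \<beta> u (x - h))))"
  proof (cases "0 < h")
    case True
    then show ?thesis using near_kernel_pos[of h x] \<open>\<bar>h\<bar> \<le> 1\<close> by simp
  next
    case False
    then show ?thesis using near_kernel_pos[of "- h" x] \<open>\<bar>h\<bar> \<le> 1\<close> assms by (simp add: two_power_minus add.commute)
  qed
  also have "\<dots> \<le> ennreal (16 * \<kappa> * conv_kernel h) * conv_part x + ennreal (32 * \<kappa> * (majorant x h + majorant x (- h)))"
    by (intro add_left_mono ennreal_leI 1)
  finally show ?thesis .
next
  case False
  have 1: "\<bar>h\<bar> powr (- 1 - \<alpha>) * cmod (commuted_increment x k) \<le> 8 * \<kappa> * majorant x k" if "\<bar>k\<bar> = \<bar>h\<bar>" for k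
    using far_kernel[where u=u and y="x + k" and x=x] False that
    by (simp add: commuted_increment_def majorant_def norm_mult mult_ac del: of_real_diff)
  have "\<bar>h\<bar> powr (- 1 - \<alpha>) * cmod ((commuted_increment x h + commuted_increment x (- h)) / 2)
     \<le> \<bar>h\<bar> powr (- 1 - \<alpha>) * (cmod (commuted_increment x h) + cmod (commuted_increment x (- h)))"
  proof (rule mult_left_mono)
    have "cmod ((commuted_increment x h + commuted_increment x (- h)) / 2) = cmod (commuted_increment x h + commuted_increment x (- h)) / 2" by (simp add: norm_divide)
    then show "cmod ((commuted_increment x h + commuted_increment x (- h)) / 2) \<le> cmod (commuted_increment x h) + cmod (commuted_increment x (- h))"
      using norm_triangle_ineq[of "commuted_increment x h" "commuted_increment x (- h)"] norm_ge_zero[of "commuted_increment x h"] norm_ge_zero[of "commuted_increment x (- h)"]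
      by linarith
  qed simp
  also have "\<dots> \<le> 8 * \<kappa> * majorant x h + 8 * \<kappa> * majorant x (- h)"
    using 1[of h] 1[of "- h"] by (simp add: distrib_left)
  also have "\<dots> = 8 * (\<kappa> * (majorant x h + majorant x (- h)))" by (simp add: algebra_simps)
  also have "\<dots> \<le> 32 * (\<kappa> * (majorant x h + majorant x (- h)))"
    using \<kappa>_nonneg majorant_nonneg by (intro mult_right_mono) auto
  finally have "ennreal (\<bar>h\<bar> powr (- 1 - \<alpha>) * cmod ((commuted_increment x h + commuted_increment x (- h)) / 2)) \<le> ennreal (32 * \<kappa> * (majorant x h + majorant x (- h)))"
    by (intro ennreal_leI) (simp add: mult.assoc)
  then show ?thesis by (rule add_increasing[OF zero_le])
qed

lemma nn_integral_majorant: "(\<integral>\<^sup>+h. ennreal (majorant x h) \<partial>lborel) = conv_part x + hilbert_part x"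
proof -
  have "conv_part x + hilbert_part x = (\<integral>\<^sup>+y. ennreal (conv_kernel (y - x) * weighted_size \<beta> u y) + ennreal (1 / max (japanese x) (japanese y) * weighted_size \<beta> u y) \<partial>lborel)"
    unfolding conv_part_def hilbert_part_def by (subst nn_integral_add) auto
  also have "\<dots> = (\<integral>\<^sup>+y. ennreal (majorant x (y - x)) \<partial>lborel)"
    unfolding majorant_def using japanese_ge(3)[of x]
    by (subst ennreal_plus[symmetric]) (auto simp: distrib_right le_max_iff_disj less_imp_le)
  also have "\<dots> = (\<integral>\<^sup>+h. ennreal (majorant x h) \<partial>lborel)"
    unfolding majorant_def by (subst nn_integral_real_affine[of _ 1 x]) auto
  finally show ?thesis ..
qed

lemma commutator_pointwise:
  assumes "\<alpha> < 2" and dg: "derivs_dominated 4 (\<lambda>_. 1) (\<lambda>x. complex_of_real (g x))"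
  shows "ennreal (symbol_const \<alpha> * cmod (commutator (abs_D \<alpha>) (mult_op g) u x))
    \<le> ennreal (\<kappa> * (16 * two_power_integral (- \<alpha> / 2) (- 2) + 64)) * (conv_part x + hilbert_part x)"
proof -
  define G where "G h = complex_of_real (\<bar>h\<bar> powr (- 1 - \<alpha>)) * ((commuted_increment x h + commuted_increment x (- h)) / 2)" for h
  have eq: "complex_of_real (symbol_const \<alpha>) * commutator (abs_D \<alpha>) (mult_op g) u x = (LINT h|lborel. G h)"
    unfolding G_def commuted_increment_def by (rule commutator_kernel) (use \<alpha> assms u in auto)
  have "symbol_const \<alpha> * cmod (commutator (abs_D \<alpha>) (mult_op g) u x) = cmod (LINT h|lborel. G h)"
    unfolding eq[symmetric] norm_mult using symbol_const_pos[of \<alpha>] \<alpha> assms by simp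
  also have "ennreal \<dots> \<le> (\<integral>\<^sup>+h. ennreal (cmod (G h)) \<partial>lborel)"
    by (cases "integrable lborel G") (auto simp: integral_norm_bound_ennreal not_integrable_integral_eq)
  also have "\<dots> \<le> (\<integral>\<^sup>+h. ennreal (16 * \<kappa> * conv_kernel h) * conv_part x + ennreal (32 * \<kappa> * (majorant x h + majorant x (- h))) \<partial>lborel)"
  proof (rule nn_integral_mono_AE)
    have "AE h in lborel. h \<noteq> (0::real)" by (rule AE_lborel_singleton)
    then show "AE h in lborel. ennreal (cmod (G h)) \<le> ennreal (16 * \<kappa> * conv_kernel h) * conv_part x + ennreal (32 * \<kappa> * (majorant x h + majorant x (- h)))"
      by eventually_elim (use kernel_estimate[of _ x] in \<open>simp add: G_def norm_mult\<close>)
  qed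
  also have "\<dots> = (\<integral>\<^sup>+h. ennreal (16 * \<kappa>) * conv_part x * ennreal (conv_kernel h) + ennreal (32 * \<kappa>) * (ennreal (majorant x h) + ennreal (majorant x (- h))) \<partial>lborel)"
    using \<kappa>_nonneg majorant_nonneg by (simp add: ennreal_mult mult_ac)
  also have "\<dots> = ennreal (16 * \<kappa>) * conv_part x * (\<integral>\<^sup>+h. ennreal (conv_kernel h) \<partial>lborel)
      + ennreal (32 * \<kappa>) * ((\<integral>\<^sup>+h. ennreal (majorant x h) \<partial>lborel) + (\<integral>\<^sup>+h. ennreal (majorant x (- h)) \<partial>lborel))"
    unfolding majorant_def by (subst nn_integral_add, simp, simp, subst nn_integral_cmult, simp,
       subst nn_integral_cmult, simp, subst nn_integral_add) auto
  also have "(\<integral>\<^sup>+h. ennreal (majorant x (- h)) \<partial>lborel) = (\<integral>\<^sup>+h. ennreal (majorant x h) \<partial>lborel)"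
    unfolding majorant_def by (subst nn_integral_real_affine[of _ "- 1" 0]) auto
  also have "(\<integral>\<^sup>+h. ennreal (conv_kernel h) \<partial>lborel) = ennreal (two_power_integral (- \<alpha> / 2) (- 2))"
    using assms \<alpha> by (intro nn_integral_two_power) auto
  also note nn_integral_majorant
  also have "ennreal (16 * \<kappa>) * conv_part x * ennreal (two_power_integral (- \<alpha> / 2) (- 2)) + ennreal (32 * \<kappa>) * (conv_part x + hilbert_part x + (conv_part x + hilbert_part x))
     \<le> ennreal (16 * \<kappa>) * (conv_part x + hilbert_part x) * ennreal (two_power_integral (- \<alpha> / 2) (- 2)) + ennreal (32 * \<kappa>) * (conv_part x + hilbert_part x + (conv_part x + hilbert_part x))"
    by (intro add_right_mono mult_right_mono mult_left_mono) auto
  also have "\<dots> = (ennreal (16 * \<kappa>) * ennreal (two_power_integral (- \<alpha> / 2) (- 2)) + (ennreal (32 * \<kappa>) + ennreal (32 * \<kappa>))) * (conv_part x + hilbert_part x)"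
    by (simp add: distrib_left distrib_right mult_ac add_ac)
  also have "ennreal (16 * \<kappa>) * ennreal (two_power_integral (- \<alpha> / 2) (- 2)) + (ennreal (32 * \<kappa>) + ennreal (32 * \<kappa>))
      = ennreal (\<kappa> * (16 * two_power_integral (- \<alpha> / 2) (- 2) + 64))"
    using \<kappa>_nonneg two_power_integral_nonneg by (simp add: ennreal_mult[symmetric] ennreal_plus[symmetric] algebra_simps del: ennreal_plus)
  finally show ?thesis .
qed

lemma conv_hilbert_L2:
  assumes "\<alpha> < 2"
  shows "(\<integral>\<^sup>+x. (conv_part x + hilbert_part x)\<^sup>2 \<partial>lborel)
    \<le> ennreal (2 * (two_power_integral (- \<alpha> / 2) (- 2))\<^sup>2 + 2 * (two_power_integral (-1/2) (-3/2))\<^sup>2) * (\<integral>\<^sup>+y. ennreal ((weighted_size \<beta> u y)\<^sup>2) \<partial>lborel)"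
proof -
  have m: "conv_part \<in> borel_measurable borel" "hilbert_part \<in> borel_measurable borel"
    unfolding conv_part_def hilbert_part_def by measurable
  have 1: "(\<integral>\<^sup>+x. (conv_part x)\<^sup>2 \<partial>lborel) \<le> ennreal ((two_power_integral (- \<alpha> / 2) (- 2))\<^sup>2) * (\<integral>\<^sup>+y. ennreal ((weighted_size \<beta> u y)\<^sup>2) \<partial>lborel)"
    using convolution_bound[of "- \<alpha> / 2" "- 2" "weighted_size \<beta> u"] assms by (simp add: conv_part_def)
  have 2: "(\<integral>\<^sup>+x. (hilbert_part x)\<^sup>2 \<partial>lborel) \<le> ennreal ((two_power_integral (-1/2) (-3/2))\<^sup>2) * (\<integral>\<^sup>+y. ennreal ((weighted_size \<beta> u y)\<^sup>2) \<partial>lborel)"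
    using hilbert_bound[of "weighted_size \<beta> u"] by (simp add: hilbert_part_def)
  have "(\<integral>\<^sup>+x. (conv_part x + hilbert_part x)\<^sup>2 \<partial>lborel) \<le> (\<integral>\<^sup>+x. 2 * (conv_part x)\<^sup>2 + 2 * (hilbert_part x)\<^sup>2 \<partial>lborel)"
    by (intro nn_integral_mono ennreal_sum_square_le)
  also have "\<dots> = 2 * (\<integral>\<^sup>+x. (conv_part x)\<^sup>2 \<partial>lborel) + 2 * (\<integral>\<^sup>+x. (hilbert_part x)\<^sup>2 \<partial>lborel)"
    using m by (simp add: nn_integral_add nn_integral_cmult)
  also have "\<dots> \<le> 2 * (ennreal ((two_power_integral (- \<alpha> / 2) (- 2))\<^sup>2) * (\<integral>\<^sup>+y. ennreal ((weighted_size \<beta> u y)\<^sup>2) \<partial>lborel))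
      + 2 * (ennreal ((two_power_integral (-1/2) (-3/2))\<^sup>2) * (\<integral>\<^sup>+y. ennreal ((weighted_size \<beta> u y)\<^sup>2) \<partial>lborel))"
    by (intro add_mono mult_left_mono 1 2) auto
  also have "\<dots> = (2 * ennreal ((two_power_integral (- \<alpha> / 2) (- 2))\<^sup>2) + 2 * ennreal ((two_power_integral (-1/2) (-3/2))\<^sup>2)) * (\<integral>\<^sup>+y. ennreal ((weighted_size \<beta> u y)\<^sup>2) \<partial>lborel)"
    by (simp add: distrib_right mult.assoc)
  also have "2 * ennreal ((two_power_integral (- \<alpha> / 2) (- 2))\<^sup>2) + 2 * ennreal ((two_power_integral (-1/2) (-3/2))\<^sup>2)
      = ennreal (2 * (two_power_integral (- \<alpha> / 2) (- 2))\<^sup>2 + 2 * (two_power_integral (-1/2) (-3/2))\<^sup>2)"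
    by (simp add: ennreal_mult ennreal_plus)
  finally show ?thesis .
qed

lemma commutator_L2:
  assumes dg: "derivs_dominated 4 (\<lambda>_. 1) (\<lambda>x. complex_of_real (g x))"
  shows "(\<integral>\<^sup>+x. ennreal ((cmod (commutator (abs_D \<alpha>) (mult_op g) u x))\<^sup>2) \<partial>lborel)
    \<le> ennreal (commutator_const * \<kappa>\<^sup>2) * (\<integral>\<^sup>+y. ennreal ((weighted_size \<beta> u y)\<^sup>2) \<partial>lborel)"
proof (cases "\<alpha> < 2")
  case True
  define A where "A = 16 * two_power_integral (- \<alpha> / 2) (- 2) + 64"
  have A: "0 \<le> A" using two_power_integral_nonneg[of "- \<alpha> / 2" "- 2"] by (simp add: A_def)
  have I: "0 < symbol_const \<alpha>" using symbol_const_pos[of \<alpha>] \<alpha> True by simp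
  have m: "conv_part \<in> borel_measurable borel" "hilbert_part \<in> borel_measurable borel"
    unfolding conv_part_def hilbert_part_def by measurable
  have pw: "ennreal ((cmod (commutator (abs_D \<alpha>) (mult_op g) u x))\<^sup>2) \<le> ennreal ((\<kappa> * A / symbol_const \<alpha>)\<^sup>2) * (conv_part x + hilbert_part x)\<^sup>2" for x
  proof -
    have "ennreal (cmod (commutator (abs_D \<alpha>) (mult_op g) u x))
        = ennreal (1 / symbol_const \<alpha>) * ennreal (symbol_const \<alpha> * cmod (commutator (abs_D \<alpha>) (mult_op g) u x))"
      using I by (simp add: ennreal_mult[symmetric])
    also have "\<dots> \<le> ennreal (1 / symbol_const \<alpha>) * (ennreal (\<kappa> * A) * (conv_part x + hilbert_part x))"
      unfolding A_def by (intro mult_left_mono commutator_pointwise True dg) auto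
    also have "\<dots> = ennreal (\<kappa> * A / symbol_const \<alpha>) * (conv_part x + hilbert_part x)"
      unfolding mult.assoc[symmetric] using I A \<kappa>_nonneg by (simp add: ennreal_mult[symmetric])
    finally have "(ennreal (cmod (commutator (abs_D \<alpha>) (mult_op g) u x)))\<^sup>2 \<le> (ennreal (\<kappa> * A / symbol_const \<alpha>) * (conv_part x + hilbert_part x))\<^sup>2"
      by (intro power_mono) auto
    then show ?thesis using I A \<kappa>_nonneg by (simp add: power_mult_distrib ennreal_power)
  qed
  have "(\<integral>\<^sup>+x. ennreal ((cmod (commutator (abs_D \<alpha>) (mult_op g) u x))\<^sup>2) \<partial>lborel)
      \<le> (\<integral>\<^sup>+x. ennreal ((\<kappa> * A / symbol_const \<alpha>)\<^sup>2) * (conv_part x + hilbert_part x)\<^sup>2 \<partial>lborel)"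
    by (intro nn_integral_mono pw)
  also have "\<dots> = ennreal ((\<kappa> * A / symbol_const \<alpha>)\<^sup>2) * (\<integral>\<^sup>+x. (conv_part x + hilbert_part x)\<^sup>2 \<partial>lborel)"
    using m by (intro nn_integral_cmult) auto
  also have "\<dots> \<le> ennreal ((\<kappa> * A / symbol_const \<alpha>)\<^sup>2) * (ennreal (2 * (two_power_integral (- \<alpha> / 2) (- 2))\<^sup>2 + 2 * (two_power_integral (-1/2) (-3/2))\<^sup>2) * (\<integral>\<^sup>+y. ennreal ((weighted_size \<beta> u y)\<^sup>2) \<partial>lborel))"
    by (intro mult_left_mono conv_hilbert_L2 True) auto
  also have "\<dots> = ennreal ((\<kappa> * A / symbol_const \<alpha>)\<^sup>2 * (2 * (two_power_integral (- \<alpha> / 2) (- 2))\<^sup>2 + 2 * (two_power_integral (-1/2) (-3/2))\<^sup>2)) * (\<integral>\<^sup>+y. ennreal ((weighted_size \<beta> u y)\<^sup>2) \<partial>lborel)"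
    by (simp add: ennreal_mult mult.assoc del: ennreal_plus)
  also have "(\<kappa> * A / symbol_const \<alpha>)\<^sup>2 * (2 * (two_power_integral (- \<alpha> / 2) (- 2))\<^sup>2 + 2 * (two_power_integral (-1/2) (-3/2))\<^sup>2) = commutator_const * \<kappa>\<^sup>2"
    using True by (simp add: commutator_const_def A_def power_mult_distrib power_divide)
  finally show ?thesis .
next
  case False
  then have \<alpha>2: "\<alpha> = 2" using \<alpha> by simp
  have pw: "cmod (commutator (abs_D \<alpha>) (mult_op g) u x) \<le> 2 * \<kappa> * weighted_size \<beta> u x" for x
  proof -
    have "cmod (commutator (abs_D \<alpha>) (mult_op g) u x) \<le> \<bar>g'' x\<bar> * cmod (u x) + 2 * \<bar>g' x\<bar> * cmod (vderiv u x)"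
      unfolding \<alpha>2 commutator_2[OF u dg g g'] norm_minus_cancel
      by (rule order.trans[OF norm_triangle_ineq]) (simp add: norm_mult)
    also have "\<dots> \<le> (\<kappa> * japanese x powr (- (1 + \<alpha>))) * cmod (u x) + 2 * (\<kappa> * japanese x powr (- (1 + \<alpha>))) * cmod (vderiv u x)"
      by (intro add_mono mult_right_mono mult_left_mono g'_le g''_le) auto
    also have "\<dots> \<le> 2 * \<kappa> * (japanese x powr (- (1 + \<alpha>)) * (cmod (u x) + cmod (vderiv u x)))"
      using \<kappa>_nonneg by (simp add: algebra_simps)
    also have "\<dots> \<le> 2 * \<kappa> * weighted_size \<beta> u x"
      unfolding weighted_size_def using \<kappa>_nonneg japanese_ge(1)[of x] \<beta>
      by (intro mult_left_mono mult_right_mono powr_mono) auto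
    finally show ?thesis .
  qed
  have "(\<integral>\<^sup>+x. ennreal ((cmod (commutator (abs_D \<alpha>) (mult_op g) u x))\<^sup>2) \<partial>lborel)
      \<le> (\<integral>\<^sup>+x. ennreal (commutator_const * \<kappa>\<^sup>2) * ennreal ((weighted_size \<beta> u x)\<^sup>2) \<partial>lborel)"
  proof (rule nn_integral_mono)
    fix x
    have "(cmod (commutator (abs_D \<alpha>) (mult_op g) u x))\<^sup>2 \<le> (2 * \<kappa> * weighted_size \<beta> u x)\<^sup>2"
      by (intro power_mono pw) auto
    also have "\<dots> = commutator_const * \<kappa>\<^sup>2 * (weighted_size \<beta> u x)\<^sup>2" using False by (simp add: commutator_const_def power_mult_distrib)
    finally show "ennreal ((cmod (commutator (abs_D \<alpha>) (mult_op g) u x))\<^sup>2) \<le> ennreal (commutator_const * \<kappa>\<^sup>2) * ennreal ((weighted_size \<beta> u x)\<^sup>2)"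
      using False by (subst ennreal_mult[symmetric]) (auto simp: commutator_const_def intro!: ennreal_leI)
  qed
  also have "\<dots> = ennreal (commutator_const * \<kappa>\<^sup>2) * (\<integral>\<^sup>+y. ennreal ((weighted_size \<beta> u y)\<^sup>2) \<partial>lborel)"
    by (intro nn_integral_cmult) auto
  finally show ?thesis .
qed

end

end

section \<open>Powers of the Japanese bracket and their tail integrals\<close>

lemma japanese_powr_eq_bracket: "japanese x powr (- p) = bracket (p / 2) x"
  unfolding japanese_def bracket_def by (simp add: powr_half_sqrt[symmetric] powr_powr)

lemma bracket_le_inv_quad: "1 \<le> b \<Longrightarrow> bracket b x \<le> inv_quad x"
proof -
  assume "1 \<le> b"
  then have "bracket b x \<le> (1 + x\<^sup>2) powr (- 1)" unfolding bracket_def by (intro powr_mono) auto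
  then show ?thesis by (simp add: inv_quad_def powr_minus_divide)
qed

lemma bracket_measurable [measurable]: "bracket b \<in> borel_measurable borel"
  by (intro borel_measurable_continuous_onI continuous_bracket)

lemma integrable_bracket: assumes "1 \<le> b" shows "integrable lborel (bracket b)"
  using bracket_le_inv_quad[OF assms] by (intro Bochner_Integration.integrable_bound[OF integrable_inv_quad]) auto

lemma LINT_bracket_pos: assumes "1 \<le> b" shows "0 < (LINT s|lborel. bracket b s)"
proof -
  have "(LINT s|lborel. bracket b s) \<noteq> 0"
  proof
    assume "(LINT s|lborel. bracket b s) = 0"
    then have "AE s in lborel. bracket b s = 0"
      using integral_nonneg_eq_0_iff_AE[OF integrable_bracket[OF assms]] by simp
    then have "AE s in (lborel :: real measure). False"
      by eventually_elim (metis bracket_pos less_irrefl)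
    then show False by (simp add: AE_iff_measurable[of UNIV])
  qed
  moreover have "0 \<le> (LINT s|lborel. bracket b s)" by simp
  ultimately show ?thesis by linarith
qed

definition bracket_integral :: "real \<Rightarrow> real" where "bracket_integral \<alpha> = (LINT s|lborel. bracket ((1 + \<alpha>) / 2) s)"

lemma phi_eq: "phi \<alpha> y = (LINT s|lborel. indicator {y..} s * bracket ((1 + \<alpha>) / 2) s) / bracket_integral \<alpha>"
proof -
  have eq: "1 / japanese s powr (1 + \<alpha>) = bracket ((1 + \<alpha>) / 2) s" for s
    using japanese_powr_eq_bracket[of s "1 + \<alpha>"] powr_minus_divide[of "japanese s" "1 + \<alpha>"] by metis
  show ?thesis
    unfolding phi_def bracket_integral_def set_lebesgue_integral_def eq real_scaleR_def by (simp only: divide_inverse mult.commute)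
qed

lemma integrable_indicator_bracket:
  assumes "1 \<le> b" "S \<in> sets borel" shows "integrable lborel (\<lambda>s. indicator S s * bracket b s)"
  using integrable_mult_indicator[of S lborel "bracket b"] integrable_bracket[OF assms(1)] assms(2) by simp

lemma phi_bounds:
  assumes "1 \<le> \<alpha>" shows "0 \<le> phi \<alpha> y" "phi \<alpha> y \<le> 1"
proof -
  have b: "1 \<le> (1 + \<alpha>) / 2" using assms by simp
  have Z: "0 < bracket_integral \<alpha>" unfolding bracket_integral_def by (rule LINT_bracket_pos[OF b])
  show "0 \<le> phi \<alpha> y" unfolding phi_eq using Z by simp
  have "(LINT s|lborel. indicator {y..} s * bracket ((1 + \<alpha>) / 2) s) \<le> bracket_integral \<alpha>"
    unfolding bracket_integral_def
    by (intro integral_mono integrable_indicator_bracket integrable_bracket b) (auto simp: indicator_def)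
  then show "phi \<alpha> y \<le> 1" unfolding phi_eq using Z by simp
qed

lemma phi_deriv:
  assumes "1 \<le> \<alpha>"
  shows "(phi \<alpha> has_real_derivative - (bracket ((1 + \<alpha>) / 2) y / bracket_integral \<alpha>)) (at y)"
proof -
  define b where "b = (1 + \<alpha>) / 2"
  have b: "1 \<le> b" using assms by (simp add: b_def)
  \<comment> \<open>Any base point to the left of \<open>y\<close> serves to write the tail integral, near \<open>y\<close>, as a constant minus an integral over a compact interval.\<close>
  define c where "c = y - 1"
  have eq: "phi \<alpha> x = phi \<alpha> c - integral {c..x} (bracket b) / bracket_integral \<alpha>" if "c \<le> x" for x
  proof -
    have "(LINT s|lborel. indicator {c..} s * bracket b s)
       = (LINT s|lborel. indicator {c..x} s * bracket b s + indicator {x..} s * bracket b s)"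
    proof (rule integral_cong_AE)
      have "AE s in lborel. s \<noteq> x" by (rule AE_lborel_singleton)
      then show "AE s in lborel. indicator {c..} s * bracket b s = indicator {c..x} s * bracket b s + indicator {x..} s * bracket b s"
        by eventually_elim (use that in \<open>auto simp: indicator_def\<close>)
    qed auto
    also have "\<dots> = (LINT s|lborel. indicator {c..x} s * bracket b s) + (LINT s|lborel. indicator {x..} s * bracket b s)"
      by (intro Bochner_Integration.integral_add integrable_indicator_bracket b) auto
    also have "(LINT s|lborel. indicator {c..x} s * bracket b s) = integral {c..x} (bracket b)"
      using set_borel_integral_eq_integral(2)[of "{c..x}" "bracket b"] integrable_indicator_bracket[OF b, of "{c..x}"]
      by (simp add: set_integrable_def set_lebesgue_integral_def)
    finally show ?thesis unfolding phi_eq b_def[symmetric] by (simp add: diff_divide_distrib[symmetric])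
  qed
  have "((\<lambda>x. integral {c..x} (bracket b)) has_real_derivative bracket b y) (at y within {c..y + 1})"
    by (rule integral_has_real_derivative) (auto simp: c_def intro: continuous_bracket)
  then have "((\<lambda>x. integral {c..x} (bracket b)) has_real_derivative bracket b y) (at y)"
    using at_within_interior[of y "{c..y + 1}"] by (simp add: c_def)
  then have "((\<lambda>x. phi \<alpha> c - integral {c..x} (bracket b) / bracket_integral \<alpha>) has_real_derivative 0 - bracket b y / bracket_integral \<alpha>) (at y)"
    by (intro DERIV_diff DERIV_const DERIV_cdivide)
  then have "(phi \<alpha> has_real_derivative 0 - bracket b y / bracket_integral \<alpha>) (at y)"
  proof (rule has_field_derivative_transform_within_open)
    show "open {c<..}" "y \<in> {c<..}" by (auto simp: c_def)
    show "phi \<alpha> c - integral {c..x} (bracket b) / bracket_integral \<alpha> = phi \<alpha> x" if "x \<in> {c<..}" for x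
      using that by (intro eq[symmetric]) simp
  qed
  then show ?thesis by (simp add: b_def)
qed

section \<open>Scaling and Sobolev norms\<close>

lemma fourier_scale:
  assumes "0 < A"
  shows "fourier (\<lambda>x. f (x / A)) \<xi> = complex_of_real A * fourier f (A * \<xi>)"
proof -
  have "(LINT x|lborel. exp (- (\<i> * complex_of_real (x * \<xi>))) * f (x / A))
      = A *\<^sub>R (LINT x|lborel. exp (- (\<i> * complex_of_real (A * x * \<xi>))) * f x)"
    using lborel_integral_real_affine[of A "\<lambda>x. exp (- (\<i> * complex_of_real (x * \<xi>))) * f (x / A)" 0] assms
    by simp
  moreover have "A * x * \<xi> = x * (A * \<xi>)" for x by (simp only: mult_ac)
  ultimately show ?thesis unfolding fourier_def scaleR_conv_of_real by (simp only:)
qed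

lemma abs_D_scale:
  assumes "0 < A"
  shows "abs_D \<alpha> (\<lambda>x. f (x / A)) x = complex_of_real (A powr (- \<alpha>)) * abs_D \<alpha> f (x / A)"
proof -
  define G where "G \<xi> = exp (\<i> * complex_of_real (x / A * \<xi>)) * (complex_of_real (\<bar>\<xi>\<bar> powr \<alpha>) * fourier f \<xi>)" for \<xi>
  define G' where "G' \<xi> = exp (\<i> * complex_of_real (x * \<xi>)) *
      (complex_of_real (\<bar>\<xi>\<bar> powr \<alpha>) * (complex_of_real A * fourier f (A * \<xi>)))" for \<xi>
  have "G' (0 + 1 / A * \<xi>) = complex_of_real (A * A powr (- \<alpha>)) * G \<xi>" for \<xi>
  proof -
    have e: "x * (0 + 1 / A * \<xi>) = x / A * \<xi>" "A * (0 + 1 / A * \<xi>) = \<xi>" using assms by auto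
    have p: "\<bar>0 + 1 / A * \<xi>\<bar> powr \<alpha> = \<bar>\<xi>\<bar> powr \<alpha> * A powr (- \<alpha>)"
      using assms by (simp add: abs_divide powr_divide powr_minus_divide)
    show ?thesis unfolding G_def G'_def e p of_real_mult by (simp only: mult_ac)
  qed
  then have "(LINT \<xi>|lborel. G' \<xi>) = \<bar>1 / A\<bar> *\<^sub>R (complex_of_real (A * A powr (- \<alpha>)) * (LINT \<xi>|lborel. G \<xi>))"
    using lborel_integral_real_affine[of "1 / A" G' 0] assms by simp
  also have "\<dots> = complex_of_real (A powr (- \<alpha>)) * (LINT \<xi>|lborel. G \<xi>)"
    using assms by (simp add: scaleR_conv_of_real)
  finally show ?thesis
    unfolding abs_D_def fourier_multiplier_def inv_fourier_def fourier_scale[OF assms] G_def G'_def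
    by (simp only: mult.left_commute)
qed

lemma commutator_scale:
  assumes "0 < A"
  shows "commutator (abs_D \<alpha>) (mult_op (\<lambda>x. g (x / A))) u x
    = complex_of_real (A powr (- \<alpha>)) * commutator (abs_D \<alpha>) (mult_op g) (\<lambda>x. u (A * x)) (x / A)"
proof -
  have 1: "u = (\<lambda>x. (\<lambda>x. u (A * x)) (x / A))" using assms by simp
  have 2: "mult_op (\<lambda>x. g (x / A)) u = (\<lambda>x. mult_op g (\<lambda>x. u (A * x)) (x / A))"
    using assms by (simp add: mult_op_def fun_eq_iff)
  have "abs_D \<alpha> u x = complex_of_real (A powr (- \<alpha>)) * abs_D \<alpha> (\<lambda>x. u (A * x)) (x / A)"
    by (subst 1) (rule abs_D_scale[OF assms])
  moreover have "abs_D \<alpha> (mult_op (\<lambda>x. g (x / A)) u) x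
      = complex_of_real (A powr (- \<alpha>)) * abs_D \<alpha> (mult_op g (\<lambda>x. u (A * x))) (x / A)"
    unfolding 2 by (rule abs_D_scale[OF assms])
  ultimately show ?thesis
    unfolding commutator_def by (simp add: mult_op_def algebra_simps)
qed

lemma L2_norm_power2: "(L2_norm f)\<^sup>2 = (LINT x|lborel. (cmod (f x))\<^sup>2)"
  unfolding L2_norm_def by simp

lemma L2_norm_scale:
  assumes "0 < A" shows "(L2_norm (\<lambda>x. c * f (x / A)))\<^sup>2 = (cmod c)\<^sup>2 * A * (L2_norm f)\<^sup>2"
proof -
  have "(L2_norm (\<lambda>x. c * f (x / A)))\<^sup>2 = (LINT x|lborel. (cmod c)\<^sup>2 * (cmod (f (x / A)))\<^sup>2)"
    unfolding L2_norm_power2 by (simp add: norm_mult power_mult_distrib)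
  also have "(LINT x|lborel. (cmod c)\<^sup>2 * (cmod (f (x / A)))\<^sup>2) = (cmod c)\<^sup>2 * (LINT x|lborel. (cmod (f (x / A)))\<^sup>2)"
    by (rule integral_mult_right_zero)
  also have "(LINT x|lborel. (cmod (f (x / A)))\<^sup>2) = A * (LINT x|lborel. (cmod (f x))\<^sup>2)"
    by (subst lborel_integral_real_affine[of A _ 0]) (use assms in auto)
  finally show ?thesis unfolding L2_norm_power2 by simp
qed

lemma in_L2_scale:
  assumes "0 < A" "in_L2 f" shows "in_L2 (\<lambda>x. c * f (x / A))"
proof -
  have [measurable]: "f \<in> borel_measurable borel" and int: "integrable lborel (\<lambda>x. (cmod (f x))\<^sup>2)"
    using assms(2) by (auto simp: in_L2_def)
  have "integrable lborel (\<lambda>x. (cmod c)\<^sup>2 * (cmod (f (x / A)))\<^sup>2)"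
    using lborel_integrable_real_affine[OF int, of "1 / A" 0] assms(1) by auto
  then show ?thesis unfolding in_L2_def by (auto simp: norm_mult power_mult_distrib)
qed

lemma in_L2_derivs_dominated: assumes "derivs_dominated n inv_quad f" shows "in_L2 f"
proof -
  have [measurable]: "f \<in> borel_measurable borel" by (rule derivs_dominated_measurable[OF assms])
  obtain M where M: "\<And>x. cmod (f x) \<le> M * inv_quad x" using derivs_dominated_bound[OF assms] by blast
  have le: "(cmod (f x))\<^sup>2 \<le> M\<^sup>2 * inv_quad x" for x
  proof -
    have "(cmod (f x))\<^sup>2 \<le> (M * inv_quad x)\<^sup>2" using M by (intro power_mono) auto
    also have "\<dots> = M\<^sup>2 * (inv_quad x * inv_quad x)" by (simp add: power2_eq_square)
    also have "\<dots> \<le> M\<^sup>2 * (inv_quad x * 1)" by (intro mult_left_mono inv_quad_le_1) auto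
    finally show ?thesis by simp
  qed
  have "integrable lborel (\<lambda>x. (cmod (f x))\<^sup>2)"
  proof (rule Bochner_Integration.integrable_bound)
    show "integrable lborel (\<lambda>x. M\<^sup>2 * inv_quad x)" using integrable_inv_quad by simp
    show "AE x in lborel. norm ((cmod (f x))\<^sup>2) \<le> norm (M\<^sup>2 * inv_quad x)"
      using le by (intro AE_I2) (simp add: abs_mult)
  qed simp
  then show ?thesis by (simp add: in_L2_def)
qed

text \<open>
  Estimates in extended nonnegative reals give square integrability along with the bound.
\<close>

lemma in_L2_nn_integral:
  assumes [measurable]: "f \<in> borel_measurable borel"
    and le: "(\<integral>\<^sup>+x. ennreal ((cmod (f x))\<^sup>2) \<partial>lborel) \<le> ennreal X" and X: "0 \<le> X"
  shows "in_L2 f" "(L2_norm f)\<^sup>2 \<le> X"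
proof -
  have int: "integrable lborel (\<lambda>x. (cmod (f x))\<^sup>2)"
    using le_less_trans[OF le ennreal_less_top] by (intro integrableI_nonneg) auto
  then show "in_L2 f" by (simp add: in_L2_def)
  have "ennreal (LINT x|lborel. (cmod (f x))\<^sup>2) \<le> ennreal X"
    using nn_integral_eq_integral[OF int] le by simp
  then show "(L2_norm f)\<^sup>2 \<le> X" unfolding L2_norm_power2 using X by simp
qed

lemma inv_quad_scale_le: assumes "1 \<le> A" shows "inv_quad (A * x) \<le> 1 * inv_quad x" "inv_quad (1 / A * x) \<le> A\<^sup>2 * inv_quad x"
proof -
  have A: "1 \<le> A\<^sup>2" using assms by (simp add: one_le_power)
  have "x\<^sup>2 \<le> (A * x)\<^sup>2" using mult_right_mono[OF A, of "x\<^sup>2"] by (simp add: power_mult_distrib)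
  then show "inv_quad (A * x) \<le> 1 * inv_quad x" unfolding inv_quad_def by (simp add: frac_le)
  define y where "y = 1 / A * x"
  have "1 + x\<^sup>2 \<le> A\<^sup>2 * (1 + y\<^sup>2)" using A assms by (simp add: y_def distrib_left power_divide)
  then have "1 \<le> A\<^sup>2 * (1 + y\<^sup>2) / (1 + x\<^sup>2)" by (simp add: pos_le_divide_eq)
  then have "1 / (1 + y\<^sup>2) \<le> A\<^sup>2 * (1 / (1 + x\<^sup>2))" by (intro mult_imp_div_pos_le) auto
  then show "inv_quad (1 / A * x) \<le> A\<^sup>2 * inv_quad x" by (simp only: inv_quad_def y_def)
qed

section \<open>The profile and its weight\<close>

lemma phi1_weight_estimate:
  fixes \<mu>1 \<mu>2 :: real
  assumes "1 \<le> \<alpha>" "\<alpha> \<le> 2"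
  defines "b \<equiv> 1 / (1 + \<mu>1)\<^sup>2 - 1 / (1 + \<mu>2)\<^sup>2"
  defines "w \<equiv> bracket ((1 + \<alpha>) / 2)"
  shows "weight_estimate \<alpha> (\<bar>b\<bar> * (1 + 3 / bracket_integral \<alpha>)) (phi1 \<alpha> \<mu>1 \<mu>2) (\<lambda>y. b / bracket_integral \<alpha> * w y)
      (\<lambda>y. b / bracket_integral \<alpha> * (- (1 + \<alpha>) * (slope y * w y)))"
    and "derivs_dominated 4 (\<lambda>_. 1) (\<lambda>x. complex_of_real (phi1 \<alpha> \<mu>1 \<mu>2 x))"
    and "Phi1 \<alpha> \<mu>1 \<mu>2 = (\<lambda>y. sqrt (\<bar>b\<bar> / bracket_integral \<alpha>) * bracket ((1 + \<alpha>) / 4) y)"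
proof -
  have Z: "0 < bracket_integral \<alpha>" unfolding bracket_integral_def using assms by (intro LINT_bracket_pos) auto
  have eq: "phi1 \<alpha> \<mu>1 \<mu>2 y = 1 / (1 + \<mu>1)\<^sup>2 - b * phi \<alpha> y" for y
    unfolding phi1_def b_def by (simp add: diff_divide_distrib algebra_simps)
  have d1: "(phi1 \<alpha> \<mu>1 \<mu>2 has_real_derivative b / bracket_integral \<alpha> * w y) (at y)" for y
    unfolding eq[abs_def] w_def by (rule derivative_eq_intros phi_deriv assms refl)+ simp
  have d2: "((\<lambda>y. b / bracket_integral \<alpha> * w y) has_real_derivative b / bracket_integral \<alpha> * (- (1 + \<alpha>) * (slope y * w y))) (at y)" for y
  proof -
    have "- 2 * ((1 + \<alpha>) / 2) = - (1 + \<alpha>)" by simp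
    then show ?thesis
      using DERIV_cmult[OF bracket_deriv[of "(1 + \<alpha>) / 2" y], of "b / bracket_integral \<alpha>"] unfolding w_def by (simp only:)
  qed
  have osc: "\<bar>phi1 \<alpha> \<mu>1 \<mu>2 x - phi1 \<alpha> \<mu>1 \<mu>2 y\<bar> \<le> \<bar>b\<bar>" for x y
  proof -
    have "\<bar>phi1 \<alpha> \<mu>1 \<mu>2 x - phi1 \<alpha> \<mu>1 \<mu>2 y\<bar> = \<bar>b\<bar> * \<bar>phi \<alpha> y - phi \<alpha> x\<bar>"
      unfolding eq by (simp add: abs_mult[symmetric] algebra_simps)
    also have "\<dots> \<le> \<bar>b\<bar> * 1"
      using phi_bounds[OF assms(1), of x] phi_bounds[OF assms(1), of y] by (intro mult_left_mono) auto
    finally show ?thesis by simp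
  qed
  have w: "0 \<le> w y" "w y = japanese y powr (- (1 + \<alpha>))" for y
    unfolding w_def japanese_powr_eq_bracket by auto
  \<comment> \<open>The constant \<open>1 + 3 / bracket_integral \<alpha>\<close> covers the oscillation, which contributes 1, and the two derivatives, whose factors 1 and \<open>1 + \<alpha>\<close> are at most 3.\<close>
  have K: "\<bar>b\<bar> / bracket_integral \<alpha> * (c * w y) \<le> \<bar>b\<bar> * (1 + 3 / bracket_integral \<alpha>) * w y" if "c \<le> 3" for c y
  proof -
    have "\<bar>b\<bar> / bracket_integral \<alpha> * c \<le> \<bar>b\<bar> / bracket_integral \<alpha> * 3" using Z that by (intro mult_left_mono) auto
    also have "\<dots> \<le> \<bar>b\<bar> * (1 + 3 / bracket_integral \<alpha>)" by (simp add: distrib_left)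
    finally show ?thesis using w(1)[of y] mult_right_mono by fastforce
  qed
  show "weight_estimate \<alpha> (\<bar>b\<bar> * (1 + 3 / bracket_integral \<alpha>)) (phi1 \<alpha> \<mu>1 \<mu>2) (\<lambda>y. b / bracket_integral \<alpha> * w y)
      (\<lambda>y. b / bracket_integral \<alpha> * (- (1 + \<alpha>) * (slope y * w y)))"
  proof (unfold_locales, fact, fact, fact d1, fact d2)
    show "\<bar>phi1 \<alpha> \<mu>1 \<mu>2 x - phi1 \<alpha> \<mu>1 \<mu>2 y\<bar> \<le> \<bar>b\<bar> * (1 + 3 / bracket_integral \<alpha>)" for x y
      using osc[of x y] Z by (smt (verit) divide_pos_pos mult_left_le mult_le_cancel_left1 abs_ge_zero)
    show "\<bar>b / bracket_integral \<alpha> * w x\<bar> \<le> \<bar>b\<bar> * (1 + 3 / bracket_integral \<alpha>) * japanese x powr (- (1 + \<alpha>))" for x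
      using K[of 1 x] Z w(1)[of x] unfolding w(2)[symmetric] by (simp add: abs_mult)
    show "\<bar>b / bracket_integral \<alpha> * (- (1 + \<alpha>) * (slope x * w x))\<bar> \<le> \<bar>b\<bar> * (1 + 3 / bracket_integral \<alpha>) * japanese x powr (- (1 + \<alpha>))" for x
    proof -
      have "\<bar>b / bracket_integral \<alpha> * (- (1 + \<alpha>) * (slope x * w x))\<bar> = \<bar>b\<bar> / bracket_integral \<alpha> * (((1 + \<alpha>) * \<bar>slope x\<bar>) * w x)"
        using Z w(1)[of x] assms by (simp add: abs_mult)
      also have "\<dots> \<le> \<bar>b\<bar> * (1 + 3 / bracket_integral \<alpha>) * w x"
      proof (rule K)
        show "(1 + \<alpha>) * \<bar>slope x\<bar> \<le> 3" using mult_mono[of "1 + \<alpha>" 3 "\<bar>slope x\<bar>" 1] slope_le_1[of x] assms by simp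
      qed
      finally show ?thesis unfolding w(2) .
    qed
  qed
  have 4: "4 = Suc 3" by simp
  show "derivs_dominated 4 (\<lambda>_. 1) (\<lambda>x. complex_of_real (phi1 \<alpha> \<mu>1 \<mu>2 x))"
    unfolding 4 derivs_dominated.simps
  proof (intro conjI)
    show "\<forall>x. (\<lambda>x. complex_of_real (phi1 \<alpha> \<mu>1 \<mu>2 x)) differentiable at x"
      using vderiv_of_real(2)[OF d1] by blast
    have "cmod (complex_of_real (phi1 \<alpha> \<mu>1 \<mu>2 x)) \<le> (\<bar>phi1 \<alpha> \<mu>1 \<mu>2 0\<bar> + \<bar>b\<bar>) * 1" for x
      using osc[of x 0] by simp
    then show "\<exists>M. \<forall>x. cmod (complex_of_real (phi1 \<alpha> \<mu>1 \<mu>2 x)) \<le> M * 1" by blast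
    show "derivs_dominated 3 (\<lambda>_. 1) (vderiv (\<lambda>x. complex_of_real (phi1 \<alpha> \<mu>1 \<mu>2 x)))"
      unfolding vderiv_of_real(1)[OF d1] of_real_mult w_def using assms by (intro derivs_dominated_cmult derivs_dominated_bracket) auto
  qed
  show "Phi1 \<alpha> \<mu>1 \<mu>2 = (\<lambda>y. sqrt (\<bar>b\<bar> / bracket_integral \<alpha>) * bracket ((1 + \<alpha>) / 4) y)"
  proof
    fix y
    have "\<bar>deriv (phi1 \<alpha> \<mu>1 \<mu>2) y\<bar> = \<bar>b\<bar> / bracket_integral \<alpha> * w y"
      using DERIV_imp_deriv[OF d1[of y]] Z w(1)[of y] by (simp add: abs_mult)
    moreover have "w y = (bracket ((1 + \<alpha>) / 4) y)\<^sup>2"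
      unfolding w_def bracket_def by (simp add: power2_eq_square powr_add[symmetric])
    ultimately show "Phi1 \<alpha> \<mu>1 \<mu>2 y = sqrt (\<bar>b\<bar> / bracket_integral \<alpha>) * bracket ((1 + \<alpha>) / 4) y"
      unfolding Phi1_def by (simp add: real_sqrt_mult real_sqrt_divide)
  qed
qed

text \<open>
  \<open>S\<close> times the weight times \<open>u'\<close> is the derivative of the weighted function minus a term in which the
  derivative falls on the weight, and the latter is bounded by a multiple of the weight itself.
\<close>

lemma weighted_size_le_H1:
  assumes u: "derivs_dominated (Suc n) inv_quad u" and S: "0 \<le> S" and b: "0 \<le> b" "b \<le> 1"
  defines "v \<equiv> \<lambda>x. complex_of_real (S * bracket b x) * u x"
  shows "derivs_dominated (Suc n) inv_quad v"
    and "S\<^sup>2 * (LINT x|lborel. (weighted_size (2 * b) u x)\<^sup>2) \<le> 18 * (H1_norm v)\<^sup>2"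
    and "integrable lborel (\<lambda>x. (weighted_size (2 * b) u x)\<^sup>2)"
proof -
  note prod = derivs_dominated_mult[of _ "\<lambda>_. 1" _ inv_quad, simplified]
  show v: "derivs_dominated (Suc n) inv_quad v"
    unfolding v_def of_real_mult by (intro prod derivs_dominated_cmult derivs_dominated_bracket u b) auto
  have du: "u differentiable at x" "derivs_dominated n inv_quad (vderiv u)" for x using u by auto
  have w: "weighted_size (2 * b) u x = bracket b x * (cmod (u x) + cmod (vderiv u x))" for x
    unfolding weighted_size_def japanese_powr_eq_bracket[of x "2 * b"] by simp
  have "derivs_dominated (Suc n) inv_quad (\<lambda>x. complex_of_real (bracket b x) * u x)"
    by (intro prod derivs_dominated_bracket u b)
  moreover have "derivs_dominated n inv_quad (\<lambda>x. complex_of_real (bracket b x) * vderiv u x)"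
    by (intro prod derivs_dominated_bracket du b)
  ultimately have "in_L2 (\<lambda>x. complex_of_real (bracket b x) * u x)" "in_L2 (\<lambda>x. complex_of_real (bracket b x) * vderiv u x)"
    using in_L2_derivs_dominated by blast+
  then have i: "integrable lborel (\<lambda>x. (bracket b x * cmod (u x))\<^sup>2)" "integrable lborel (\<lambda>x. (bracket b x * cmod (vderiv u x))\<^sup>2)"
    unfolding in_L2_def by (auto simp: norm_mult)
  show int: "integrable lborel (\<lambda>x. (weighted_size (2 * b) u x)\<^sup>2)"
  proof (rule Bochner_Integration.integrable_bound)
    show "integrable lborel (\<lambda>x. 2 * (bracket b x * cmod (u x))\<^sup>2 + 2 * (bracket b x * cmod (vderiv u x))\<^sup>2)"
      using i by auto
    show "(\<lambda>x. (weighted_size (2 * b) u x)\<^sup>2) \<in> borel_measurable lborel"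
      using weighted_size_measurable[OF u] by measurable
    have "(s + t)\<^sup>2 \<le> 2 * s\<^sup>2 + 2 * t\<^sup>2" for s t :: real
      using zero_le_power2[of "s - t"] by (simp add: power2_eq_square algebra_simps)
    then show "AE x in lborel. norm ((weighted_size (2 * b) u x)\<^sup>2) \<le> norm (2 * (bracket b x * cmod (u x))\<^sup>2 + 2 * (bracket b x * cmod (vderiv u x))\<^sup>2)"
      unfolding w distrib_left by (auto simp: abs_of_nonneg)
  qed
  have v': "vderiv v x = complex_of_real (S * bracket b x) * vderiv u x + complex_of_real (S * (- 2 * b * (slope x * bracket b x))) * u x" for x
    unfolding v_def
    by (intro fun_cong[of "vderiv _"] vderiv_eqI has_vector_derivative_mult of_real_has_vderiv has_vderiv du)
       (rule derivative_eq_intros bracket_deriv refl | simp)+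
  have pw: "S\<^sup>2 * (weighted_size (2 * b) u x)\<^sup>2 \<le> 18 * (cmod (v x))\<^sup>2 + 18 * (cmod (vderiv v x))\<^sup>2" for x
  proof -
    have 1: "S * bracket b x * cmod (u x) = cmod (v x)" using S by (simp add: v_def norm_mult)
    have "S * bracket b x * cmod (vderiv u x) = cmod (vderiv v x - complex_of_real (S * (- 2 * b * (slope x * bracket b x))) * u x)"
      unfolding v' using S by (simp add: norm_mult)
    also have "\<dots> \<le> cmod (vderiv v x) + cmod (complex_of_real (S * (- 2 * b * (slope x * bracket b x))) * u x)"
      by (rule norm_triangle_ineq4)
    also have "cmod (complex_of_real (S * (- 2 * b * (slope x * bracket b x))) * u x) = (2 * b * \<bar>slope x\<bar>) * cmod (v x)"
      unfolding 1[symmetric] using S b by (simp add: norm_mult abs_mult)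
    also have "\<dots> \<le> 2 * cmod (v x)"
      using b slope_le_1[of x] mult_mono[of b 1 "\<bar>slope x\<bar>" 1] by (intro mult_right_mono) auto
    finally have 2: "S * bracket b x * cmod (vderiv u x) \<le> cmod (vderiv v x) + 2 * cmod (v x)" by simp
    have "S * weighted_size (2 * b) u x \<le> 3 * cmod (v x) + cmod (vderiv v x)"
      using 1 2 by (simp add: w distrib_left mult.assoc)
    then have "(S * weighted_size (2 * b) u x)\<^sup>2 \<le> (3 * cmod (v x) + cmod (vderiv v x))\<^sup>2"
      using S by (intro power_mono) auto
    also have "\<dots> \<le> 18 * (cmod (v x))\<^sup>2 + 18 * (cmod (vderiv v x))\<^sup>2"
    proof -
      have "(3 * s + t)\<^sup>2 \<le> 18 * s\<^sup>2 + 18 * t\<^sup>2" for s t :: real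
      proof -
        have "(3 * s + t)\<^sup>2 + (3 * s - t)\<^sup>2 = 18 * s\<^sup>2 + 2 * t\<^sup>2"
          by (simp add: power2_eq_square algebra_simps)
        then show ?thesis using zero_le_power2[of "3 * s - t"] zero_le_power2[of t] by linarith
      qed
      then show ?thesis .
    qed
    finally show ?thesis by (simp add: power_mult_distrib)
  qed
  have "S\<^sup>2 * (LINT x|lborel. (weighted_size (2 * b) u x)\<^sup>2) = (LINT x|lborel. S\<^sup>2 * (weighted_size (2 * b) u x)\<^sup>2)" by simp
  also have "\<dots> \<le> (LINT x|lborel. 18 * (cmod (v x))\<^sup>2 + 18 * (cmod (vderiv v x))\<^sup>2)"
    using in_L2_derivs_dominated[OF v] in_L2_derivs_dominated[of n "vderiv v"] v int
    by (intro integral_mono pw) (auto simp: in_L2_def)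
  also have "\<dots> = 18 * (H1_norm v)\<^sup>2"
    unfolding H1_norm_def using in_L2_derivs_dominated[OF v] in_L2_derivs_dominated[of n "vderiv v"] v
    by (simp add: in_L2_def L2_norm_power2)
  finally show "S\<^sup>2 * (LINT x|lborel. (weighted_size (2 * b) u x)\<^sup>2) \<le> 18 * (H1_norm v)\<^sup>2" .
qed

lemma derivs_dominated_4_D:
  assumes "derivs_dominated 4 \<rho> f" shows "f differentiable at x" "derivs_dominated 3 \<rho> (vderiv f)"
  using assms derivs_dominated.simps(2)[of 3 \<rho> f] by simp_all

theorem lemma28:
  fixes \<alpha> :: real
  assumes "1 \<le> \<alpha>" and "\<alpha> \<le> 2"
  shows "\<exists>C>0. \<forall>(\<mu>1::real) (\<mu>2::real) (u :: real \<Rightarrow> complex) (A::real).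
           \<mu>1 > -1 \<longrightarrow> \<mu>2 > -1 \<longrightarrow> schwartz u \<longrightarrow> A > 1 \<longrightarrow>
             in_L2 (commutator (abs_D \<alpha>) (mult_op (phi1_A \<alpha> \<mu>1 \<mu>2 A)) u) \<and>
             in_H1 (mult_op (Phi1_A \<alpha> \<mu>1 \<mu>2 A) u) \<and>
             L2_norm (commutator (abs_D \<alpha>) (mult_op (phi1_A \<alpha> \<mu>1 \<mu>2 A)) u)
               \<le> C * \<bar>1 / (1 + \<mu>1)\<^sup>2 - 1 / (1 + \<mu>2)\<^sup>2\<bar> powr (1 / 2)
                   * H1_norm (mult_op (Phi1_A \<alpha> \<mu>1 \<mu>2 A) u)"
proof -
  define K where "K = 1 + 3 / bracket_integral \<alpha>"
  define L where "L = weight_estimate.commutator_const \<alpha>"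
  \<comment> \<open>The factor 18 is lost in passing from the square of the weighted size to that of the \<open>H\<^sup>1\<close> norm, and \<open>bracket_integral \<alpha>\<close> comes from the normalisation of \<open>\<Phi>\<^sub>1\<close>.\<close>
  define C2 where "C2 = 18 * L * K\<^sup>2 * bracket_integral \<alpha>"
  have Z: "0 < bracket_integral \<alpha>" unfolding bracket_integral_def using assms by (intro LINT_bracket_pos) auto
  have main: "in_L2 (commutator (abs_D \<alpha>) (mult_op (phi1_A \<alpha> \<mu>1 \<mu>2 A)) u) \<and>
             in_H1 (mult_op (Phi1_A \<alpha> \<mu>1 \<mu>2 A) u) \<and>
             (L2_norm (commutator (abs_D \<alpha>) (mult_op (phi1_A \<alpha> \<mu>1 \<mu>2 A)) u))\<^sup>2
               \<le> C2 * \<bar>1 / (1 + \<mu>1)\<^sup>2 - 1 / (1 + \<mu>2)\<^sup>2\<bar>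
                   * (H1_norm (mult_op (Phi1_A \<alpha> \<mu>1 \<mu>2 A) u))\<^sup>2"
    if su: "schwartz u" and A: "A > 1" for \<mu>1 \<mu>2 A :: real and u
  proof -
    define b where "b = 1 / (1 + \<mu>1)\<^sup>2 - 1 / (1 + \<mu>2)\<^sup>2"
    define S where "S = sqrt (\<bar>b\<bar> / bracket_integral \<alpha>)"
    define u1 where "u1 = (\<lambda>x. u (A * x))"
    define v1 where "v1 = (\<lambda>x. complex_of_real (S * bracket ((1 + \<alpha>) / 4) x) * u1 x)"
    define com where "com = commutator (abs_D \<alpha>) (mult_op (phi1 \<alpha> \<mu>1 \<mu>2)) u1"
    note ph = phi1_weight_estimate[OF assms, of \<mu>1 \<mu>2, folded b_def]
    interpret weight_estimate \<alpha> "\<bar>b\<bar> * K" "phi1 \<alpha> \<mu>1 \<mu>2" "\<lambda>y. b / bracket_integral \<alpha> * bracket ((1 + \<alpha>) / 2) y"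
      "\<lambda>y. b / bracket_integral \<alpha> * (- (1 + \<alpha>) * (slope y * bracket ((1 + \<alpha>) / 2) y))"
      unfolding K_def by (rule ph(1))
    have A0: "0 < A" "1 \<le> A" using A by auto
    have u1: "derivs_dominated 4 inv_quad u1"
      unfolding u1_def by (rule derivs_dominated_weaken[OF derivs_dominated_scale[OF schwartz_derivs_dominated[OF su] inv_quad_nonneg] inv_quad_scale_le(1)[OF A0(2)] inv_quad_nonneg])
    have 4: "4 = Suc 3" by simp
    have bb: "2 * ((1 + \<alpha>) / 4) = (1 + \<alpha>) / 2" by simp
    have S2: "S\<^sup>2 = \<bar>b\<bar> / bracket_integral \<alpha>" "0 \<le> S" using Z by (auto simp: S_def)
    note W = weighted_size_le_H1[OF u1[unfolded 4] S2(2), of "(1 + \<alpha>) / 4", folded v1_def, unfolded bb, folded \<beta>_def]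
    have v1: "derivs_dominated 4 inv_quad v1" and W2: "S\<^sup>2 * (LINT x|lborel. (weighted_size \<beta> u1 x)\<^sup>2) \<le> 18 * (H1_norm v1)\<^sup>2"
      and W3: "integrable lborel (\<lambda>x. (weighted_size \<beta> u1 x)\<^sup>2)"
      using W assms by auto
    define I where "I = (LINT x|lborel. (weighted_size \<beta> u1 x)\<^sup>2)"
    have I0: "0 \<le> I" unfolding I_def by simp
    have L0: "0 \<le> L" unfolding L_def by (rule commutator_const_nonneg)
    have comm_meas: "com \<in> borel_measurable borel"
    proof -
      have [measurable]: "u1 \<in> borel_measurable borel" by (rule derivs_dominated_measurable[OF u1])
      have [measurable]: "phi1 \<alpha> \<mu>1 \<mu>2 \<in> borel_measurable borel"
        by (intro borel_measurable_continuous_onI continuous_at_imp_continuous_on ballI DERIV_isCont[OF g])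
      have m: "mult_op (phi1 \<alpha> \<mu>1 \<mu>2) u1 \<in> borel_measurable borel"
        unfolding mult_op_def[abs_def] by measurable
      note [measurable] = abs_D_measurable[OF m, of \<alpha>] abs_D_measurable[OF \<open>u1 \<in> borel_measurable borel\<close>, of \<alpha>]
      show ?thesis unfolding com_def commutator_def[abs_def] mult_op_def[of _ "abs_D \<alpha> u1"] by measurable
    qed
    have "(\<integral>\<^sup>+x. ennreal ((cmod (com x))\<^sup>2) \<partial>lborel) \<le> ennreal (L * (\<bar>b\<bar> * K)\<^sup>2) * (\<integral>\<^sup>+y. ennreal ((weighted_size \<beta> u1 y)\<^sup>2) \<partial>lborel)"
      unfolding com_def L_def by (rule commutator_L2[OF u1 ph(2)])
    also have "(\<integral>\<^sup>+y. ennreal ((weighted_size \<beta> u1 y)\<^sup>2) \<partial>lborel) = ennreal I"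
      unfolding I_def by (intro nn_integral_eq_integral W3) auto
    also have "ennreal (L * (\<bar>b\<bar> * K)\<^sup>2) * ennreal I = ennreal (L * (\<bar>b\<bar> * K)\<^sup>2 * I)"
      using L0 I0 by (simp add: ennreal_mult)
    finally have com: "in_L2 com" "(L2_norm com)\<^sup>2 \<le> L * (\<bar>b\<bar> * K)\<^sup>2 * I"
      using in_L2_nn_integral[OF comm_meas, of "L * (\<bar>b\<bar> * K)\<^sup>2 * I"] L0 I0 by auto
    have com_le: "(L2_norm com)\<^sup>2 \<le> C2 * \<bar>b\<bar> * (H1_norm v1)\<^sup>2"
    proof -
      \<comment> \<open>\<open>\<bar>b\<bar>\<^sup>2\<close> splits into the factor \<open>\<bar>b\<bar>\<close> of the claim and the factor \<open>\<bar>b\<bar>\<close> contained in \<open>S\<^sup>2\<close>; division by \<open>S\<close>, which vanishes for \<open>b = 0\<close>, is avoided.\<close>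
      have "L * (\<bar>b\<bar> * K)\<^sup>2 * I = L * K\<^sup>2 * \<bar>b\<bar> * bracket_integral \<alpha> * (S\<^sup>2 * I)"
        unfolding S2(1) using Z by (simp add: power2_eq_square)
      also have "\<dots> \<le> L * K\<^sup>2 * \<bar>b\<bar> * bracket_integral \<alpha> * (18 * (H1_norm v1)\<^sup>2)"
        using W2 L0 Z unfolding I_def by (intro mult_left_mono) auto
      also have "\<dots> = C2 * \<bar>b\<bar> * (H1_norm v1)\<^sup>2" by (simp add: C2_def)
      finally show ?thesis using com(2) by simp
    qed
    have eq_com: "commutator (abs_D \<alpha>) (mult_op (phi1_A \<alpha> \<mu>1 \<mu>2 A)) u = (\<lambda>x. complex_of_real (A powr (- \<alpha>)) * com (x / A))"
      unfolding com_def u1_def using commutator_scale[OF A0(1), of \<alpha> "phi1 \<alpha> \<mu>1 \<mu>2" u]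
      by (simp add: fun_eq_iff phi1_A_def[abs_def])
    have eq_v: "mult_op (Phi1_A \<alpha> \<mu>1 \<mu>2 A) u = (\<lambda>x. v1 (1 / A * x))"
      unfolding mult_op_def[abs_def] Phi1_A_def ph(3) v1_def u1_def S_def using A0 by simp
    have dv1: "v1 differentiable at x" for x by (rule derivs_dominated_4_D[OF v1])
    have v: "derivs_dominated 4 inv_quad (\<lambda>x. v1 (1 / A * x))"
      by (rule derivs_dominated_weaken[OF derivs_dominated_scale[OF v1 inv_quad_nonneg] inv_quad_scale_le(2)[OF A0(2)] inv_quad_nonneg])
    have v': "vderiv (\<lambda>x. v1 (1 / A * x)) = (\<lambda>x. complex_of_real (1 / A) * vderiv v1 (x / A))"
      using vderiv_scale[OF dv1, of "1 / A"] by simp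
    have H1: "in_H1 (\<lambda>x. v1 (1 / A * x))"
      unfolding in_H1_def using in_L2_derivs_dominated[OF v] in_L2_derivs_dominated[OF derivs_dominated_4_D(2)[OF v]] derivs_dominated_4_D(1)[OF v] by blast
    have "(H1_norm (\<lambda>x. v1 (1 / A * x)))\<^sup>2 = A * (L2_norm v1)\<^sup>2 + 1 / A * (L2_norm (vderiv v1))\<^sup>2"
      unfolding H1_norm_def v' using L2_norm_scale[OF A0(1), of 1 v1] L2_norm_scale[OF A0(1), of "complex_of_real (1 / A)" "vderiv v1"] A0
      by (simp add: power2_eq_square norm_divide)
    moreover have "A * (H1_norm (\<lambda>x. v1 (1 / A * x)))\<^sup>2 \<ge> (H1_norm v1)\<^sup>2"
    proof -
      have "1 * (L2_norm v1)\<^sup>2 \<le> (A * A) * (L2_norm v1)\<^sup>2"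
        using A0 mult_mono[of 1 A 1 A] by (intro mult_right_mono) auto
      then show ?thesis unfolding calculation using A0 by (simp add: H1_norm_def distrib_left)
    qed
    ultimately have H1_le: "(H1_norm v1)\<^sup>2 \<le> A * (H1_norm (\<lambda>x. v1 (1 / A * x)))\<^sup>2" by simp
    have "(L2_norm (\<lambda>x. complex_of_real (A powr (- \<alpha>)) * com (x / A)))\<^sup>2 = (A powr (- \<alpha>))\<^sup>2 * A * (L2_norm com)\<^sup>2"
      using L2_norm_scale[OF A0(1), of "complex_of_real (A powr (- \<alpha>))" com] by simp
    also have "\<dots> \<le> (A powr (- \<alpha>))\<^sup>2 * A * (C2 * \<bar>b\<bar> * (A * (H1_norm (\<lambda>x. v1 (1 / A * x)))\<^sup>2))"
      using A0 L0 Z by (intro mult_left_mono order.trans[OF com_le] H1_le) (auto simp: C2_def)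
    also have "\<dots> = (A powr (- \<alpha>) * A)\<^sup>2 * (C2 * \<bar>b\<bar> * (H1_norm (\<lambda>x. v1 (1 / A * x)))\<^sup>2)"
      by (simp add: power2_eq_square)
    also have "\<dots> \<le> 1 * (C2 * \<bar>b\<bar> * (H1_norm (\<lambda>x. v1 (1 / A * x)))\<^sup>2)"
    proof (rule mult_right_mono)
      have "A powr (- \<alpha>) * A = A powr (1 - \<alpha>)" using A0 powr_add[of A "- \<alpha>" 1] by simp
      also have "\<dots> \<le> A powr 0" using A0 assms by (intro powr_mono) auto
      finally show "(A powr (- \<alpha>) * A)\<^sup>2 \<le> 1" using A0 by (intro power_le_one) auto
    qed (use L0 Z in \<open>auto simp: C2_def\<close>)
    finally show ?thesis
      unfolding eq_com eq_v b_def[symmetric] using in_L2_scale[OF A0(1) com(1)] H1 by simp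
  qed
  show ?thesis
  \<comment> \<open>The summand 1 makes the constant positive without an argument that \<open>C2\<close> is.\<close>
  proof (intro exI[of _ "sqrt \<bar>C2\<bar> + 1"] conjI allI impI)
    show "0 < sqrt \<bar>C2\<bar> + 1" by (smt (verit) real_sqrt_ge_zero abs_ge_zero)
    fix \<mu>1 \<mu>2 :: real and u :: "real \<Rightarrow> complex" and A :: real
    assume "schwartz u" "1 < A"
    note m = main[OF this, of \<mu>1 \<mu>2]
    then show "in_L2 (commutator (abs_D \<alpha>) (mult_op (phi1_A \<alpha> \<mu>1 \<mu>2 A)) u)"
      "in_H1 (mult_op (Phi1_A \<alpha> \<mu>1 \<mu>2 A) u)" by auto
    define b where "b = \<bar>1 / (1 + \<mu>1)\<^sup>2 - 1 / (1 + \<mu>2)\<^sup>2\<bar>"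
    define h where "h = H1_norm (mult_op (Phi1_A \<alpha> \<mu>1 \<mu>2 A) u)"
    have bh: "0 \<le> b" "0 \<le> h" by (auto simp: b_def h_def H1_norm_def)
    have "(L2_norm (commutator (abs_D \<alpha>) (mult_op (phi1_A \<alpha> \<mu>1 \<mu>2 A)) u))\<^sup>2 \<le> C2 * b * h\<^sup>2"
      using m unfolding b_def h_def by blast
    also have "\<dots> \<le> \<bar>C2\<bar> * b * h\<^sup>2" using bh by (intro mult_right_mono) auto
    finally have "L2_norm (commutator (abs_D \<alpha>) (mult_op (phi1_A \<alpha> \<mu>1 \<mu>2 A)) u) \<le> sqrt (\<bar>C2\<bar> * b * h\<^sup>2)"
      by (rule real_le_rsqrt)
    also have "\<dots> = sqrt \<bar>C2\<bar> * b powr (1 / 2) * h"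
      using bh by (simp add: real_sqrt_mult powr_half_sqrt)
    also have "\<dots> \<le> (sqrt \<bar>C2\<bar> + 1) * b powr (1 / 2) * h"
      using bh by (intro mult_right_mono) auto
    finally show "L2_norm (commutator (abs_D \<alpha>) (mult_op (phi1_A \<alpha> \<mu>1 \<mu>2 A)) u)
        \<le> (sqrt \<bar>C2\<bar> + 1) * \<bar>1 / (1 + \<mu>1)\<^sup>2 - 1 / (1 + \<mu>2)\<^sup>2\<bar> powr (1 / 2)
          * H1_norm (mult_op (Phi1_A \<alpha> \<mu>1 \<mu>2 A) u)"
      unfolding b_def h_def .
  qed
qed

end
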